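(* Let $(k_n)_n$, $(l_n)_n$ be sequences of positive integers with $k_n\to\infty$ and $l_n\to\infty$. Every group isomorphism $\varphi:\mathrm{U}^{\mathrm{HS}}[(k_n)_n]\to\mathrm{U}^{\mathrm{HS}}[(l_n)_n]$ induces an automorphism (self-homeomorphism) $\theta$ of the Stone--Čech boundary $\partial\beta\mathbb N$ which has the following two properties: (1) for all $a,b\in\mathrm{U}^{\mathrm{HS}}[(k_n)_n]$ and any infinite subset $S\subseteq\mathbb N$, we have $$a=_S b\iff\varphi(a)=_{\theta(S)}\varphi(b);$$ (2) for every nonprincipal ultrafilter $\mathcal U\in\partial\beta\mathbb N$, the isomorphism $\varphi$ induces an isomorphism $\varphi_{\mathcal U}$ between the metric ultraproduct groups $\prod_n\mathrm{U}(k_n)/\mathcal U$ and $\prod_n\mathrm{U}(l_n)/\theta^{-1}(\mathcal U)$.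
   Context: For $k\ge 1$, $\mathrm{U}(k)$ is the group of unitary complex $k\times k$ matrices, $\|x\|_{2,k}=(\frac1k\mathrm{tr}(x^*x))^{1/2}$, and $d^{\mathrm{HS}}_k(x,y)=\|x-y\|_{2,k}$. For a sequence $(k_n)_n$ of positive integers with $k_n\to\infty$, $\mathrm{U}^{\mathrm{HS}}[(k_n)_n]$ is the quotient of the group $\prod_n\mathrm{U}(k_n)$ by the normal subgroup of sequences $(u_n)_n$ with $d^{\mathrm{HS}}_{k_n}(u_n,1)\to0$; $[u_n]_n$ denotes the class of $(u_n)_n$. For $a=[a_n]_n,b=[b_n]_n\in\mathrm{U}^{\mathrm{HS}}[(k_n)_n]$ and $S\subseteq\mathbb N$, write $a=_S b$ if $\lim_{n\in S}d^{\mathrm{HS}}_{k_n}(a_n,b_n)=0$ (vacuous if $S$ is finite); this depends only on the class of $S$ in $\mathscr P(\mathbb N)/\mathrm{Fin}$, where $\mathrm{Fin}$ is the ideal of finite sets. $\partial\beta\mathbb N=\beta\mathbb N\setminus\mathbb N$ is the space of nonprincipal ultrafilters on $\mathbb N$. By Stone duality a self-homeomorphism $\theta$ of $\partial\beta\mathbb N$ corresponds to a Boolean algebra automorphism of $\mathscr P(\mathbb N)/\mathrm{Fin}$, denoted by the same symbol, via $S\in\theta(\mathcal U)\iff\theta(S)\in\mathcal U$. The metric ultraproduct $\prod_n\mathrm{U}(k_n)/\mathcal U$ is the quotient of $\prod_n\mathrm{U}(k_n)$ by the normal subgroup of sequences with $\lim_{n\to\mathcal U}d^{\mathrm{HS}}_{k_n}(u_n,1)=0$;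 it is a quotient of $\mathrm{U}^{\mathrm{HS}}[(k_n)_n]$. That $\varphi$ induces $\varphi_{\mathcal U}$ means that $\varphi_{\mathcal U}$ sends the class of $a$ modulo $\mathcal U$ to the class of $\varphi(a)$ modulo $\theta^{-1}(\mathcal U)$. *)

theory Defs
  imports
    "HOL-Analysis.Abstract_Topology"
    "HOL-Algebra.Coset"
    "HOL-Algebra.Product_Groups"
    "Jordan_Normal_Form.Schur_Decomposition"
begin

section \<open>Unitary groups and the normalized Hilbert--Schmidt metric\<close>

definition unitary_group :: "nat \<Rightarrow> complex mat monoid" where
  "unitary_group k =
     \<lparr>carrier = {u \<in> carrier_mat k k. mat_adjoint u * u = 1\<^sub>m k \<and> u * mat_adjoint u = 1\<^sub>m k},
      monoid.mult = (*), one = 1\<^sub>m k\<rparr>"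

definition mat_trace :: "'a::comm_monoid_add mat \<Rightarrow> 'a" where
  "mat_trace x = (\<Sum>i<dim_row x. x $$ (i, i))"

text \<open>The trace of \<open>x\<^sup>* x\<close> is a nonnegative real number, so that taking \<open>Re\<close> only changes its type.\<close>

definition hs_norm :: "nat \<Rightarrow> complex mat \<Rightarrow> real" where
  "hs_norm k x = sqrt (1 / real k * Re (mat_trace (mat_adjoint x * x)))"

definition hs_dist :: "nat \<Rightarrow> complex mat \<Rightarrow> complex mat \<Rightarrow> real" where
  "hs_dist k x y = hs_norm k (x - y)"

section \<open>Reduced products and metric ultraproducts\<close>

definition unitary_seqs :: "(nat \<Rightarrow> nat) \<Rightarrow> (nat \<Rightarrow> complex mat) monoid" where
  "unitary_seqs k = product_group UNIV (\<lambda>n. unitary_group (k n))"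

text \<open>
  Both the reduced product modulo \<open>Fin\<close> and the metric ultraproducts are quotients by the sequences
  whose distance to the identity tends to \<open>0\<close> along a filter: \<open>sequentially\<close> in the former case,
  the ultrafilter in the latter.
\<close>

definition null_seqs :: "(nat \<Rightarrow> nat) \<Rightarrow> nat filter \<Rightarrow> (nat \<Rightarrow> complex mat) set" where
  "null_seqs k F =
     {u \<in> carrier (unitary_seqs k). ((\<lambda>n. hs_dist (k n) (u n) (1\<^sub>m (k n))) \<longlongrightarrow> 0) F}"

definition seq_class ::
    "(nat \<Rightarrow> nat) \<Rightarrow> nat filter \<Rightarrow> (nat \<Rightarrow> complex mat) \<Rightarrow> (nat \<Rightarrow> complex mat) set" where
  "seq_class k F u = null_seqs k F #>\<^bsub>unitary_seqs k\<^esub> u"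

definition U_HS :: "(nat \<Rightarrow> nat) \<Rightarrow> (nat \<Rightarrow> complex mat) set monoid" where
  "U_HS k = unitary_seqs k Mod null_seqs k sequentially"

definition metric_ultraproduct ::
    "(nat \<Rightarrow> nat) \<Rightarrow> nat filter \<Rightarrow> (nat \<Rightarrow> complex mat) set monoid" where
  "metric_ultraproduct k U = unitary_seqs k Mod null_seqs k U"

section \<open>The Boolean algebra of sets of natural numbers modulo finite sets\<close>

definition eq_mod_fin :: "nat set \<Rightarrow> nat set \<Rightarrow> bool" where
  "eq_mod_fin S T \<longleftrightarrow> finite ((S - T) \<union> (T - S))"

lemma eq_mod_fin_refl: "eq_mod_fin S S"
  by (simp add: eq_mod_fin_def)

lemma eq_mod_fin_sym: "eq_mod_fin S T \<Longrightarrow> eq_mod_fin T S"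
  by (simp add: eq_mod_fin_def)

lemma eq_mod_fin_trans:
  assumes "eq_mod_fin S T" "eq_mod_fin T R"
  shows "eq_mod_fin S R"
  unfolding eq_mod_fin_def
  by (rule finite_subset[of _ "((S - T) \<union> (T - S)) \<union> ((T - R) \<union> (R - T))"])
    (use assms in \<open>auto simp: eq_mod_fin_def\<close>)

quotient_type pow_mod_fin = "nat set" / eq_mod_fin
  morphisms rep_mod_fin class_mod_fin
  by (intro equivpI reflpI sympI transpI) (blast intro: eq_mod_fin_refl eq_mod_fin_sym eq_mod_fin_trans)+

instantiation pow_mod_fin :: boolean_algebra
begin

lift_definition inf_pow_mod_fin :: "pow_mod_fin \<Rightarrow> pow_mod_fin \<Rightarrow> pow_mod_fin" is "(\<inter>)"
proof -
  fix A A' B B' assume "eq_mod_fin A A'" "eq_mod_fin B B'"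
  then have "finite ((A - A') \<union> (A' - A) \<union> ((B - B') \<union> (B' - B)))"
    by (simp add: eq_mod_fin_def)
  then show "eq_mod_fin (A \<inter> B) (A' \<inter> B')"
    unfolding eq_mod_fin_def by (rule finite_subset[rotated]) auto
qed

lift_definition sup_pow_mod_fin :: "pow_mod_fin \<Rightarrow> pow_mod_fin \<Rightarrow> pow_mod_fin" is "(\<union>)"
proof -
  fix A A' B B' assume "eq_mod_fin A A'" "eq_mod_fin B B'"
  then have "finite ((A - A') \<union> (A' - A) \<union> ((B - B') \<union> (B' - B)))"
    by (simp add: eq_mod_fin_def)
  then show "eq_mod_fin (A \<union> B) (A' \<union> B')"
    unfolding eq_mod_fin_def by (rule finite_subset[rotated]) auto
qed

lift_definition minus_pow_mod_fin :: "pow_mod_fin \<Rightarrow> pow_mod_fin \<Rightarrow> pow_mod_fin" is "(-)"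
proof -
  fix A A' B B' assume "eq_mod_fin A A'" "eq_mod_fin B B'"
  then have "finite ((A - A') \<union> (A' - A) \<union> ((B - B') \<union> (B' - B)))"
    by (simp add: eq_mod_fin_def)
  then show "eq_mod_fin (A - B) (A' - B')"
    unfolding eq_mod_fin_def by (rule finite_subset[rotated]) auto
qed

lift_definition uminus_pow_mod_fin :: "pow_mod_fin \<Rightarrow> pow_mod_fin" is "uminus"
proof -
  fix A A' assume "eq_mod_fin A A'"
  then show "eq_mod_fin (- A) (- A')"
    unfolding eq_mod_fin_def by (elim finite_subset[rotated]) auto
qed

lift_definition bot_pow_mod_fin :: "pow_mod_fin" is "{}" .

lift_definition top_pow_mod_fin :: "pow_mod_fin" is "UNIV" .

lift_definition less_eq_pow_mod_fin :: "pow_mod_fin \<Rightarrow> pow_mod_fin \<Rightarrow> bool"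
  is "\<lambda>S T. finite (S - T)"
proof -
  fix A A' B B' assume "eq_mod_fin A A'" "eq_mod_fin B B'"
  then have fin: "finite (A - A')" "finite (A' - A)" "finite (B - B')" "finite (B' - B)"
    by (auto simp: eq_mod_fin_def)
  have "A - B \<subseteq> (A - A') \<union> (A' - B') \<union> (B' - B)" "A' - B' \<subseteq> (A' - A) \<union> (A - B) \<union> (B - B')"
    by auto
  with fin show "finite (A - B) = finite (A' - B')"
    by (meson finite_UnI finite_subset)
qed

definition less_pow_mod_fin :: "pow_mod_fin \<Rightarrow> pow_mod_fin \<Rightarrow> bool" where
  "less_pow_mod_fin x y \<longleftrightarrow> x \<le> y \<and> \<not> y \<le> x"

instance
proof
  fix x y z :: pow_mod_fin
  show "(x < y) = (x \<le> y \<and> \<not> y \<le> x)" by (rule less_pow_mod_fin_def)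
  show "x \<le> x" by transfer simp
  show "x \<le> z" if "x \<le> y" "y \<le> z"
    using that
  proof transfer
    fix S T R :: "nat set" assume "finite (S - T)" "finite (T - R)"
    then show "finite (S - R)" by (auto intro: finite_subset[of _ "(S - T) \<union> (T - R)"])
  qed
  show "x = y" if "x \<le> y" "y \<le> x" using that by transfer (simp add: eq_mod_fin_def)
  show "inf x y \<le> x" "inf x y \<le> y" "x \<le> sup x y" "y \<le> sup x y"
    by (transfer; auto intro: finite_subset[OF _ finite.emptyI])+
  show "x \<le> inf y z" if "x \<le> y" "x \<le> z"
    using that by transfer (simp add: Diff_Int)
  show "sup y z \<le> x" if "y \<le> x" "z \<le> x"
    using that by transfer (simp add: Un_Diff)
  show "bot \<le> x" "x \<le> Orderings.top" by (transfer; simp)+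
  show "sup x (inf y z) = inf (sup x y) (sup x z)"
    by transfer (simp add: Un_Int_distrib eq_mod_fin_refl)
  show "inf x (- x) = bot" "sup x (- x) = Orderings.top" "x - y = inf x (- y)"
    by (transfer; simp add: eq_mod_fin_refl Diff_eq)+
qed

end

definition boolean_automorphism :: "('a::boolean_algebra \<Rightarrow> 'a) \<Rightarrow> bool" where
  "boolean_automorphism h \<longleftrightarrow>
     bij h \<and> h bot = bot \<and> h Orderings.top = Orderings.top \<and> (\<forall>x. h (- x) = - h x) \<and>
     (\<forall>x y. h (inf x y) = inf (h x) (h y) \<and> h (sup x y) = sup (h x) (h y))"

section \<open>Equality of classes of sequences along a set\<close>

lemma sequentially_principal_cong:
  assumes "eq_mod_fin S T"
  shows "inf sequentially (principal S) = inf sequentially (principal T)"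
proof -
  from assms have "finite ((S - T) \<union> (T - S))" by (simp add: eq_mod_fin_def)
  then obtain m where m: "\<And>n. n \<in> (S - T) \<union> (T - S) \<Longrightarrow> n < m"
    by (meson finite_nat_set_iff_bounded)
  have "\<forall>\<^sub>F n in sequentially. n \<in> S \<longleftrightarrow> n \<in> T"
    by (rule eventually_sequentiallyI[of m]) (use m in force)
  then have "(\<forall>\<^sub>F n in sequentially. n \<in> S \<longrightarrow> P n) \<longleftrightarrow> (\<forall>\<^sub>F n in sequentially. n \<in> T \<longrightarrow> P n)" for P
    by (rule eventually_subst[OF eventually_mono]) blast
  then show ?thesis
    by (simp add: filter_eq_iff eventually_inf_principal)
qed

text \<open>
  The relation \<open>a =\<^sub>S b\<close> for the class of \<open>S\<close> modulo \<open>Fin\<close>. Elements of \<^const>\<open>U_HS\<close> are cosets, whose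
  elements are precisely the representing sequences; the limit does not depend on the
  representatives. For finite \<open>S\<close> the filter below is \<^term>\<open>bot\<close>, and the condition is vacuous.
\<close>

lift_definition eq_along ::
    "(nat \<Rightarrow> nat) \<Rightarrow> pow_mod_fin \<Rightarrow> (nat \<Rightarrow> complex mat) set \<Rightarrow> (nat \<Rightarrow> complex mat) set \<Rightarrow> bool"
  is "\<lambda>k S a b. \<forall>u\<in>a. \<forall>v\<in>b.
        ((\<lambda>n. hs_dist (k n) (u n) (v n)) \<longlongrightarrow> 0) (inf sequentially (principal S))"
  by (simp add: sequentially_principal_cong)

section \<open>The Stone--Cech boundary of the natural numbers\<close>

text \<open>
  Ultrafilters are represented by the type \<^typ>\<open>nat filter\<close>: a set \<open>S\<close> belongs to \<open>U\<close> iff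
  \<^term>\<open>eventually (\<lambda>n. n \<in> S) U\<close>. The natural number \<open>n\<close> is identified with \<^term>\<open>principal {n}\<close>.
\<close>

definition ultrafilter :: "'a filter \<Rightarrow> bool" where
  "ultrafilter U \<longleftrightarrow> U \<noteq> bot \<and> (\<forall>P. eventually P U \<or> eventually (\<lambda>x. \<not> P x) U)"

definition stone_cech_nat :: "nat filter topology" where
  "stone_cech_nat =
     topology_generated_by (range (\<lambda>S. {U. ultrafilter U \<and> eventually (\<lambda>n. n \<in> S) U}))"

definition stone_cech_boundary :: "nat filter topology" where
  "stone_cech_boundary = subtopology stone_cech_nat (- range (\<lambda>n. principal {n}))"

lemma topspace_stone_cech_boundary:
  "topspace stone_cech_boundary = {U. ultrafilter U \<and> (\<forall>n. U \<noteq> principal {n})}"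
  by (auto simp: stone_cech_boundary_def stone_cech_nat_def topology_generated_by_topspace
      intro!: exI[of _ UNIV])

definition class_in_ultrafilter :: "pow_mod_fin \<Rightarrow> nat filter \<Rightarrow> bool" where
  "class_in_ultrafilter x U \<longleftrightarrow> (\<exists>S. x = class_mod_fin S \<and> eventually (\<lambda>n. n \<in> S) U)"

lemma nonprincipal_le_sequentially:
  assumes "U \<in> topspace stone_cech_boundary"
  shows "U \<le> sequentially"
proof -
  from assms have U: "ultrafilter U" "\<And>n. U \<noteq> principal {n}"
    by (auto simp: topspace_stone_cech_boundary)
  have "eventually (\<lambda>m. m \<noteq> n) U" for n
  proof (rule ccontr)
    assume "\<not> eventually (\<lambda>m. m \<noteq> n) U"
    with U(1) have n: "eventually (\<lambda>m. m = n) U"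
      unfolding ultrafilter_def by (metis (mono_tags, lifting) eventually_mono)
    have "eventually P U \<longleftrightarrow> P n" for P
    proof
      assume "eventually P U"
      with n have "eventually (\<lambda>m. m = n \<and> P m) U" by (rule eventually_conj)
      with U(1) show "P n" by (auto simp: ultrafilter_def dest: eventually_happens')
    next
      assume "P n" with n show "eventually P U" by (auto elim: eventually_mono)
    qed
    then have "U = principal {n}" by (simp add: filter_eq_iff eventually_principal)
    with U(2) show False by blast
  qed
  then have "eventually (\<lambda>m. \<forall>n\<in>{..<N}. m \<noteq> n) U" for N
    by (intro eventually_ball_finite) auto
  then have "eventually (\<lambda>m. N \<le> m) U" for N
    by (rule eventually_mono) (auto simp: not_less[symmetric])
  then show ?thesis
    unfolding le_filter_def eventually_sequentially by (blast intro: eventually_mono)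
qed

lemma class_in_ultrafilter_iff:
  assumes "U \<in> topspace stone_cech_boundary"
  shows "class_in_ultrafilter (class_mod_fin S) U \<longleftrightarrow> eventually (\<lambda>n. n \<in> S) U"
proof
  assume "class_in_ultrafilter (class_mod_fin S) U"
  then obtain T where T: "eq_mod_fin S T" "eventually (\<lambda>n. n \<in> T) U"
    by (auto simp: class_in_ultrafilter_def pow_mod_fin.abs_eq_iff)
  have "eventually (\<lambda>n. n \<in> S) (inf sequentially (principal T))"
    using sequentially_principal_cong[OF T(1)] by (metis (mono_tags, lifting) eventually_inf_principal
        eventually_True always_eventually)
  then have "eventually (\<lambda>n. n \<in> T \<longrightarrow> n \<in> S) U"
    using filter_leD[OF nonprincipal_le_sequentially[OF assms]]
    by (simp add: eventually_inf_principal)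
  with T(2) show "eventually (\<lambda>n. n \<in> S) U" by (rule eventually_rev_mp)
qed (auto simp: class_in_ultrafilter_def)

definition stone_dual :: "(nat filter \<Rightarrow> nat filter) \<Rightarrow> (pow_mod_fin \<Rightarrow> pow_mod_fin) \<Rightarrow> bool" where
  "stone_dual \<theta> \<Theta> \<longleftrightarrow>
     boolean_automorphism \<Theta> \<and>
     (\<forall>U\<in>topspace stone_cech_boundary. \<forall>x.
        class_in_ultrafilter x (\<theta> U) \<longleftrightarrow> class_in_ultrafilter (\<Theta> x) U)"

end

theory Submission
  imports Defs
    "HOL-Analysis.L2_Norm"
    "Jordan_Normal_Form.Spectral_Radius"
    "HOL-Combinatorics.Permutations"
begin

text \<open>
  The group of unitary sequences modulo null sequences remembers the Boolean algebra of subsets of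
  \<open>\<nat>\<close> modulo finite sets as the lattice of its internal direct factors: these are exactly the
  subgroups of the elements that are trivial along a given set. Indeed, let \<open>G = M \<times> N\<close>. Every
  unitary is, up to an error of order \<open>1/\<surd>k\<close>, a commutator, so every element of \<open>M\<close> is a commutator
  of elements of \<open>M\<close>. On the other hand, if two unitaries are uniformly far from the scalars, then
  the first is uniformly far from commuting with some conjugate of the second. Since \<open>M\<close> commutes
  with all conjugates of elements of \<open>N\<close>, at each coordinate an element of \<open>M\<close> or an element of \<open>N\<close>
  is nearly scalar.
  Factoring an element that is nowhere nearly scalar decides which of the two holds where, and
  commutators of nearly scalar unitaries are nearly trivial.

  An isomorphism permutes direct factors, which yields the Boolean automorphism, the
  homeomorphism and the first property. For the second one, if \<open>u\<close> and \<open>u'\<close> are close along an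
  ultrafilter but their images are not, then a pseudo-intersection argument gives an infinite set
  along which \<open>u\<close> and \<open>u'\<close> are asymptotically equal, while their images stay apart along the
  corresponding set, against the first property.
\<close>

section \<open>Unitary matrices and the Hilbert--Schmidt norm\<close>

text \<open>Only the group structure is available for locating supports, and commutation cannot tell
  a scalar from the identity: comparing elements of \<open>M\<close> with conjugates from
  \<open>N\<close> controls them only modulo scalars. Rewriting an element of \<open>M\<close> as a
  commutator inside \<open>M\<close> removes this ambiguity, since commutators do not see scalar
  factors; this is why near-commutators are needed. The noncommutation estimate must not depend on
  the dimension, which tends to infinity. If both defects are at least \<open>\<epsilon>\<close>, a
  proportion \<open>\<epsilon>\<^sup>2 / 64\<close> of index pairs carries spectral gaps of size
  \<open>\<epsilon> / 4\<close> for both unitaries, and each such pair contributes at least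
  \<open>\<epsilon>\<^sup>2 / 32\<close> to the commutator; together they give the cubic bound
  \<open>\<epsilon> ^ 3 / 256\<close>. The conjugating unitary may be chosen separately at each
  coordinate, because any such choice is again an element of the product. A single conjugate of an
  element of \<open>N\<close> therefore tests all coordinates at once.\<close>

lemma mat_adjoint_carrier [simp]: "A \<in> carrier_mat m n \<Longrightarrow> mat_adjoint A \<in> carrier_mat n m"
  by (auto simp: mat_adjoint_def)

lemma dim_mat_adjoint [simp]: "dim_row (mat_adjoint A) = dim_col A" "dim_col (mat_adjoint A) = dim_row A"
  by (auto simp: mat_adjoint_def)

lemma index_mat_adjoint [simp]:
  "i < dim_col A \<Longrightarrow> j < dim_row A \<Longrightarrow> mat_adjoint A $$ (i, j) = conjugate (A $$ (j, i))"
  by (simp add: mat_adjoint_def mat_of_rows_index)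

lemma mat_adjoint_mat_adjoint [simp]: "mat_adjoint (mat_adjoint A) = A"
  by (rule eq_matI) auto

lemma mat_adjoint_mult:
  assumes "A \<in> carrier_mat m n" "B \<in> carrier_mat n p"
  shows "mat_adjoint (A * B) = mat_adjoint B * mat_adjoint (A :: 'a::conjugatable_field mat)"
  using assms
  by (intro eq_matI)
    (auto simp: scalar_prod_def sum_conjugate conjugate_dist_mul mult.commute intro!: sum.cong)

lemma mat_adjoint_one [simp]: "mat_adjoint (1\<^sub>m n) = (1\<^sub>m n :: complex mat)"
  by (rule eq_matI) auto

lemma index_mult_mat_sum:
  assumes "A \<in> carrier_mat m n" "B \<in> carrier_mat n p" "i < m" "j < p"
  shows "(A * B) $$ (i, j) = (\<Sum>t<n. A $$ (i, t) * B $$ (t, j))"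
  using assms by (auto simp: scalar_prod_def atLeast0LessThan)

lemma mat_trace_mult_commute:
  fixes A :: "'a::comm_ring_1 mat"
  assumes "A \<in> carrier_mat m n" "B \<in> carrier_mat n m"
  shows "mat_trace (A * B) = mat_trace (B * A)"
proof -
  have "mat_trace (A * B) = (\<Sum>i<m. \<Sum>t<n. A $$ (i, t) * B $$ (t, i))"
    using assms by (auto simp: mat_trace_def index_mult_mat_sum simp del: index_mult_mat(1) intro!: sum.cong)
  also have "\<dots> = (\<Sum>t<n. \<Sum>i<m. B $$ (t, i) * A $$ (i, t))"
    by (subst sum.swap) (simp add: mult.commute)
  also have "\<dots> = mat_trace (B * A)"
    using assms by (auto simp: mat_trace_def index_mult_mat_sum simp del: index_mult_mat(1) intro!: sum.cong)
  finally show ?thesis .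
qed

text \<open>Identifies the Hilbert--Schmidt norm with a Euclidean norm of the entries, so that its
  triangle inequality is Minkowski's.\<close>

lemma hs_norm_eq_L2_set:
  assumes "x \<in> carrier_mat k k"
  shows "hs_norm k x = L2_set (\<lambda>(i, j). cmod (x $$ (i, j))) ({..<k} \<times> {..<k}) / sqrt (real k)"
proof -
  have "Re (mat_trace (mat_adjoint x * x)) = (\<Sum>j<k. \<Sum>i<k. (cmod (x $$ (i, j)))\<^sup>2)"
    using assms
    by (auto simp: mat_trace_def scalar_prod_def atLeast0LessThan cmod_def power2_eq_square
        intro!: sum.cong)
  also have "\<dots> = (\<Sum>p\<in>{..<k} \<times> {..<k}. ((\<lambda>(i, j). cmod (x $$ (i, j))) p)\<^sup>2)"
    by (subst sum.swap) (simp add: sum.cartesian_product case_prod_unfold)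
  finally show ?thesis
    by (simp add: hs_norm_def L2_set_def real_sqrt_divide)
qed

lemma hs_norm_nonneg [simp]: "x \<in> carrier_mat k k \<Longrightarrow> 0 \<le> hs_norm k x"
  by (simp add: hs_norm_eq_L2_set L2_set_nonneg)

lemma hs_norm_triangle:
  assumes "x \<in> carrier_mat k k" "y \<in> carrier_mat k k"
  shows "hs_norm k (x + y) \<le> hs_norm k x + hs_norm k y"
proof -
  let ?I = "{..<k} \<times> {..<k}"
  have "L2_set (\<lambda>(i, j). cmod ((x + y) $$ (i, j))) ?I
      \<le> L2_set (\<lambda>p. (\<lambda>(i, j). cmod (x $$ (i, j))) p + (\<lambda>(i, j). cmod (y $$ (i, j))) p) ?I"
    using assms by (intro L2_set_mono) (auto intro: norm_triangle_ineq)
  also have "\<dots> \<le> L2_set (\<lambda>(i, j). cmod (x $$ (i, j))) ?I + L2_set (\<lambda>(i, j). cmod (y $$ (i, j))) ?I"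
    by (rule L2_set_triangle_ineq)
  finally show ?thesis
    using assms by (simp add: hs_norm_eq_L2_set divide_right_mono flip: add_divide_distrib)
qed

section \<open>Unitary groups and bi-invariance of the metric\<close>

abbreviation unitaries :: "nat \<Rightarrow> complex mat set" where
  "unitaries k \<equiv> carrier (unitary_group k)"

lemma unitariesD:
  assumes "u \<in> unitaries k"
  shows "u \<in> carrier_mat k k" "mat_adjoint u * u = 1\<^sub>m k" "u * mat_adjoint u = 1\<^sub>m k"
  using assms by (auto simp: unitary_group_def)

text \<open>A one-sided inverse of a square matrix is two-sided, so one of the two defining
  identities suffices.\<close>

lemma unitariesI:
  assumes "u \<in> carrier_mat k k" "mat_adjoint u * u = 1\<^sub>m k"
  shows "u \<in> unitaries k"
  using assms mat_mult_left_right_inverse[OF mat_adjoint_carrier[OF assms(1)] assms]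
  by (simp add: unitary_group_def)

lemma unitary_group_simps [simp]:
  "x \<otimes>\<^bsub>unitary_group k\<^esub> y = x * y" "\<one>\<^bsub>unitary_group k\<^esub> = 1\<^sub>m k"
  by (auto simp: unitary_group_def)

lemma one_unitaries [simp, intro]: "1\<^sub>m k \<in> unitaries k"
  by (rule unitariesI) auto

lemma mat_adjoint_unitaries [simp, intro]: "u \<in> unitaries k \<Longrightarrow> mat_adjoint u \<in> unitaries k"
  by (rule unitariesI) (auto dest: unitariesD)

lemma mult_unitaries [simp, intro]:
  assumes "u \<in> unitaries k" "v \<in> unitaries k"
  shows "u * v \<in> unitaries k"
proof (rule unitariesI)
  note [simp] = unitariesD[OF assms(1)] unitariesD[OF assms(2)]
  show "u * v \<in> carrier_mat k k" by (rule mult_carrier_mat[of _ k k]) auto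
  have "mat_adjoint (u * v) * (u * v) = mat_adjoint v * (mat_adjoint u * (u * v))"
    by (subst mat_adjoint_mult[of _ k k _ k])
      (auto intro!: assoc_mult_mat[of _ k k _ k _ k] mult_carrier_mat[of u k k v k])
  also have "mat_adjoint u * (u * v) = (mat_adjoint u * u) * v"
    by (rule assoc_mult_mat[symmetric, of _ k k _ k _ k]) auto
  finally show "mat_adjoint (u * v) * (u * v) = 1\<^sub>m k"
    by (simp add: unitariesD(2)[OF assms(1)] left_mult_one_mat[OF unitariesD(1)[OF assms(2)]])
qed

lemma group_unitary_group [simp, intro]: "group (unitary_group k)"
proof (rule groupI)
  fix x assume x: "x \<in> unitaries k"
  then show "\<exists>y\<in>unitaries k. y \<otimes>\<^bsub>unitary_group k\<^esub> x = \<one>\<^bsub>unitary_group k\<^esub>"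
    by (intro bexI[of _ "mat_adjoint x"]) (auto dest: unitariesD)
  show "\<one>\<^bsub>unitary_group k\<^esub> \<otimes>\<^bsub>unitary_group k\<^esub> x = x"
    using unitariesD(1)[OF x] by simp
qed (auto intro!: assoc_mult_mat[of _ k k _ k _ k] dest: unitariesD)

lemma inv_unitary_group [simp]: "u \<in> unitaries k \<Longrightarrow> inv\<^bsub>unitary_group k\<^esub> u = mat_adjoint u"
  by (rule group.inv_equality) (auto dest: unitariesD)

lemma hs_norm_mult_left:
  assumes "u \<in> unitaries k" and x: "x \<in> carrier_mat k k"
  shows "hs_norm k (u * x) = hs_norm k x"
proof -
  note u = unitariesD[OF assms(1)]
  have "mat_adjoint (u * x) * (u * x) = mat_adjoint x * (mat_adjoint u * (u * x))"
    using u(1) x by (subst mat_adjoint_mult[of _ k k _ k])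
      (auto intro!: assoc_mult_mat[of _ k k _ k _ k] mult_carrier_mat[of _ k k])
  also have "mat_adjoint u * (u * x) = (mat_adjoint u * u) * x"
    using u(1) x by (intro assoc_mult_mat[symmetric, of _ k k _ k _ k]) auto
  finally show ?thesis using u x by (simp add: hs_norm_def)
qed

lemma hs_norm_mat_adjoint:
  assumes "x \<in> carrier_mat k k"
  shows "hs_norm k (mat_adjoint x) = hs_norm k x"
  using assms mat_trace_mult_commute[of x k k "mat_adjoint x"] by (simp add: hs_norm_def)

lemma hs_norm_mult_right:
  assumes "u \<in> unitaries k" and x: "x \<in> carrier_mat k k"
  shows "hs_norm k (x * u) = hs_norm k x"
proof -
  note u = unitariesD[OF assms(1)]
  have "hs_norm k (x * u) = hs_norm k (mat_adjoint u * mat_adjoint x)"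
    using u x by (subst hs_norm_mat_adjoint[symmetric]) (auto simp: mat_adjoint_mult[of _ k k _ k])
  also have "\<dots> = hs_norm k x"
    using assms by (simp add: hs_norm_mult_left hs_norm_mat_adjoint)
  finally show ?thesis .
qed

lemma hs_norm_unitary:
  assumes "u \<in> unitaries k" "0 < k"
  shows "hs_norm k u = 1"
  using unitariesD[OF assms(1)] assms(2) by (simp add: hs_norm_def mat_trace_def)

lemma hs_dist_nonneg [simp]: "x \<in> unitaries k \<Longrightarrow> y \<in> unitaries k \<Longrightarrow> 0 \<le> hs_dist k x y"
  by (auto simp: hs_dist_def dest!: unitariesD(1) intro!: hs_norm_nonneg)

lemma hs_dist_self [simp]: "x \<in> carrier_mat k k \<Longrightarrow> hs_dist k x x = 0"
  by (auto simp: hs_dist_def hs_norm_eq_L2_set L2_set_def intro!: sum.neutral)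

lemma hs_dist_commute:
  assumes "x \<in> carrier_mat k k" "y \<in> carrier_mat k k"
  shows "hs_dist k x y = hs_dist k y x"
  using assms unfolding hs_dist_def
  by (subst (1 2) hs_norm_eq_L2_set) (auto simp: norm_minus_commute intro!: L2_set_cong arg_cong2[where f="(/)"])

lemma hs_dist_triangle:
  assumes "x \<in> carrier_mat k k" "y \<in> carrier_mat k k" "z \<in> carrier_mat k k"
  shows "hs_dist k x z \<le> hs_dist k x y + hs_dist k y z"
proof -
  have "x - z = (x - y) + (y - z)"
    using assms by (intro eq_matI) auto
  then show ?thesis
    using hs_norm_triangle[OF minus_carrier_mat[OF assms(2)] minus_carrier_mat[OF assms(3)], of x y] assms by (simp add: hs_dist_def)
qed

lemma hs_dist_mult_left:
  assumes "u \<in> unitaries k" "x \<in> carrier_mat k k" "y \<in> carrier_mat k k"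
  shows "hs_dist k (u * x) (u * y) = hs_dist k x y"
  using hs_norm_mult_left[OF assms(1) minus_carrier_mat[OF assms(3)], of x] assms unitariesD(1)[OF assms(1)]
  by (simp add: hs_dist_def mult_minus_distrib_mat)

lemma hs_dist_mult_right:
  assumes "u \<in> unitaries k" "x \<in> carrier_mat k k" "y \<in> carrier_mat k k"
  shows "hs_dist k (x * u) (y * u) = hs_dist k x y"
  using hs_norm_mult_right[OF assms(1) minus_carrier_mat[OF assms(3)], of x] assms unitariesD(1)[OF assms(1)]
  by (simp add: hs_dist_def minus_mult_distrib_mat)

text \<open>Both matrices have norm 1, hence distance 1 from the zero matrix, which serves as the
  intermediate point.\<close>

lemma hs_dist_le_2:
  assumes "x \<in> unitaries k" "y \<in> unitaries k" "0 < k"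
  shows "hs_dist k x y \<le> 2"
proof -
  note c = unitariesD(1)[OF assms(1)] unitariesD(1)[OF assms(2)]
  have z: "0\<^sub>m k k \<in> carrier_mat k k" by simp
  have "x - 0\<^sub>m k k = x" "y - 0\<^sub>m k k = y" using c by (auto intro!: eq_matI)
  then show ?thesis
    using hs_dist_triangle[OF c(1) z c(2)] hs_dist_commute[OF z c(2)] assms
    by (simp add: hs_dist_def hs_norm_unitary)
qed

section \<open>Diagonalization of unitary matrices\<close>

text \<open>Orthonormality of the columns in terms of entries: the form in which explicitly given
  matrices are checked below.\<close>

lemma unitariesI_sum:
  assumes "u \<in> carrier_mat n n"
    and "\<And>i j. i < n \<Longrightarrow> j < n \<Longrightarrow> (\<Sum>t<n. cnj (u $$ (t, i)) * u $$ (t, j)) = (if i = j then 1 else 0)"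
  shows "u \<in> unitaries n"
proof (rule unitariesI[OF assms(1)], rule eq_matI)
  fix i j assume "i < dim_row (1\<^sub>m n :: complex mat)" "j < dim_col (1\<^sub>m n :: complex mat)"
  then show "(mat_adjoint u * u) $$ (i, j) = 1\<^sub>m n $$ (i, j)"
    using assms by (simp add: index_mult_mat_sum[of _ n n _ n] del: index_mult_mat(1))
qed (use assms(1) in auto)

lemma unitaries_sumD:
  assumes "u \<in> unitaries n" "i < n" "j < n"
  shows "(\<Sum>t<n. cnj (u $$ (t, i)) * u $$ (t, j)) = (if i = j then 1 else 0)"
proof -
  note u = unitariesD[OF assms(1)]
  have "(mat_adjoint u * u) $$ (i, j) = 1\<^sub>m n $$ (i, j)" by (simp add: u)
  then show ?thesis
    using assms u(1) by (simp add: index_mult_mat_sum[of _ n n _ n] del: index_mult_mat(1))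
qed

text \<open>Gram--Schmidt applied to a basis that starts with \<open>v\<close> keeps
  \<open>v\<close> in first place. The resulting vectors are orthogonal but not normalized;
  \<open>c\<close> absorbs the normalization of \<open>v\<close>.\<close>

lemma unitary_with_first_column:
  assumes v: "v \<in> carrier_vec n" "v \<noteq> 0\<^sub>v n" and n: "0 < n"
  obtains w c where "w \<in> unitaries n" "\<And>i. i < n \<Longrightarrow> w $$ (i, 0) = c * v $ i"
proof -
  interpret cof_vec_space n "TYPE(complex)" .
  define b where "b = basis_completion v"
  define ws where "ws = gram_schmidt n b"
  from basis_completion[OF v, folded b_def]
  have b: "set b \<subseteq> carrier_vec n" "distinct b" "\<not> lin_dep (set b)" "hd b = v" "length b = n"
    by auto
  with n obtain vs where vs: "b = v # vs" by (cases b) auto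
  from gram_schmidt_result[OF b(1-3) refl, folded ws_def] b(5)
  have ws: "set ws \<subseteq> carrier_vec n" "corthogonal ws" "length ws = n" by auto
  have "hd ws = v" using gram_schmidt_hd[OF v(1), of vs, folded vs] by (simp add: ws_def)
  then have ws0: "ws ! 0 = v" using ws(3) n by (cases ws) auto
  have dim: "ws ! j \<in> carrier_vec n" if "j < n" for j using ws that by auto
  define r where "r j = (\<Sum>t<n. (cmod (ws ! j $ t))\<^sup>2)" for j
  have inner: "(\<Sum>t<n. ws ! i $ t * cnj (ws ! j $ t)) = (if i = j then complex_of_real (r i) else 0)"
    "r i \<noteq> 0" if "i < n" "j < n" for i j
  proof -
    have eq: "ws ! i \<bullet>c ws ! j = (\<Sum>t<n. ws ! i $ t * cnj (ws ! j $ t))" if "i < n" "j < n" for i j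
      using dim[OF that(2)] by (auto simp: scalar_prod_def atLeast0LessThan intro!: sum.cong)
    have self: "(\<Sum>t<n. ws ! i $ t * cnj (ws ! i $ t)) = complex_of_real (r i)"
      by (simp add: r_def complex_norm_square del: of_real_power)
    show "(\<Sum>t<n. ws ! i $ t * cnj (ws ! j $ t)) = (if i = j then complex_of_real (r i) else 0)"
      using corthogonalD[OF ws(2), of i j] eq[OF that] that ws(3) self by auto
    show "r i \<noteq> 0"
      using corthogonalD[OF ws(2), of i i] eq[OF that(1) that(1)] that ws(3) self by auto
  qed
  have rpos: "0 < r i" if "i < n" for i
    using inner(2)[OF that that] by (simp add: r_def less_le sum_nonneg)
  define w where "w = mat n n (\<lambda>(i, j). ws ! j $ i / complex_of_real (sqrt (r j)))"
  have "w \<in> unitaries n"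
  proof (rule unitariesI_sum)
    show "w \<in> carrier_mat n n" by (simp add: w_def)
    fix i j assume ij: "i < n" "j < n"
    have "(\<Sum>t<n. cnj (w $$ (t, i)) * w $$ (t, j))
        = (\<Sum>t<n. ws ! j $ t * cnj (ws ! i $ t)) / (complex_of_real (sqrt (r i)) * complex_of_real (sqrt (r j)))"
      using ij by (simp add: w_def sum_divide_distrib mult_ac)
    also have "\<dots> = (if i = j then 1 else 0)"
      using inner[OF ij(2,1)] rpos[OF ij(1)] by (auto simp flip: of_real_mult)
    finally show "(\<Sum>t<n. cnj (w $$ (t, i)) * w $$ (t, j)) = (if i = j then 1 else 0)" .
  qed
  moreover have "w $$ (i, 0) = 1 / complex_of_real (sqrt (r 0)) * v $ i" if "i < n" for i
    using that n by (simp add: w_def ws0)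
  ultimately show ?thesis by (rule that)
qed

text \<open>Induction on the dimension. An eigenvector, completed to a unitary \<open>w\<close>,
  turns \<open>u\<close> into a unitary \<open>a\<close> whose first column is a multiple of the
  first basis vector. Unitarity clears the first row as well, so that \<open>a\<close> splits off a
  unitary block \<open>b\<close> of size \<open>n\<close>.\<close>

lemma unitary_eigenbasis:
  assumes "u \<in> unitaries n"
  shows "\<exists>w\<in>unitaries n. \<exists>\<alpha>. u * w = w * mat_diag n \<alpha>"
  using assms
proof (induction n arbitrary: u)
  case 0
  then show ?case
    by (intro bexI[of _ "1\<^sub>m 0"] exI[of _ "\<lambda>_. 1"]) (auto dest!: unitariesD(1) intro!: eq_matI)
next
  case (Suc n)
  let ?N = "Suc n"
  note u = unitariesD[OF Suc.prems]
  obtain e v where ev: "eigenvector u v e"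
    using spectrum_non_empty[OF u(1)] by (auto simp: spectrum_def eigenvalue_def)
  then have v: "v \<in> carrier_vec ?N" "v \<noteq> 0\<^sub>v ?N" "u *\<^sub>v v = e \<cdot>\<^sub>v v"
    using u(1) by (auto simp: eigenvector_def)
  obtain w c where w: "w \<in> unitaries ?N" and w0: "\<And>i. i < ?N \<Longrightarrow> w $$ (i, 0) = c * v $ i"
    using unitary_with_first_column[OF v(1,2)] by auto
  note wD = unitariesD[OF w]
  define a where "a = mat_adjoint w * (u * w)"
  have a: "a \<in> unitaries ?N" unfolding a_def using Suc.prems w by blast
  note aD = unitariesD[OF a]
  have uw0: "(u * w) $$ (i, 0) = e * w $$ (i, 0)" if "i < ?N" for i
  proof -
    have "(u * w) $$ (i, 0) = (\<Sum>t<?N. u $$ (i, t) * (c * v $ t))"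
      using that u(1) wD(1) w0 by (simp add: index_mult_mat_sum[of _ ?N ?N _ ?N] del: index_mult_mat(1))
    also have "\<dots> = c * (u *\<^sub>v v) $ i"
      using that u(1) v(1) by (simp add: scalar_prod_def atLeast0LessThan sum_distrib_left mult_ac del: sum.lessThan_Suc)
    also have "\<dots> = e * w $$ (i, 0)"
      using that v(1) w0 by (simp add: v(3))
    finally show ?thesis .
  qed
  have a0: "a $$ (i, 0) = (if i = 0 then e else 0)" if "i < ?N" for i
  proof -
    have "a $$ (i, 0) = (\<Sum>t<?N. cnj (w $$ (t, i)) * (e * w $$ (t, 0)))"
      unfolding a_def using that u(1) wD(1) uw0
      by (subst index_mult_mat_sum[of _ ?N ?N _ ?N]) (auto intro!: sum.cong simp del: sum.lessThan_Suc index_mult_mat(1))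
    also have "\<dots> = e * (\<Sum>t<?N. cnj (w $$ (t, i)) * w $$ (t, 0))"
      by (simp add: sum_distrib_left mult_ac del: sum.lessThan_Suc)
    also have "\<dots> = (if i = 0 then e else 0)"
      using unitaries_sumD[OF w that, of 0] by simp
    finally show ?thesis .
  qed
  \<comment> \<open>The first column of \<open>a\<close> has length 1, and \<open>e\<close> is its
    only nonzero entry.\<close>
  have ee: "cnj e * e = 1"
    using unitaries_sumD[OF a, of 0 0] a0 by (simp add: sum.lessThan_Suc_shift del: sum.lessThan_Suc)
  then have "e \<noteq> 0" by auto
  \<comment> \<open>Columns 0 and \<open>Suc j\<close> are orthogonal, and since column 0 vanishes
    below the top, only one term of their inner product remains.\<close>
  have a0': "a $$ (0, Suc j) = 0" if "j < n" for j
    using unitaries_sumD[OF a, of 0 "Suc j"] a0 that \<open>e \<noteq> 0\<close>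
    by (simp add: sum.lessThan_Suc_shift del: sum.lessThan_Suc)
  define b where "b = mat n n (\<lambda>(i, j). a $$ (Suc i, Suc j))"
  have b: "b \<in> unitaries n"
  proof (rule unitariesI_sum)
    fix i j assume "i < n" "j < n"
    then show "(\<Sum>t<n. cnj (b $$ (t, i)) * b $$ (t, j)) = (if i = j then 1 else 0)"
      using unitaries_sumD[OF a, of "Suc i" "Suc j"] a0'
      by (simp add: b_def sum.lessThan_Suc_shift del: sum.lessThan_Suc)
  qed (simp add: b_def)
  from Suc.IH[OF b] obtain x \<alpha> where x: "x \<in> unitaries n" and bx: "b * x = x * mat_diag n \<alpha>" by blast
  note xD = unitariesD[OF x]
  \<comment> \<open>The block sum of 1 and \<open>x\<close>, which diagonalizes \<open>a\<close>;
    hence \<open>w * y\<close> diagonalizes \<open>u\<close>.\<close>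
  define y where "y = mat ?N ?N (\<lambda>(i, j). case i of 0 \<Rightarrow> if j = 0 then 1 else 0
    | Suc i \<Rightarrow> (case j of 0 \<Rightarrow> 0 | Suc j \<Rightarrow> x $$ (i, j)))"
  define \<beta> where "\<beta> = case_nat e \<alpha>"
  have yc: "y \<in> carrier_mat ?N ?N" by (simp add: y_def)
  have y_simps: "y $$ (0, 0) = 1" "\<And>j. j < n \<Longrightarrow> y $$ (0, Suc j) = 0" "\<And>i. i < n \<Longrightarrow> y $$ (Suc i, 0) = 0"
    "\<And>i j. i < n \<Longrightarrow> j < n \<Longrightarrow> y $$ (Suc i, Suc j) = x $$ (i, j)"
    by (auto simp: y_def)
  have y: "y \<in> unitaries ?N"
  proof (rule unitariesI_sum[OF yc])
    fix i j assume "i < ?N" "j < ?N"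
    then show "(\<Sum>t<?N. cnj (y $$ (t, i)) * y $$ (t, j)) = (if i = j then 1 else 0)"
      using unitaries_sumD[OF x]
      by (cases i; cases j) (simp_all add: y_simps sum.lessThan_Suc_shift del: sum.lessThan_Suc)
  qed
  have bx': "(\<Sum>t<n. b $$ (i, t) * x $$ (t, j)) = x $$ (i, j) * \<alpha> j" if "i < n" "j < n" for i j
  proof -
    have "(b * x) $$ (i, j) = (x * mat_diag n \<alpha>) $$ (i, j)" by (simp add: bx)
    then show ?thesis
      using that xD(1) unitariesD(1)[OF b]
      by (simp add: index_mult_mat_sum[of b n n x n] mat_diag_mult_right[of _ n] del: index_mult_mat(1))
  qed
  have ay: "a * y = y * mat_diag ?N \<beta>"
  proof (rule eq_matI)
    fix i j assume "i < dim_row (y * mat_diag ?N \<beta>)" "j < dim_col (y * mat_diag ?N \<beta>)"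
    then have ij: "i < ?N" "j < ?N" using yc by (auto simp: mat_diag_def)
    have "(a * y) $$ (i, j) = (\<Sum>t<?N. a $$ (i, t) * y $$ (t, j))"
      using aD(1) yc ij by (rule index_mult_mat_sum)
    also have "\<dots> = y $$ (i, j) * \<beta> j"
      using ij a0 a0' bx'
      by (cases i; cases j) (simp_all add: y_simps \<beta>_def b_def sum.lessThan_Suc_shift del: sum.lessThan_Suc)
    also have "\<dots> = (y * mat_diag ?N \<beta>) $$ (i, j)"
      using ij yc by (simp add: mat_diag_mult_right[of _ ?N])
    finally show "(a * y) $$ (i, j) = (y * mat_diag ?N \<beta>) $$ (i, j)" .
  qed (use aD(1) yc in \<open>auto simp: mat_diag_def\<close>)
  have "w * a = (w * mat_adjoint w) * (u * w)"
    unfolding a_def using wD(1) u(1) by (intro assoc_mult_mat[symmetric, of _ ?N ?N _ ?N _ ?N]) auto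
  then have wa: "w * a = u * w"
    using u(1) wD by simp
  have "u * (w * y) = (u * w) * y"
    using wD(1) u(1) yc by (intro assoc_mult_mat[symmetric, of _ ?N ?N _ ?N _ ?N]) auto
  also have "\<dots> = w * (a * y)"
    unfolding wa[symmetric] using wD(1) aD(1) yc by (intro assoc_mult_mat[of _ ?N ?N _ ?N _ ?N]) auto
  also have "\<dots> = (w * y) * mat_diag ?N \<beta>"
    unfolding ay using wD(1) yc by (intro assoc_mult_mat[symmetric, of _ ?N ?N _ ?N _ ?N]) auto
  finally show ?case using w y by blast
qed

lemma mat_diag_unitaries [simp, intro]:
  assumes "\<And>i. i < n \<Longrightarrow> cmod (\<alpha> i) = 1"
  shows "mat_diag n \<alpha> \<in> unitaries n"
proof (rule unitariesI)
  have "mat_adjoint (mat_diag n \<alpha>) = mat_diag n (\<lambda>i. cnj (\<alpha> i))"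
    by (rule eq_matI) (auto simp: mat_diag_def)
  then have "mat_adjoint (mat_diag n \<alpha>) * mat_diag n \<alpha> = mat_diag n (\<lambda>i. cnj (\<alpha> i) * \<alpha> i)"
    by simp
  also have "\<dots> = mat_diag n (\<lambda>_. 1)"
    unfolding mat_diag_def
    using assms by (intro cong_mat) (auto simp: complex_norm_square[symmetric] mult.commute[of "cnj _"]
        simp del: of_real_power)
  finally show "mat_adjoint (mat_diag n \<alpha>) * mat_diag n \<alpha> = 1\<^sub>m n" by simp
qed simp

lemma mat_diag_unitariesD:
  assumes "mat_diag n \<alpha> \<in> unitaries n" "i < n"
  shows "cmod (\<alpha> i) = 1"
proof -
  have "(\<Sum>t<n. cnj (mat_diag n \<alpha> $$ (t, i)) * mat_diag n \<alpha> $$ (t, i)) = 1"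
    using unitaries_sumD[OF assms(1,2,2)] by simp
  also have "(\<Sum>t<n. cnj (mat_diag n \<alpha> $$ (t, i)) * mat_diag n \<alpha> $$ (t, i))
      = (\<Sum>t<n. if t = i then cnj (\<alpha> i) * \<alpha> i else 0)"
    using assms(2) by (intro sum.cong) (auto simp: mat_diag_def)
  finally have "complex_of_real ((cmod (\<alpha> i))\<^sup>2) = 1"
    using assms(2) by (simp add: complex_norm_square[symmetric] mult.commute)
  then show ?thesis by (metis norm_ge_zero of_real_eq_1_iff power2_eq_1_iff abs_of_nonneg abs_1 real_sqrt_abs real_sqrt_one)
qed

text \<open>The eigenvalues have modulus 1 because the diagonal matrix equals
  \<open>mat_adjoint w * (u * w)\<close>, which is again unitary.\<close>

lemma unitary_diagonalization:
  assumes u: "u \<in> unitaries n"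
  obtains w \<alpha> where "w \<in> unitaries n" "\<And>i. i < n \<Longrightarrow> cmod (\<alpha> i) = 1"
    "u = w * (mat_diag n \<alpha> * mat_adjoint w)"
proof -
  obtain w \<alpha> where w: "w \<in> unitaries n" and eq: "u * w = w * mat_diag n \<alpha>"
    using unitary_eigenbasis[OF u] by blast
  note uD = unitariesD[OF u] and wD = unitariesD[OF w]
  have "mat_adjoint w * (u * w) = (mat_adjoint w * w) * mat_diag n \<alpha>"
    unfolding eq using wD(1) by (intro assoc_mult_mat[symmetric, of _ n n _ n _ n]) auto
  then have "mat_diag n \<alpha> = mat_adjoint w * (u * w)"
    using wD by (simp add: left_mult_one_mat[of _ n n])
  then have "mat_diag n \<alpha> \<in> unitaries n"
    using u w by auto
  then have *: "\<And>i. i < n \<Longrightarrow> cmod (\<alpha> i) = 1" by (rule mat_diag_unitariesD)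
  have "u = u * (w * mat_adjoint w)"
    using uD wD by simp
  also have "\<dots> = (u * w) * mat_adjoint w"
    using uD(1) wD(1) by (intro assoc_mult_mat[symmetric, of _ n n _ n _ n]) auto
  also have "\<dots> = w * (mat_diag n \<alpha> * mat_adjoint w)"
    unfolding eq using wD(1) by (intro assoc_mult_mat[of _ n n _ n _ n]) auto
  finally show ?thesis using that w * by blast
qed

section \<open>Commutators of unitaries and the distance from the scalars\<close>

lemma mult_carrier_square [simp]: "A \<in> carrier_mat k k \<Longrightarrow> B \<in> carrier_mat k k \<Longrightarrow> A * B \<in> carrier_mat k k"
  by (rule mult_carrier_mat)

lemmas assoc_mult_square = assoc_mult_mat[of _ k k _ k _ k] for k

text \<open>Bracketed to the right to match the factorization produced by
  \<open>unitary_diagonalization\<close>.\<close>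

definition unitary_conj :: "complex mat \<Rightarrow> complex mat \<Rightarrow> complex mat" where
  "unitary_conj w x = w * (x * mat_adjoint w)"

lemma unitary_conj_carrier [simp]:
  "w \<in> carrier_mat k k \<Longrightarrow> x \<in> carrier_mat k k \<Longrightarrow> unitary_conj w x \<in> carrier_mat k k"
  by (simp add: unitary_conj_def)

lemma unitary_conj_unitaries [simp, intro]:
  "w \<in> unitaries k \<Longrightarrow> x \<in> unitaries k \<Longrightarrow> unitary_conj w x \<in> unitaries k"
  by (simp add: unitary_conj_def)

lemma unitary_conj_mult:
  assumes "w \<in> unitaries k" "x \<in> carrier_mat k k" "y \<in> carrier_mat k k"
  shows "unitary_conj w x * unitary_conj w y = unitary_conj w (x * y)"
proof -
  note w = unitariesD[OF assms(1)]
  have "mat_adjoint w * (w * (y * mat_adjoint w)) = y * mat_adjoint w"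
    using w assms by (simp flip: assoc_mult_square[where k=k])
  then show ?thesis
    using w assms by (simp add: unitary_conj_def assoc_mult_square[where k=k])
qed

lemma unitary_conj_unitary_conj:
  assumes "v \<in> carrier_mat k k" "w \<in> carrier_mat k k" "x \<in> carrier_mat k k"
  shows "unitary_conj v (unitary_conj w x) = unitary_conj (v * w) x"
  using assms by (simp add: unitary_conj_def assoc_mult_square[where k=k] mat_adjoint_mult[of _ k k _ k])

lemma hs_dist_unitary_conj:
  assumes "w \<in> unitaries k" "x \<in> carrier_mat k k" "y \<in> carrier_mat k k"
  shows "hs_dist k (unitary_conj w x) (unitary_conj w y) = hs_dist k x y"
  using assms unitariesD(1)[OF assms(1)]
  by (simp add: unitary_conj_def hs_dist_mult_left hs_dist_mult_right)

lemma hs_norm_smult: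
  assumes "x \<in> carrier_mat k k"
  shows "hs_norm k (c \<cdot>\<^sub>m x) = cmod c * hs_norm k x"
proof -
  have "L2_set (\<lambda>(i, j). cmod ((c \<cdot>\<^sub>m x) $$ (i, j))) ({..<k} \<times> {..<k})
      = L2_set (\<lambda>p. cmod c * (\<lambda>(i, j). cmod (x $$ (i, j))) p) ({..<k} \<times> {..<k})"
    using assms by (intro L2_set_cong) (auto simp: norm_mult)
  then show ?thesis
    using assms by (simp add: hs_norm_eq_L2_set L2_set_right_distrib)
qed

lemma hs_norm_power2:
  assumes "x \<in> carrier_mat k k"
  shows "(hs_norm k x)\<^sup>2 = (\<Sum>i<k. \<Sum>j<k. (cmod (x $$ (i, j)))\<^sup>2) / real k"
proof -
  have "L2_set (\<lambda>(i, j). cmod (x $$ (i, j))) ({..<k} \<times> {..<k})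
      = sqrt (\<Sum>i<k. \<Sum>j<k. (cmod (x $$ (i, j)))\<^sup>2)"
    by (simp add: L2_set_def sum.cartesian_product case_prod_unfold)
  then show ?thesis
    using assms by (simp add: hs_norm_eq_L2_set power_divide sum_nonneg)
qed

definition cyclic_shift :: "nat \<Rightarrow> complex mat" where
  "cyclic_shift k = mat k k (\<lambda>(i, j). if i = Suc j mod k then 1 else 0)"

lemma cyclic_shift_unitaries [simp, intro]: "cyclic_shift k \<in> unitaries k"
proof (rule unitariesI_sum)
  fix i j assume ij: "i < k" "j < k"
  have inj: "Suc i mod k = Suc j mod k \<longleftrightarrow> i = j"
    using ij by (auto simp: mod_Suc)
  have "(\<Sum>t<k. cnj (cyclic_shift k $$ (t, i)) * cyclic_shift k $$ (t, j))
      = (\<Sum>t<k. if t = Suc i mod k then (if i = j then 1 else 0) else 0)"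
    using ij inj by (intro sum.cong) (auto simp: cyclic_shift_def)
  then show "(\<Sum>t<k. cnj (cyclic_shift k $$ (t, i)) * cyclic_shift k $$ (t, j)) = (if i = j then 1 else 0)"
    using ij by simp
qed (simp add: cyclic_shift_def)

text \<open>
  For \<open>\<delta> i = \<alpha> 0 \<cdots> \<alpha> i\<close> the commutator of \<open>diag \<delta>\<close> and the cyclic shift is diagonal
  with entries \<open>\<delta> i / \<delta> (i - 1) = \<alpha> i\<close>, except at \<open>i = 0\<close>.
\<close>

lemma unitary_near_commutator:
  assumes u: "u \<in> unitaries k" and k: "0 < k"
  obtains x y where "x \<in> unitaries k" "y \<in> unitaries k"
    "hs_dist k (x * y) (u * (y * x)) \<le> 2 / sqrt (real k)"
proof -
  obtain w \<alpha> where w: "w \<in> unitaries k" and \<alpha>: "\<And>i. i < k \<Longrightarrow> cmod (\<alpha> i) = 1"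
    and uw: "u = unitary_conj w (mat_diag k \<alpha>)"
    using unitary_diagonalization[OF u] by (metis unitary_conj_def)
  note wD = unitariesD[OF w]
  define \<delta> where "\<delta> i = (\<Prod>t\<le>i. \<alpha> t)" for i
  have \<delta>: "cmod (\<delta> i) = 1" if "i < k" for i
    using \<alpha> that by (simp add: \<delta>_def prod_norm[symmetric])
  let ?P = "cyclic_shift k" and ?D = "mat_diag k \<delta>" and ?A = "mat_diag k \<alpha>"
  have P: "?P \<in> carrier_mat k k" by (simp add: cyclic_shift_def)
  let ?x = "?D * ?P" and ?y = "?A * (?P * ?D)"
  \<comment> \<open>The partial products telescope,
    \<open>\<delta> (Suc j) = \<alpha> (Suc j) * \<delta> j\<close>, so all entries cancel except in
    the corner where the shift wraps around. There \<open>\<delta> (k - 1)\<close> is the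
    determinant of \<open>u\<close>, which need not be 1. One entry of modulus at most 2 amounts to
    \<open>2 / sqrt k\<close> in the normalized norm.\<close>
  have entry: "(?x - ?y) $$ (i, j) = (if i = 0 \<and> j = k - 1 then \<alpha> 0 - \<alpha> 0 * \<delta> (k - 1) else 0)"
    if "i < k" "j < k" for i j
  proof -
    have "(?x - ?y) $$ (i, j) = (if i = Suc j mod k then \<delta> i - \<alpha> i * \<delta> j else 0)"
      using that P by (simp add: mat_diag_mult_left[of _ k k] mat_diag_mult_right[of _ k k])
        (simp add: cyclic_shift_def)
    also have "\<dots> = (if i = 0 \<and> j = k - 1 then \<alpha> 0 - \<alpha> 0 * \<delta> (k - 1) else 0)"
      using that by (auto simp: mod_Suc \<delta>_def)
    finally show ?thesis .
  qed
  have inner: "(\<Sum>j<k. if j = k - 1 then c else 0) = c" for c :: real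
    by (subst sum.delta) (use k in auto)
  have "(hs_norm k (?x - ?y))\<^sup>2
      = (\<Sum>i<k. \<Sum>j<k. if i = 0 \<and> j = k - 1 then (cmod (\<alpha> 0 - \<alpha> 0 * \<delta> (k - 1)))\<^sup>2 else 0) / real k"
    using P by (subst hs_norm_power2) (auto simp: entry intro!: sum.cong arg_cong2[where f = "(/)"] minus_carrier_mat)
  also have "(\<Sum>i<k. \<Sum>j<k. if i = 0 \<and> j = k - 1 then (cmod (\<alpha> 0 - \<alpha> 0 * \<delta> (k - 1)))\<^sup>2 else 0)
      = (\<Sum>i<k. if i = 0 then (\<Sum>j<k. if j = k - 1 then (cmod (\<alpha> 0 - \<alpha> 0 * \<delta> (k - 1)))\<^sup>2 else 0) else 0)"
    using k by (intro sum.cong) (auto intro!: sum.cong)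
  also have "\<dots> = (cmod (\<alpha> 0 - \<alpha> 0 * \<delta> (k - 1)))\<^sup>2"
    unfolding inner using k by simp
  also have "(cmod (\<alpha> 0 - \<alpha> 0 * \<delta> (k - 1)))\<^sup>2 / real k \<le> 2\<^sup>2 / real k"
    using norm_triangle_ineq4[of "\<alpha> 0" "\<alpha> 0 * \<delta> (k - 1)"] k
    by (intro divide_right_mono power_mono) (simp_all add: norm_mult \<alpha> \<delta>)
  also have "\<dots> = (2 / sqrt (real k))\<^sup>2"
    by (simp add: power_divide)
  finally have "hs_dist k ?x ?y \<le> 2 / sqrt (real k)"
    unfolding hs_dist_def by (rule power2_le_imp_le) simp
  moreover have "hs_dist k (unitary_conj w ?D * unitary_conj w ?P)
        (u * (unitary_conj w ?P * unitary_conj w ?D)) = hs_dist k ?x ?y"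
    using w P by (simp add: uw unitary_conj_mult hs_dist_unitary_conj)
  ultimately show ?thesis
    using that[of "unitary_conj w ?D" "unitary_conj w ?P"] w \<delta> by auto
qed

text \<open>
  Up to constants, the defect is the distance from the scalar matrices. Defining it through
  commutators makes its subadditivity immediate.
\<close>

definition defect :: "nat \<Rightarrow> complex mat \<Rightarrow> real" where
  "defect k a = (SUP g\<in>unitaries k. hs_dist k (a * g) (g * a))"

lemma hs_dist_le_defect:
  assumes "a \<in> unitaries k" "g \<in> unitaries k" "0 < k"
  shows "hs_dist k (a * g) (g * a) \<le> defect k a"
  unfolding defect_def
  by (rule cSUP_upper[OF assms(2)], rule bdd_aboveI2[where M = 2]) (auto intro!: hs_dist_le_2 assms)

lemma defect_le:
  assumes "\<And>g. g \<in> unitaries k \<Longrightarrow> hs_dist k (a * g) (g * a) \<le> c"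
  shows "defect k a \<le> c"
  unfolding defect_def by (rule cSUP_least) (use assms in auto)

lemma defect_nonneg [simp]:
  assumes "a \<in> unitaries k" "0 < k"
  shows "0 \<le> defect k a"
  using hs_dist_le_defect[OF assms(1) one_unitaries assms(2)] unitariesD(1)[OF assms(1)] by simp

text \<open>Leibniz rule for commutators: pass from \<open>a * b * g\<close> to
  \<open>g * (a * b)\<close> through \<open>a * g * b\<close>, moving \<open>g\<close> past one
  factor at a time.\<close>

lemma defect_mult_le:
  assumes "a \<in> unitaries k" "b \<in> unitaries k" "0 < k"
  shows "defect k (a * b) \<le> defect k a + defect k b"
proof (rule defect_le)
  fix g assume g: "g \<in> unitaries k"
  note c [simp] = unitariesD(1)[OF assms(1)] unitariesD(1)[OF assms(2)] unitariesD(1)[OF g]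
  have "hs_dist k (a * b * g) (g * (a * b))
      \<le> hs_dist k (a * (b * g)) (a * (g * b)) + hs_dist k ((a * g) * b) ((g * a) * b)"
    using hs_dist_triangle[of "a * (b * g)" k "a * (g * b)" "g * (a * b)"]
    by (simp add: assoc_mult_square[where k=k])
  also have "\<dots> = hs_dist k (b * g) (g * b) + hs_dist k (a * g) (g * a)"
    using assms by (simp add: hs_dist_mult_left hs_dist_mult_right)
  also have "\<dots> \<le> defect k b + defect k a"
    by (intro add_mono hs_dist_le_defect assms g)
  finally show "hs_dist k (a * b * g) (g * (a * b)) \<le> defect k a + defect k b" by simp
qed

text \<open>Replacing \<open>a\<close> by \<open>b\<close> to the left and to the right of
  \<open>g\<close> costs one distance each, whence the factor 2.\<close>

lemma defect_le_defect_plus_hs_dist: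
  assumes "a \<in> unitaries k" "b \<in> unitaries k" "0 < k"
  shows "defect k a \<le> defect k b + 2 * hs_dist k a b"
proof (rule defect_le)
  fix g assume g: "g \<in> unitaries k"
  note c [simp] = unitariesD(1)[OF assms(1)] unitariesD(1)[OF assms(2)] unitariesD(1)[OF g]
  have "hs_dist k (a * g) (g * a) \<le> hs_dist k (a * g) (b * g) + hs_dist k (b * g) (g * a)"
    by (rule hs_dist_triangle) auto
  also have "hs_dist k (b * g) (g * a) \<le> hs_dist k (b * g) (g * b) + hs_dist k (g * b) (g * a)"
    by (rule hs_dist_triangle) auto
  also have "hs_dist k (b * g) (g * b) \<le> defect k b"
    by (intro hs_dist_le_defect assms g)
  finally show "hs_dist k (a * g) (g * a) \<le> defect k b + 2 * hs_dist k a b"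
    using hs_dist_commute[OF c(2,1)] g by (simp add: hs_dist_mult_left hs_dist_mult_right)
qed

lemma defect_one [simp]: "0 < k \<Longrightarrow> defect k (1\<^sub>m k) = 0"
proof (rule antisym)
  show "defect k (1\<^sub>m k) \<le> 0"
    by (rule defect_le) (auto dest!: unitariesD(1))
qed simp

text \<open>If \<open>x * y\<close> is close to the negative of \<open>y * x\<close>, then
  \<open>x\<close> and \<open>y\<close> are far from commuting. Such a pair comes from writing the
  scalar -1 as a near-commutator: for \<open>16 \<le> k\<close> the error is at most 1, against the
  distance 2 between a unitary and its negative.\<close>

lemma ex_large_defect:
  assumes "16 \<le> k"
  obtains a where "a \<in> unitaries k" "1 \<le> defect k a"
proof -
  have k: "0 < k" using assms by simp
  let ?u = "mat_diag k (\<lambda>_. -1) :: complex mat"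
  have u: "?u \<in> unitaries k" by auto
  obtain x y where xy: "x \<in> unitaries k" "y \<in> unitaries k"
    "hs_dist k (x * y) (?u * (y * x)) \<le> 2 / sqrt (real k)"
    using unitary_near_commutator[OF u k] .
  note c [simp] = unitariesD(1)[OF xy(1)] unitariesD(1)[OF xy(2)]
  have "?u * z - z = (-2) \<cdot>\<^sub>m z" if "z \<in> carrier_mat k k" for z
    using that by (intro eq_matI) (auto simp: mat_diag_mult_left[of _ k k])
  from this[of "y * x"] have "hs_dist k (?u * (y * x)) (y * x) = 2"
    using xy k by (simp add: hs_dist_def hs_norm_smult hs_norm_unitary)
  moreover have "hs_dist k (?u * (y * x)) (y * x) \<le> hs_dist k (?u * (y * x)) (x * y) + hs_dist k (x * y) (y * x)"
    by (rule hs_dist_triangle) auto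
  moreover have "4 \<le> sqrt (real k)"
    using assms by (intro real_le_rsqrt) simp
  then have "2 / sqrt (real k) \<le> 1"
    using k by (subst pos_divide_le_eq) auto
  moreover have "hs_dist k (x * y) (y * x) \<le> defect k x"
    by (intro hs_dist_le_defect xy k)
  ultimately show ?thesis
    using that[of x] xy hs_dist_commute[of "?u * (y * x)" k "x * y"] by auto
qed

section \<open>Unitaries with large defect and their failure to commute with a conjugate\<close>

text \<open>Take as many disjoint pairs at distance at least \<open>\<eta>\<close> as possible; a
  far pair among the remaining indices would extend the list. The permutation puts the pairs into
  the standard positions \<open>2 * i\<close> and \<open>2 * i + 1\<close>, so that the pairs of two
  different spectra can later be matched.\<close>

lemma ex_maximal_spread_pairing:
  fixes \<alpha> :: "nat \<Rightarrow> 'a::real_normed_vector"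
  assumes "0 < \<eta>"
  obtains p m where "p permutes {..<k}" "2 * m \<le> k"
    "\<And>i. i < m \<Longrightarrow> \<eta> \<le> norm (\<alpha> (p (2 * i)) - \<alpha> (p (2 * i + 1)))"
    "\<And>i j. 2 * m \<le> i \<Longrightarrow> i < k \<Longrightarrow> 2 * m \<le> j \<Longrightarrow> j < k \<Longrightarrow> norm (\<alpha> (p i) - \<alpha> (p j)) < \<eta>"
proof -
  define Q where "Q p m \<longleftrightarrow> p permutes {..<k} \<and> 2 * m \<le> k \<and>
      (\<forall>i<m. \<eta> \<le> norm (\<alpha> (p (2 * i)) - \<alpha> (p (2 * i + 1))))" for p m
  have "\<exists>p. Q p 0" by (auto simp: Q_def intro: permutes_id)
  moreover have "\<forall>m. (\<exists>p. Q p m) \<longrightarrow> m \<le> k" by (auto simp: Q_def)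
  ultimately obtain m where "\<exists>p. Q p m" and max: "\<And>n. \<exists>p. Q p n \<Longrightarrow> n \<le> m"
    using GreatestI_ex_nat[of "\<lambda>m. \<exists>p. Q p m" k] Greatest_le_nat[of "\<lambda>m. \<exists>p. Q p m" _ k] by metis
  then obtain p where p: "p permutes {..<k}" "2 * m \<le> k"
    "\<And>i. i < m \<Longrightarrow> \<eta> \<le> norm (\<alpha> (p (2 * i)) - \<alpha> (p (2 * i + 1)))"
    by (auto simp: Q_def)
  have "norm (\<alpha> (p i) - \<alpha> (p j)) < \<eta>" if "2 * m \<le> i" "i < k" "2 * m \<le> j" "j < k" for i j
  proof (rule ccontr)
    assume "\<not> ?thesis"
    then have far: "\<eta> \<le> norm (\<alpha> (p i) - \<alpha> (p j))" and "i \<noteq> j" using assms by auto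
    \<comment> \<open>\<open>j'\<close> is the index that the transposition of \<open>2 * m\<close>
      and \<open>i\<close> maps to \<open>j\<close>; it differs from \<open>j\<close> exactly when
      \<open>j = 2 * m\<close>.\<close>
    define j' where "j' = Transposition.transpose (2 * m) i j"
    have j': "2 * m < j'" "j' < k"
      using that \<open>i \<noteq> j\<close> by (auto simp: j'_def Transposition.transpose_def)
    define \<sigma> where "\<sigma> = Transposition.transpose (2 * m) i \<circ> Transposition.transpose (2 * m + 1) j'"
    have "2 * m + 1 < k" using j' by simp
    have "\<sigma> permutes {..<k}"
      unfolding \<sigma>_def using that j' \<open>2 * m + 1 < k\<close>
      by (intro permutes_compose permutes_swap_id) auto
    then have "(p \<circ> \<sigma>) permutes {..<k}" by (rule permutes_compose[OF _ p(1)])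
    moreover have "\<sigma> (2 * m) = i" using j' by (simp add: \<sigma>_def Transposition.transpose_def)
    moreover have "\<sigma> (2 * m + 1) = j"
      using j' \<open>i \<noteq> j\<close> by (auto simp: \<sigma>_def j'_def Transposition.transpose_def split: if_splits)
    moreover have "\<sigma> t = t" if "t < 2 * m" for t
      using that \<open>2 * m \<le> i\<close> j' by (simp add: \<sigma>_def Transposition.transpose_def)
    ultimately have "Q (p \<circ> \<sigma>) (Suc m)"
      using p(3) far \<open>2 * m + 1 < k\<close> by (auto simp: Q_def less_Suc_eq)
    then show False using max[of "Suc m"] by auto
  qed
  with p that show ?thesis by blast
qed

text \<open>Reordering the eigenvalues is absorbed by reordering the eigenvectors: each entry of the
  conjugate is a sum over all eigenvalues, which a permutation leaves unchanged.\<close>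

lemma unitary_conj_permute_columns:
  assumes w: "w \<in> unitaries k" and p: "p permutes {..<k}"
  obtains w' where "w' \<in> unitaries k"
    "\<And>\<alpha>. unitary_conj w' (mat_diag k (\<alpha> \<circ> p)) = unitary_conj w (mat_diag k \<alpha>)"
proof -
  note wD = unitariesD[OF w]
  define w' where "w' = mat k k (\<lambda>(i, j). w $$ (i, p j))"
  have pk: "p i < k" if "i < k" for i using permutes_in_image[OF p, of i] that by simp
  have "w' \<in> unitaries k"
  proof (rule unitariesI_sum)
    fix i j assume "i < k" "j < k"
    then show "(\<Sum>t<k. cnj (w' $$ (t, i)) * w' $$ (t, j)) = (if i = j then 1 else 0)"
      using unitaries_sumD[OF w, of "p i" "p j"] pk permutes_inj[OF p]
      by (simp add: w'_def inj_eq)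
  qed (simp add: w'_def)
  moreover have "unitary_conj w' (mat_diag k (\<alpha> \<circ> p)) = unitary_conj w (mat_diag k \<alpha>)" for \<alpha>
  proof -
    have entry: "unitary_conj v (mat_diag k \<beta>) $$ (i, j) = (\<Sum>t<k. v $$ (i, t) * (\<beta> t * cnj (v $$ (j, t))))"
      if "v \<in> carrier_mat k k" "i < k" "j < k" for v \<beta> i j
      using that unfolding unitary_conj_def
      by (subst index_mult_mat_sum[of _ k k _ k]) (auto simp: mat_diag_mult_left[of _ k k])
    show ?thesis
    proof (rule eq_matI)
      fix i j assume "i < dim_row (unitary_conj w (mat_diag k \<alpha>))" "j < dim_col (unitary_conj w (mat_diag k \<alpha>))"
      then have ij: "i < k" "j < k" using wD(1) by (auto simp: unitary_conj_def)
      have "(\<Sum>t<k. w $$ (i, t) * (\<alpha> t * cnj (w $$ (j, t))))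
          = (\<Sum>t<k. w $$ (i, p t) * (\<alpha> (p t) * cnj (w $$ (j, p t))))"
        using sum.permute[OF p, of "\<lambda>t. w $$ (i, t) * (\<alpha> t * cnj (w $$ (j, t)))"] by (simp add: o_def)
      then show "unitary_conj w' (mat_diag k (\<alpha> \<circ> p)) $$ (i, j) = unitary_conj w (mat_diag k \<alpha>) $$ (i, j)"
        using ij wD(1) by (subst (1 2) entry) (auto simp: w'_def)
    qed (use wD(1) in \<open>auto simp: unitary_conj_def w'_def\<close>)
  qed
  ultimately show ?thesis by (rule that)
qed

lemma scalar_mat_mult:
  fixes x :: "'a::comm_ring_1 mat"
  assumes "x \<in> carrier_mat k k"
  shows "(c \<cdot>\<^sub>m 1\<^sub>m k) * x = c \<cdot>\<^sub>m x" "x * (c \<cdot>\<^sub>m 1\<^sub>m k) = c \<cdot>\<^sub>m x"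
  using assms by (simp_all add: mult_smult_assoc_mat[of _ k k _ k] mult_smult_distrib[of _ k k _ k])

text \<open>A scalar commutes with \<open>g\<close>, so \<open>a\<close> and \<open>a - c\<close>
  have the same commutator with \<open>g\<close>, and each of its two terms has the norm of
  \<open>a - c\<close>.\<close>

lemma defect_le_hs_norm_minus_scalar:
  assumes a: "a \<in> unitaries k"
  shows "defect k a \<le> 2 * hs_norm k (a - c \<cdot>\<^sub>m 1\<^sub>m k)"
proof (rule defect_le)
  fix g assume g: "g \<in> unitaries k"
  note [simp] = unitariesD(1)[OF a] unitariesD(1)[OF g]
  let ?b = "a - c \<cdot>\<^sub>m 1\<^sub>m k"
  have b: "?b \<in> carrier_mat k k" by (rule minus_carrier_mat) simp
  have "a * g - g * a = ?b * g + (- 1) \<cdot>\<^sub>m (g * ?b)"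
  proof -
    have "?b * g = a * g - c \<cdot>\<^sub>m g" "g * ?b = g * a - c \<cdot>\<^sub>m g"
      by (simp_all add: minus_mult_distrib_mat[of _ k k _ _ k] mult_minus_distrib_mat[of _ k k _ k] scalar_mat_mult)
    moreover have "x - y = (x - z) + (- 1) \<cdot>\<^sub>m (y - z)"
      if "x \<in> carrier_mat k k" "y \<in> carrier_mat k k" "z \<in> carrier_mat k k" for x y z :: "complex mat"
      using that by (intro eq_matI) auto
    ultimately show ?thesis by simp
  qed
  moreover have "hs_norm k ((- 1) \<cdot>\<^sub>m (g * ?b)) = hs_norm k (g * ?b)"
    using mult_carrier_square[OF _ b, of g] by (simp add: hs_norm_smult)
  ultimately have "hs_dist k (a * g) (g * a) \<le> hs_norm k (?b * g) + hs_norm k (g * ?b)"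
    using hs_norm_triangle[of "?b * g" k "(- 1) \<cdot>\<^sub>m (g * ?b)"] b by (simp add: hs_dist_def)
  then show "hs_dist k (a * g) (g * a) \<le> 2 * hs_norm k ?b"
    using g b by (simp add: hs_norm_mult_left hs_norm_mult_right)
qed

lemma unitary_conj_minus_scalar:
  assumes w: "w \<in> unitaries k" and x: "x \<in> carrier_mat k k"
  shows "hs_norm k (unitary_conj w x - c \<cdot>\<^sub>m 1\<^sub>m k) = hs_norm k (x - c \<cdot>\<^sub>m 1\<^sub>m k)"
proof -
  note wD = unitariesD[OF w]
  have "unitary_conj w (c \<cdot>\<^sub>m 1\<^sub>m k) = c \<cdot>\<^sub>m 1\<^sub>m k"
    using wD by (simp add: unitary_conj_def scalar_mat_mult mult_smult_distrib[of _ k k _ k])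
  then show ?thesis
    using hs_dist_unitary_conj[OF w x, of "c \<cdot>\<^sub>m 1\<^sub>m k"] by (simp add: hs_dist_def)
qed

text \<open>
  If too few eigenvalues could be paired off at distance \<open>\<epsilon> / 4\<close>, then the remaining ones would
  be close to one another and \<open>a\<close> would be close to a scalar.
\<close>

lemma spread_diagonalization:
  assumes a: "a \<in> unitaries k" and k: "0 < k" and \<epsilon>: "0 < \<epsilon>" "\<epsilon> \<le> defect k a"
  obtains w \<alpha> m where "w \<in> unitaries k" "\<And>i. i < k \<Longrightarrow> cmod (\<alpha> i) = 1"
    "a = unitary_conj w (mat_diag k \<alpha>)" "2 * m \<le> k" "\<epsilon>\<^sup>2 / 64 * real k \<le> real m"
    "\<And>i. i < m \<Longrightarrow> \<epsilon> / 4 \<le> cmod (\<alpha> (2 * i) - \<alpha> (2 * i + 1))"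
proof -
  obtain w \<alpha> where w: "w \<in> unitaries k" and \<alpha>: "\<And>i. i < k \<Longrightarrow> cmod (\<alpha> i) = 1"
    and aw: "a = unitary_conj w (mat_diag k \<alpha>)"
    using unitary_diagonalization[OF a] by (metis unitary_conj_def)
  obtain p m where p: "p permutes {..<k}" and m: "2 * m \<le> k"
    and far: "\<And>i. i < m \<Longrightarrow> \<epsilon> / 4 \<le> cmod (\<alpha> (p (2 * i)) - \<alpha> (p (2 * i + 1)))"
    and close: "\<And>i j. 2 * m \<le> i \<Longrightarrow> i < k \<Longrightarrow> 2 * m \<le> j \<Longrightarrow> j < k \<Longrightarrow> cmod (\<alpha> (p i) - \<alpha> (p j)) < \<epsilon> / 4"
    using ex_maximal_spread_pairing[of "\<epsilon> / 4" k \<alpha>] \<epsilon>(1) by auto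
  have pk: "p i < k" if "i < k" for i using permutes_in_image[OF p, of i] that by simp
  \<comment> \<open>Index \<open>k - 1\<close> is unpaired as soon as any index is, so all unpaired
    eigenvalues are close to \<open>c\<close>. If every index is paired, any eigenvalue would
    do.\<close>
  define c where "c = \<alpha> (p (k - 1))"
  let ?D = "mat_diag k \<alpha>"
  have "(hs_norm k (?D - c \<cdot>\<^sub>m 1\<^sub>m k))\<^sup>2 = (\<Sum>i<k. \<Sum>j<k. if j = i then (cmod (\<alpha> i - c))\<^sup>2 else 0) / real k"
    by (subst hs_norm_power2)
      (auto simp: mat_diag_def intro!: minus_carrier_mat sum.cong arg_cong2[where f = "(/)"] simp del: sum.delta sum.delta')
  also have "(\<Sum>i<k. \<Sum>j<k. if j = i then (cmod (\<alpha> i - c))\<^sup>2 else 0) = (\<Sum>i<k. (cmod (\<alpha> i - c))\<^sup>2)"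
    by simp
  also have "\<dots> = (\<Sum>i<k. (cmod (\<alpha> (p i) - c))\<^sup>2)"
    using sum.permute[OF p, of "\<lambda>i. (cmod (\<alpha> i - c))\<^sup>2"] by (simp add: o_def)
  \<comment> \<open>A paired eigenvalue has distance at most 2 from \<open>c\<close>, the diameter
    of the unit circle; an unpaired one is within \<open>\<epsilon> / 4\<close>.\<close>
  also have "\<dots> \<le> (\<Sum>i<k. (if i < 2 * m then 4 else 0) + (\<epsilon> / 4)\<^sup>2)"
  proof (rule sum_mono)
    fix i assume "i \<in> {..<k}"
    then have i: "i < k" by simp
    show "(cmod (\<alpha> (p i) - c))\<^sup>2 \<le> (if i < 2 * m then 4 else 0) + (\<epsilon> / 4)\<^sup>2"
    proof (cases "i < 2 * m")
      case True
      have "cmod (\<alpha> (p i) - c) \<le> 2"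
        using norm_triangle_ineq4[of "\<alpha> (p i)" c] i pk[OF i] pk[of "k - 1"] by (simp add: c_def \<alpha>)
      then have "(cmod (\<alpha> (p i) - c))\<^sup>2 \<le> 2\<^sup>2" by (intro power_mono) auto
      also have "\<dots> \<le> 4 + (\<epsilon> / 4)\<^sup>2" by simp
      finally show ?thesis using True by simp
    next
      case False
      then have "cmod (\<alpha> (p i) - c) < \<epsilon> / 4" unfolding c_def using i by (intro close) auto
      then show ?thesis using False by (auto intro: power_mono)
    qed
  qed
  also have "\<dots> = 8 * real m + real k * (\<epsilon> / 4)\<^sup>2"
  proof -
    have "{..<k} \<inter> {i. i < 2 * m} = {..<2 * m}" using m by auto
    then show ?thesis by (simp add: sum.distrib sum.If_cases)
  qed
  finally have "(hs_norm k (?D - c \<cdot>\<^sub>m 1\<^sub>m k))\<^sup>2 \<le> (8 * real m + real k * (\<epsilon> / 4)\<^sup>2) / real k"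
    by (simp add: divide_right_mono)
  moreover have "\<epsilon> \<le> 2 * hs_norm k (?D - c \<cdot>\<^sub>m 1\<^sub>m k)"
    using \<epsilon>(2) defect_le_hs_norm_minus_scalar[OF a, of c] unitary_conj_minus_scalar[OF w, of ?D c]
    by (simp add: aw)
  then have "\<epsilon>\<^sup>2 \<le> (2 * hs_norm k (?D - c \<cdot>\<^sub>m 1\<^sub>m k))\<^sup>2"
    using \<epsilon>(1) by (intro power_mono) auto
  then have "\<epsilon>\<^sup>2 \<le> 4 * (hs_norm k (?D - c \<cdot>\<^sub>m 1\<^sub>m k))\<^sup>2"
    by (simp add: power_mult_distrib)
  ultimately have "\<epsilon>\<^sup>2 \<le> 4 * ((8 * real m + real k * (\<epsilon> / 4)\<^sup>2) / real k)"
    by linarith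
  \<comment> \<open>Absorbing the last summand on the left gives
    \<open>3 / 128 * \<epsilon>\<^sup>2 * k \<le> m\<close>, which implies the claim with the
    smaller constant \<open>1 / 64\<close>.\<close>
  then have "\<epsilon>\<^sup>2 * real k \<le> 32 * real m + real k * \<epsilon>\<^sup>2 / 4"
    using k by (simp add: field_simps power_divide)
  moreover have "0 \<le> \<epsilon>\<^sup>2 * real k" by simp
  ultimately have "\<epsilon>\<^sup>2 / 64 * real k \<le> real m" by (simp add: field_simps)
  moreover obtain w' where "w' \<in> unitaries k"
    "\<And>\<alpha>. unitary_conj w' (mat_diag k (\<alpha> \<circ> p)) = unitary_conj w (mat_diag k \<alpha>)"
    using unitary_conj_permute_columns[OF w p] by blast
  ultimately show ?thesis
    using that[of w' "\<alpha> \<circ> p" m] m far aw \<alpha> pk by simp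
qed

text \<open>
  A Hadamard block on each of the coordinate pairs \<open>{2 * i, 2 * i + 1}\<close> with \<open>i < m\<close>.
\<close>

definition pair_flip :: "nat \<Rightarrow> nat \<Rightarrow> complex mat" where
  "pair_flip k m = mat k k (\<lambda>(i, j).
     (if i = j then if j < 2 * m then if even j then 1 / sqrt 2 else - 1 / sqrt 2 else 1 else 0) +
     (if j < 2 * m \<and> i = (if even j then j + 1 else j - 1) then 1 / sqrt 2 else 0))"

lemma pair_flip_unitaries:
  assumes "2 * m \<le> k"
  shows "pair_flip k m \<in> unitaries k"
proof (rule unitariesI_sum)
  \<comment> \<open>Column \<open>j\<close> has the entry \<open>r j\<close> on the diagonal and
    \<open>s j\<close> in the row of its partner \<open>q j\<close>. An unpaired index is its own
    partner, with \<open>s j = 0\<close>, so one formula covers all columns.\<close>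
  define r where "r j = (if j < 2 * m then if even j then 1 / sqrt 2 else - 1 / sqrt 2 else (1::real))" for j
  define s where "s j = (if j < 2 * m then 1 / sqrt 2 else (0::real))" for j
  define q where "q j = (if j < 2 * m then if even j then j + 1 else j - 1 else j)" for j
  have q_less: "q j < k" if "j < k" for j
    using that assms by (auto simp: q_def elim!: evenE)
  have entry: "pair_flip k m $$ (t, j) = complex_of_real ((if t = j then r j else 0) + (if t = q j then s j else 0))"
    if "t < k" "j < k" for t j
    using that by (auto simp: pair_flip_def r_def s_def q_def)
  have half: "complex_of_real (sqrt 2) * complex_of_real (sqrt 2) = 2"
    by (simp flip: of_real_mult)
  fix i j assume ij: "i < k" "j < k"
  have "(\<Sum>t<k. cnj (pair_flip k m $$ (t, i)) * pair_flip k m $$ (t, j))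
     = complex_of_real (\<Sum>t<k. (if t = i then (if i = j then r i * r j else 0) + (if i = q j then r i * s j else 0) else 0)
         + (if t = q i then (if q i = j then s i * r j else 0) + (if q i = q j then s i * s j else 0) else 0))"
    unfolding of_real_sum using ij by (intro sum.cong) (auto simp: entry algebra_simps)
  also have "\<dots> = complex_of_real ((if i = j then r i * r j else 0) + (if i = q j then r i * s j else 0)
      + (if q i = j then s i * r j else 0) + (if q i = q j then s i * s j else 0))"
    using ij q_less by (simp add: sum.distrib)
  also have "\<dots> = (if i = j then 1 else 0)"
  proof -
    have q_q: "q (q i) = i" for i by (auto simp: q_def elim!: evenE oddE)
    have inj: "q i = q j \<longleftrightarrow> i = j" by (metis q_q)
    have swap: "q i = j \<longleftrightarrow> i = q j" by (metis q_q)
    show ?thesis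
    proof (cases "i = j")
      case True
      then show ?thesis
        using half by (auto simp: r_def s_def q_def elim!: evenE oddE)
    next
      case False
      then show ?thesis unfolding inj swap
        by (auto simp: r_def s_def q_def elim!: evenE oddE)
    qed
  qed
  finally show "(\<Sum>t<k. cnj (pair_flip k m $$ (t, i)) * pair_flip k m $$ (t, j)) = (if i = j then 1 else 0)" .
qed (simp add: pair_flip_def)

text \<open>Conjugating a diagonal 2 by 2 matrix by the Hadamard matrix puts half the difference of
  its eigenvalues off the diagonal. A spectral gap thus becomes an entry in a prescribed
  position.\<close>

lemma pair_flip_conj_entry:
  assumes m: "2 * m \<le> k" and i: "i < m"
  shows "unitary_conj (pair_flip k m) (mat_diag k \<beta>) $$ (2 * i, 2 * i + 1) = (\<beta> (2 * i) - \<beta> (2 * i + 1)) / 2"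
proof -
  have ik: "2 * i < k" "2 * i + 1 < k" using assms by auto
  have half: "complex_of_real (sqrt 2) * complex_of_real (sqrt 2) = 2"
    by (simp flip: of_real_mult)
  let ?R = "pair_flip k m"
  have R: "?R \<in> carrier_mat k k" by (simp add: pair_flip_def)
  have "unitary_conj ?R (mat_diag k \<beta>) $$ (2 * i, 2 * i + 1)
      = (\<Sum>t<k. ?R $$ (2 * i, t) * (\<beta> t * cnj (?R $$ (2 * i + 1, t))))"
    unfolding unitary_conj_def using R ik
    by (subst index_mult_mat_sum[of _ k k _ k]) (auto simp: mat_diag_mult_left[of _ k k])
  also have "\<dots> = (\<Sum>t<k. (if t = 2 * i then \<beta> (2 * i) / 2 else 0) + (if t = 2 * i + 1 then - \<beta> (2 * i + 1) / 2 else 0))"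
  proof (rule sum.cong[OF refl])
    fix t assume "t \<in> {..<k}"
    then show "?R $$ (2 * i, t) * (\<beta> t * cnj (?R $$ (2 * i + 1, t)))
        = (if t = 2 * i then \<beta> (2 * i) / 2 else 0) + (if t = 2 * i + 1 then - \<beta> (2 * i + 1) / 2 else 0)"
      using ik half i by (auto simp: pair_flip_def field_simps elim!: evenE oddE)
  qed
  also have "\<dots> = (\<beta> (2 * i) - \<beta> (2 * i + 1)) / 2"
    using ik by (simp add: sum.distrib diff_divide_distrib)
  finally show ?thesis .
qed

text \<open>The conjugator aligns the eigenbasis of \<open>b\<close> with that of \<open>a\<close>,
  up to a Hadamard rotation of the index pairs. In the eigenbasis of \<open>a\<close>, the
  commutator then has as entries half the product of a gap of \<open>a\<close> and a gap of
  \<open>b\<close>, at least \<open>\<epsilon>\<^sup>2 / 32\<close>, in at least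
  \<open>\<epsilon>\<^sup>2 / 64 * k\<close> positions. Its normalized squared norm is at least
  \<open>\<epsilon> ^ 6 / (64 * 1024)\<close>, the square of
  \<open>\<epsilon> ^ 3 / 256\<close>.\<close>

lemma ex_conj_far_from_commuting:
  assumes a: "a \<in> unitaries k" and b: "b \<in> unitaries k" and k: "0 < k"
  shows "\<exists>h\<in>unitaries k. (min (defect k a) (defect k b)) ^ 3 / 256
    \<le> hs_dist k (a * unitary_conj h b) (unitary_conj h b * a)"
proof (cases "0 < min (defect k a) (defect k b)")
  case False
  then have "min (defect k a) (defect k b) = 0"
    using a b k by (auto simp: min_def not_less intro: antisym)
  then show ?thesis using a b by (intro bexI[of _ "1\<^sub>m k"]) auto
next
  case True
  define \<epsilon> where "\<epsilon> = min (defect k a) (defect k b)"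
  have \<epsilon>: "0 < \<epsilon>" "\<epsilon> \<le> defect k a" "\<epsilon> \<le> defect k b" using True by (auto simp: \<epsilon>_def)
  obtain v \<alpha> m1 where v: "v \<in> unitaries k" "\<And>i. i < k \<Longrightarrow> cmod (\<alpha> i) = 1"
    "a = unitary_conj v (mat_diag k \<alpha>)" "2 * m1 \<le> k" "\<epsilon>\<^sup>2 / 64 * real k \<le> real m1"
    "\<And>i. i < m1 \<Longrightarrow> \<epsilon> / 4 \<le> cmod (\<alpha> (2 * i) - \<alpha> (2 * i + 1))"
    using spread_diagonalization[OF a k \<epsilon>(1,2)] by blast
  obtain w \<beta> m2 where w: "w \<in> unitaries k" "\<And>i. i < k \<Longrightarrow> cmod (\<beta> i) = 1"
    "b = unitary_conj w (mat_diag k \<beta>)" "2 * m2 \<le> k" "\<epsilon>\<^sup>2 / 64 * real k \<le> real m2"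
    "\<And>i. i < m2 \<Longrightarrow> \<epsilon> / 4 \<le> cmod (\<beta> (2 * i) - \<beta> (2 * i + 1))"
    using spread_diagonalization[OF b k \<epsilon>(1,3)] by blast
  \<comment> \<open>Both lists of pairs occupy the standard positions, so their first
    \<open>m\<close> pairs use the same indices.\<close>
  define m where "m = min m1 m2"
  have m: "2 * m \<le> k" "\<epsilon>\<^sup>2 / 64 * real k \<le> real m" using v w by (auto simp: m_def)
  define R where "R = pair_flip k m"
  have R: "R \<in> unitaries k" using m by (simp add: R_def pair_flip_unitaries)
  \<comment> \<open>\<open>mat_adjoint w\<close> leaves the eigenbasis of \<open>b\<close>,
    \<open>R\<close> mixes the pairs, and \<open>v\<close> enters the eigenbasis of
    \<open>a\<close>.\<close>
  define h where "h = v * (R * mat_adjoint w)"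
  have h: "h \<in> unitaries k" using v w R by (simp add: h_def)
  let ?D = "mat_diag k \<alpha>"
  define T where "T = unitary_conj R (mat_diag k \<beta>)"
  have T: "T \<in> carrier_mat k k" using unitariesD(1)[OF R] by (simp add: T_def)
  note [simp] = unitariesD[OF v(1)] unitariesD[OF w(1)] unitariesD[OF R]
  have "h * w = v * R"
    by (simp add: h_def assoc_mult_square[where k=k] right_mult_one_mat[of _ k k])
  then have hb: "unitary_conj h b = unitary_conj v T"
    unfolding w(3) T_def using unitariesD(1)[OF h]
    by (simp add: unitary_conj_unitary_conj[where k=k])
  have "(\<epsilon> ^ 3 / 256)\<^sup>2 * real k = (\<epsilon>\<^sup>2 / 64 * real k) * (\<epsilon>\<^sup>2 / 32)\<^sup>2"
    by (simp add: power_divide field_simps flip: power_mult power_add)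
  also have "\<dots> \<le> real m * (\<epsilon>\<^sup>2 / 32)\<^sup>2"
    using m by (intro mult_right_mono) auto
  also have "\<dots> = (\<Sum>i<m. (\<epsilon>\<^sup>2 / 32)\<^sup>2)" by simp
  also have "\<dots> \<le> (\<Sum>i<m. (cmod ((?D * T - T * ?D) $$ (2 * i, 2 * i + 1)))\<^sup>2)"
  proof (rule sum_mono)
    fix i assume "i \<in> {..<m}"
    then have i: "i < m" "2 * i < k" "2 * i + 1 < k" using m by auto
    have "(?D * T - T * ?D) $$ (2 * i, 2 * i + 1) = (\<alpha> (2 * i) - \<alpha> (2 * i + 1)) * T $$ (2 * i, 2 * i + 1)"
      using i T by (simp add: mat_diag_mult_left[of _ k k] mat_diag_mult_right[of _ k k] algebra_simps)
    also have "T $$ (2 * i, 2 * i + 1) = (\<beta> (2 * i) - \<beta> (2 * i + 1)) / 2"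
      unfolding T_def R_def by (rule pair_flip_conj_entry[OF m(1) i(1)])
    finally have *: "cmod ((?D * T - T * ?D) $$ (2 * i, 2 * i + 1))
        = cmod (\<alpha> (2 * i) - \<alpha> (2 * i + 1)) * (cmod (\<beta> (2 * i) - \<beta> (2 * i + 1)) / 2)"
      by (simp only: norm_mult norm_divide) simp
    have "\<epsilon>\<^sup>2 / 32 = \<epsilon> / 4 * (\<epsilon> / 4 / 2)" by (simp add: power2_eq_square)
    also have "\<dots> \<le> cmod (\<alpha> (2 * i) - \<alpha> (2 * i + 1)) * (cmod (\<beta> (2 * i) - \<beta> (2 * i + 1)) / 2)"
      using v(6)[of i] w(6)[of i] i \<epsilon>(1) by (intro mult_mono divide_right_mono) (auto simp: m_def)
    finally show "(\<epsilon>\<^sup>2 / 32)\<^sup>2 \<le> (cmod ((?D * T - T * ?D) $$ (2 * i, 2 * i + 1)))\<^sup>2"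
      unfolding * by (intro power_mono) auto
  qed
  also have "\<dots> = (\<Sum>p\<in>(\<lambda>i. (2 * i, 2 * i + 1)) ` {..<m}. (cmod ((?D * T - T * ?D) $$ p))\<^sup>2)"
    by (subst sum.reindex) (auto simp: inj_on_def)
  also have "\<dots> \<le> (\<Sum>p\<in>{..<k} \<times> {..<k}. (cmod ((?D * T - T * ?D) $$ p))\<^sup>2)"
    using m by (intro sum_mono2) auto
  also have "\<dots> = (hs_norm k (?D * T - T * ?D))\<^sup>2 * real k"
    using T k by (subst hs_norm_power2) (auto simp: sum.cartesian_product intro!: minus_carrier_mat)
  finally have "(\<epsilon> ^ 3 / 256)\<^sup>2 \<le> (hs_norm k (?D * T - T * ?D))\<^sup>2"
    using k by simp
  moreover have "0 \<le> hs_norm k (?D * T - T * ?D)" using T by (intro hs_norm_nonneg minus_carrier_mat) simp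
  ultimately have "\<epsilon> ^ 3 / 256 \<le> hs_dist k (?D * T) (T * ?D)"
    unfolding hs_dist_def by (rule power2_le_imp_le)
  also have "\<dots> = hs_dist k (a * unitary_conj h b) (unitary_conj h b * a)"
    unfolding hb v(3) using v(1) T by (simp add: unitary_conj_mult hs_dist_unitary_conj)
  finally show ?thesis using h by (auto simp: \<epsilon>_def)
qed

section \<open>Sequences of unitaries modulo null sequences\<close>

lemma carrier_unitary_seqs: "u \<in> carrier (unitary_seqs k) \<longleftrightarrow> (\<forall>n. u n \<in> unitaries (k n))"
  by (auto simp: unitary_seqs_def PiE_UNIV_domain)

lemma unitary_seqsD:
  assumes "u \<in> carrier (unitary_seqs k)"
  shows "u n \<in> unitaries (k n)" "u n \<in> carrier_mat (k n) (k n)"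
  using assms unitariesD(1) by (auto simp: carrier_unitary_seqs)

lemma group_unitary_seqs [simp, intro]: "group (unitary_seqs k)"
  by (simp add: unitary_seqs_def)

lemma mult_unitary_seqs [simp]: "u \<otimes>\<^bsub>unitary_seqs k\<^esub> v = (\<lambda>n. u n * v n)"
  by (simp add: unitary_seqs_def restrict_def)

lemma one_unitary_seqs [simp]: "\<one>\<^bsub>unitary_seqs k\<^esub> = (\<lambda>n. 1\<^sub>m (k n))"
  by (simp add: unitary_seqs_def restrict_def)

lemma inv_unitary_seqs [simp]:
  assumes "u \<in> carrier (unitary_seqs k)"
  shows "inv\<^bsub>unitary_seqs k\<^esub> u = (\<lambda>n. mat_adjoint (u n))"
  using assms by (auto simp: unitary_seqs_def PiE_UNIV_domain restrict_def intro!: ext inv_unitary_group)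

text \<open>Phrased for representatives and an arbitrary filter, since three kinds occur:
  \<open>sequentially\<close> for the reduced product, its restriction to a set, and
  ultrafilters.\<close>

definition seq_close ::
    "(nat \<Rightarrow> nat) \<Rightarrow> nat filter \<Rightarrow> (nat \<Rightarrow> complex mat) \<Rightarrow> (nat \<Rightarrow> complex mat) \<Rightarrow> bool" where
  "seq_close k F u v \<longleftrightarrow> ((\<lambda>n. hs_dist (k n) (u n) (v n)) \<longlongrightarrow> 0) F"

lemma null_seqs_iff: "u \<in> null_seqs k F \<longleftrightarrow> u \<in> carrier (unitary_seqs k) \<and> seq_close k F u (\<lambda>n. 1\<^sub>m (k n))"
  by (simp add: null_seqs_def seq_close_def)

lemma seq_close_mono: "seq_close k F u v \<Longrightarrow> F' \<le> F \<Longrightarrow> seq_close k F' u v"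
  unfolding seq_close_def by (rule tendsto_mono)

lemma seq_closeI_le:
  assumes "\<And>n. u n \<in> unitaries (k n)" "\<And>n. v n \<in> unitaries (k n)"
    and "eventually (\<lambda>n. hs_dist (k n) (u n) (v n) \<le> f n) F" "(f \<longlongrightarrow> 0) F"
  shows "seq_close k F u v"
  unfolding seq_close_def
  by (rule tendsto_sandwich[OF _ assms(3) tendsto_const assms(4)]) (use assms(1,2) in simp)

lemma seq_close_refl [simp]: "u \<in> carrier (unitary_seqs k) \<Longrightarrow> seq_close k F u u"
  by (simp add: seq_close_def unitary_seqsD)

lemma seq_close_sym:
  assumes "u \<in> carrier (unitary_seqs k)" "v \<in> carrier (unitary_seqs k)" "seq_close k F u v"
  shows "seq_close k F v u"
proof -
  have "hs_dist (k n) (u n) (v n) = hs_dist (k n) (v n) (u n)" for n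
    using assms(1,2) by (intro hs_dist_commute unitary_seqsD(2))
  then show ?thesis using assms(3) by (simp add: seq_close_def)
qed

lemma seq_close_trans:
  assumes "u \<in> carrier (unitary_seqs k)" "v \<in> carrier (unitary_seqs k)" "w \<in> carrier (unitary_seqs k)"
    and "seq_close k F u v" "seq_close k F v w"
  shows "seq_close k F u w"
proof (rule seq_closeI_le)
  show "eventually (\<lambda>n. hs_dist (k n) (u n) (w n) \<le> hs_dist (k n) (u n) (v n) + hs_dist (k n) (v n) (w n)) F"
    using assms(1-3) by (intro always_eventually allI hs_dist_triangle unitary_seqsD(2))
  show "((\<lambda>n. hs_dist (k n) (u n) (v n) + hs_dist (k n) (v n) (w n)) \<longlongrightarrow> 0) F"
    using tendsto_add[OF assms(4,5)[unfolded seq_close_def]] by simp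
qed (use assms(1,3) in \<open>auto simp: carrier_unitary_seqs\<close>)

lemma seq_close_mult_left_iff:
  assumes "u \<in> carrier (unitary_seqs k)" "v \<in> carrier (unitary_seqs k)" "w \<in> carrier (unitary_seqs k)"
  shows "seq_close k F (\<lambda>n. w n * u n) (\<lambda>n. w n * v n) \<longleftrightarrow> seq_close k F u v"
proof -
  have "hs_dist (k n) (w n * u n) (w n * v n) = hs_dist (k n) (u n) (v n)" for n
    using assms by (intro hs_dist_mult_left unitary_seqsD)
  then show ?thesis by (simp add: seq_close_def)
qed

lemma seq_close_mult_right_iff:
  assumes "u \<in> carrier (unitary_seqs k)" "v \<in> carrier (unitary_seqs k)" "w \<in> carrier (unitary_seqs k)"
  shows "seq_close k F (\<lambda>n. u n * w n) (\<lambda>n. v n * w n) \<longleftrightarrow> seq_close k F u v"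
proof -
  have "hs_dist (k n) (u n * w n) (v n * w n) = hs_dist (k n) (u n) (v n)" for n
    using assms by (intro hs_dist_mult_right unitary_seqsD)
  then show ?thesis by (simp add: seq_close_def)
qed

lemma mult_carrier_unitary_seqs [simp, intro]:
  "u \<in> carrier (unitary_seqs k) \<Longrightarrow> v \<in> carrier (unitary_seqs k) \<Longrightarrow> (\<lambda>n. u n * v n) \<in> carrier (unitary_seqs k)"
  by (auto simp: carrier_unitary_seqs)

lemma adjoint_carrier_unitary_seqs [simp, intro]:
  "u \<in> carrier (unitary_seqs k) \<Longrightarrow> (\<lambda>n. mat_adjoint (u n)) \<in> carrier (unitary_seqs k)"
  by (auto simp: carrier_unitary_seqs)

lemma one_carrier_unitary_seqs [simp, intro]: "(\<lambda>n. 1\<^sub>m (k n)) \<in> carrier (unitary_seqs k)"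
  by (auto simp: carrier_unitary_seqs)

lemma unitary_seqs_group_laws [simp]:
  assumes "u \<in> carrier (unitary_seqs k)"
  shows "(\<lambda>n. u n * mat_adjoint (u n)) = (\<lambda>n. 1\<^sub>m (k n))" "(\<lambda>n. mat_adjoint (u n) * u n) = (\<lambda>n. 1\<^sub>m (k n))"
    "(\<lambda>n. 1\<^sub>m (k n) * u n) = u" "(\<lambda>n. u n * 1\<^sub>m (k n)) = u"
  using unitary_seqsD(2)[OF assms] unitariesD(2,3)[OF unitary_seqsD(1)[OF assms]]
  by (auto intro!: ext left_mult_one_mat right_mult_one_mat)

lemma seq_close_mult:
  assumes "u \<in> carrier (unitary_seqs k)" "v \<in> carrier (unitary_seqs k)"
    "u' \<in> carrier (unitary_seqs k)" "v' \<in> carrier (unitary_seqs k)"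
    and "seq_close k F u u'" "seq_close k F v v'"
  shows "seq_close k F (\<lambda>n. u n * v n) (\<lambda>n. u' n * v' n)"
proof -
  have "seq_close k F (\<lambda>n. u n * v n) (\<lambda>n. u n * v' n)"
    using seq_close_mult_left_iff[OF assms(2,4,1)] assms(6) by blast
  moreover have "seq_close k F (\<lambda>n. u n * v' n) (\<lambda>n. u' n * v' n)"
    using seq_close_mult_right_iff[OF assms(1,3,4)] assms(5) by blast
  ultimately show ?thesis
    using seq_close_trans[OF mult_carrier_unitary_seqs[OF assms(1,2)]
        mult_carrier_unitary_seqs[OF assms(1,4)] mult_carrier_unitary_seqs[OF assms(3,4)]] by blast
qed

text \<open>Bi-invariance of the metric gives closure under products, inverses and conjugation,
  along any filter.\<close>

lemma null_seqs_normal: "null_seqs k F \<lhd> unitary_seqs k"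
proof (rule group.normal_invI)
  show "subgroup (null_seqs k F) (unitary_seqs k)"
  proof (rule group.subgroupI)
    have "(\<lambda>n. 1\<^sub>m (k n)) \<in> null_seqs k F" by (simp add: null_seqs_iff)
    then show "null_seqs k F \<noteq> {}" by blast
  next
    fix u assume "u \<in> null_seqs k F"
    then have u: "u \<in> carrier (unitary_seqs k)" "seq_close k F u (\<lambda>n. 1\<^sub>m (k n))" by (auto simp: null_seqs_iff)
    then have "seq_close k F (\<lambda>n. mat_adjoint (u n) * 1\<^sub>m (k n)) (\<lambda>n. mat_adjoint (u n) * u n)"
      by (subst seq_close_mult_left_iff) (auto intro: seq_close_sym)
    then show "inv\<^bsub>unitary_seqs k\<^esub> u \<in> null_seqs k F"
      using u(1) by (auto simp: null_seqs_iff)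
  next
    fix u v assume "u \<in> null_seqs k F" "v \<in> null_seqs k F"
    then show "u \<otimes>\<^bsub>unitary_seqs k\<^esub> v \<in> null_seqs k F"
      using seq_close_mult[of u k v "\<lambda>n. 1\<^sub>m (k n)" "\<lambda>n. 1\<^sub>m (k n)" F] by (auto simp: null_seqs_iff)
  qed (auto simp: null_seqs_iff)
next
  fix u g assume "u \<in> null_seqs k F" and g: "g \<in> carrier (unitary_seqs k)"
  then have u: "u \<in> carrier (unitary_seqs k)" "seq_close k F u (\<lambda>n. 1\<^sub>m (k n))" by (auto simp: null_seqs_iff)
  then have "seq_close k F (\<lambda>n. (g n * u n) * mat_adjoint (g n)) (\<lambda>n. (g n * 1\<^sub>m (k n)) * mat_adjoint (g n))"
    using g by (intro seq_close_mult) auto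
  then show "g \<otimes>\<^bsub>unitary_seqs k\<^esub> u \<otimes>\<^bsub>unitary_seqs k\<^esub> inv\<^bsub>unitary_seqs k\<^esub> g \<in> null_seqs k F"
    using u(1) g by (auto simp: null_seqs_iff right_mult_one_mat[OF unitary_seqsD(2)[OF g]])
qed auto

lemma null_seqs_subgroup: "subgroup (null_seqs k F) (unitary_seqs k)"
  by (rule normal_imp_subgroup[OF null_seqs_normal])

lemma mem_seq_class_iff:
  assumes "u \<in> carrier (unitary_seqs k)"
  shows "v \<in> seq_class k F u \<longleftrightarrow> v \<in> carrier (unitary_seqs k) \<and> seq_close k F v u"
proof -
  have "v \<in> seq_class k F u \<longleftrightarrow> v \<otimes>\<^bsub>unitary_seqs k\<^esub> inv\<^bsub>unitary_seqs k\<^esub> u \<in> null_seqs k F"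
    if "v \<in> carrier (unitary_seqs k)"
    unfolding seq_class_def
    by (rule subgroup.rcos_module[OF null_seqs_subgroup group_unitary_seqs assms that])
  also have "\<dots> \<longleftrightarrow> seq_close k F v u" if v: "v \<in> carrier (unitary_seqs k)"
    using v assms seq_close_mult_right_iff[of v k u "\<lambda>n. mat_adjoint (u n)" F]
    by (simp add: null_seqs_iff)
  moreover have "seq_class k F u \<subseteq> carrier (unitary_seqs k)"
    unfolding seq_class_def
    by (rule monoid.r_coset_subset_G[OF group.is_monoid[OF group_unitary_seqs]]) (use assms in \<open>auto simp: null_seqs_iff\<close>)
  ultimately show ?thesis by blast
qed

lemma seq_class_eq_iff:
  assumes "u \<in> carrier (unitary_seqs k)" "v \<in> carrier (unitary_seqs k)"
  shows "seq_class k F u = seq_class k F v \<longleftrightarrow> seq_close k F u v"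
proof
  assume "seq_class k F u = seq_class k F v"
  then show "seq_close k F u v"
    using assms mem_seq_class_iff by (metis seq_close_refl)
next
  assume "seq_close k F u v"
  then have "u \<in> seq_class k F v" using assms by (simp add: mem_seq_class_iff)
  then show "seq_class k F u = seq_class k F v"
    unfolding seq_class_def
    using group.repr_independence[OF group_unitary_seqs _ assms(2) null_seqs_subgroup] by blast
qed

section \<open>Quotients by null sequences along a filter\<close>

lemma group_metric_ultraproduct [simp, intro]: "group (metric_ultraproduct k F)"
  unfolding metric_ultraproduct_def by (rule normal.factorgroup_is_group[OF null_seqs_normal])

lemma carrier_metric_ultraproduct:
  "carrier (metric_ultraproduct k F) = seq_class k F ` carrier (unitary_seqs k)"
  by (auto simp: metric_ultraproduct_def carrier_FactGroup seq_class_def)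

lemma mult_metric_ultraproduct:
  assumes "u \<in> carrier (unitary_seqs k)" "v \<in> carrier (unitary_seqs k)"
  shows "seq_class k F u \<otimes>\<^bsub>metric_ultraproduct k F\<^esub> seq_class k F v = seq_class k F (\<lambda>n. u n * v n)"
  using normal.rcos_sum[OF null_seqs_normal assms, of F] by (simp add: metric_ultraproduct_def seq_class_def)

lemma one_metric_ultraproduct:
  "\<one>\<^bsub>metric_ultraproduct k F\<^esub> = seq_class k F (\<lambda>n. 1\<^sub>m (k n))"
  using group.coset_mult_one[OF group_unitary_seqs, of "null_seqs k F" k]
  by (simp add: metric_ultraproduct_def seq_class_def null_seqs_def)

lemma inv_metric_ultraproduct:
  assumes "u \<in> carrier (unitary_seqs k)"
  shows "inv\<^bsub>metric_ultraproduct k F\<^esub> (seq_class k F u) = seq_class k F (\<lambda>n. mat_adjoint (u n))"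
  by (rule group.inv_equality)
    (use assms in \<open>auto simp: mult_metric_ultraproduct one_metric_ultraproduct carrier_metric_ultraproduct\<close>)

text \<open>\<open>metric_ultraproduct\<close> accepts every filter, so the preceding facts
  specialize to the reduced product.\<close>

lemma U_HS_eq_metric_ultraproduct: "U_HS k = metric_ultraproduct k sequentially"
  by (simp add: U_HS_def metric_ultraproduct_def)

lemmas carrier_U_HS = carrier_metric_ultraproduct[where F = sequentially, folded U_HS_eq_metric_ultraproduct]
  and mult_U_HS = mult_metric_ultraproduct[where F = sequentially, folded U_HS_eq_metric_ultraproduct]
  and one_U_HS = one_metric_ultraproduct[where F = sequentially, folded U_HS_eq_metric_ultraproduct]
  and inv_U_HS = inv_metric_ultraproduct[where F = sequentially, folded U_HS_eq_metric_ultraproduct]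
  and group_U_HS [simp, intro] = group_metric_ultraproduct[where F = sequentially, folded U_HS_eq_metric_ultraproduct]

lemma seq_class_in_U_HS [simp, intro]:
  "u \<in> carrier (unitary_seqs k) \<Longrightarrow> seq_class k sequentially u \<in> carrier (U_HS k)"
  by (auto simp: carrier_U_HS)

section \<open>Equality along a set and the subgroups that express it\<close>

abbreviation along :: "nat set \<Rightarrow> nat filter" where
  "along S \<equiv> inf sequentially (principal S)"

text \<open>\<open>eq_along\<close> quantifies over all representatives. Two representatives of a
  class are close along \<open>sequentially\<close>, hence along the smaller filter
  \<open>along S\<close>, so a single pair decides.\<close>

lemma eq_along_iff:
  assumes u: "u \<in> carrier (unitary_seqs k)" and v: "v \<in> carrier (unitary_seqs k)"
  shows "eq_along k (class_mod_fin S) (seq_class k sequentially u) (seq_class k sequentially v)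
    \<longleftrightarrow> seq_close k (along S) u v"
proof -
  have "seq_close k (along S) u' v'"
    if "seq_close k (along S) u v" "u' \<in> carrier (unitary_seqs k)" "v' \<in> carrier (unitary_seqs k)"
      "seq_close k sequentially u' u" "seq_close k sequentially v' v" for u' v'
  proof (rule seq_close_trans[OF that(2) u that(3)])
    show "seq_close k (along S) u' u" using that(4) by (rule seq_close_mono) simp
    have "seq_close k (along S) v v'"
      using seq_close_mono[OF seq_close_sym[OF that(3) v that(5)], of "along S"] by simp
    then show "seq_close k (along S) u v'" by (rule seq_close_trans[OF u v that(3,1)])
  qed
  then show ?thesis
    using u v unfolding eq_along.abs_eq seq_close_def[symmetric]
    by (auto simp: mem_seq_class_iff)
qed

text \<open>These subgroups will turn out to be all direct factors. Their elements are supported off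
  \<open>x\<close>, so a larger \<open>x\<close> gives a smaller subgroup.\<close>

definition trivial_on :: "(nat \<Rightarrow> nat) \<Rightarrow> pow_mod_fin \<Rightarrow> (nat \<Rightarrow> complex mat) set set" where
  "trivial_on k x = {a \<in> carrier (U_HS k). eq_along k x a \<one>\<^bsub>U_HS k\<^esub>}"

lemma seq_class_in_trivial_on_iff:
  assumes "u \<in> carrier (unitary_seqs k)"
  shows "seq_class k sequentially u \<in> trivial_on k (class_mod_fin S) \<longleftrightarrow> seq_close k (along S) u (\<lambda>n. 1\<^sub>m (k n))"
  using assms by (simp add: trivial_on_def one_U_HS eq_along_iff)

lemma ex_class_mod_fin: "\<exists>S. x = class_mod_fin S"
  by (induction x rule: pow_mod_fin.abs_induct) blast

text \<open>Expresses the relation by membership in a subgroup, which an isomorphism can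
  transport.\<close>

lemma eq_along_iff_trivial_on:
  assumes "a \<in> carrier (U_HS k)" "b \<in> carrier (U_HS k)"
  shows "eq_along k x a b \<longleftrightarrow> a \<otimes>\<^bsub>U_HS k\<^esub> inv\<^bsub>U_HS k\<^esub> b \<in> trivial_on k x"
proof -
  obtain S where x: "x = class_mod_fin S" using ex_class_mod_fin by blast
  obtain u v where uv: "u \<in> carrier (unitary_seqs k)" "v \<in> carrier (unitary_seqs k)"
    "a = seq_class k sequentially u" "b = seq_class k sequentially v"
    using assms by (auto simp: carrier_U_HS)
  have "seq_close k (along S) (\<lambda>n. u n * mat_adjoint (v n)) (\<lambda>n. 1\<^sub>m (k n)) \<longleftrightarrow> seq_close k (along S) u v"
    using seq_close_mult_right_iff[of u k v "\<lambda>n. mat_adjoint (v n)"] uv(1,2) by simp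
  then show ?thesis
    using uv by (simp add: x eq_along_iff inv_U_HS mult_U_HS seq_class_in_trivial_on_iff)
qed

lemma seq_close_cases:
  assumes "seq_close k (along S) u v" "seq_close k (along (- S)) u v"
  shows "seq_close k sequentially u v"
proof -
  have "sup (along S) (along (- S)) = sequentially"
    unfolding filter_eq_iff eventually_sup eventually_inf_principal eventually_conj_iff[symmetric]
    by (intro allI arg_cong2[where f = eventually]) auto
  then show ?thesis
    using assms filterlim_sup[of _ "nhds 0" "along S" "along (- S)"] unfolding seq_close_def by simp
qed

lemma seq_close_alongI:
  assumes "u \<in> carrier (unitary_seqs k)" "\<And>n. n \<in> S \<Longrightarrow> u n = v n"
  shows "seq_close k (along S) u v"
proof -
  have "hs_dist (k n) (u n) (v n) = 0" if "n \<in> S" for n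
    using assms(2)[OF that, symmetric] unitary_seqsD(2)[OF assms(1)] by simp
  then have "eventually (\<lambda>n. hs_dist (k n) (u n) (v n) = 0) (along S)"
    by (simp add: eventually_inf_principal)
  then show ?thesis unfolding seq_close_def by (rule tendsto_eventually)
qed

section \<open>Internal direct factors\<close>

text \<open>Elementwise commutation stands in for normality; \<open>direct_pair_conj_closed\<close>
  derives normality from it.\<close>

definition direct_pair :: "('a, 'b) monoid_scheme \<Rightarrow> 'a set \<Rightarrow> 'a set \<Rightarrow> bool" where
  "direct_pair G M N \<longleftrightarrow> subgroup M G \<and> subgroup N G \<and>
     (\<forall>m\<in>M. \<forall>n\<in>N. m \<otimes>\<^bsub>G\<^esub> n = n \<otimes>\<^bsub>G\<^esub> m) \<and> M \<inter> N = {\<one>\<^bsub>G\<^esub>} \<and>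
     (\<forall>g\<in>carrier G. \<exists>m\<in>M. \<exists>n\<in>N. g = m \<otimes>\<^bsub>G\<^esub> n)"

lemma direct_pairD:
  assumes "direct_pair G M N"
  shows "subgroup M G" "subgroup N G" "\<And>m n. m \<in> M \<Longrightarrow> n \<in> N \<Longrightarrow> m \<otimes>\<^bsub>G\<^esub> n = n \<otimes>\<^bsub>G\<^esub> m"
    "M \<inter> N = {\<one>\<^bsub>G\<^esub>}" "\<And>g. g \<in> carrier G \<Longrightarrow> \<exists>m\<in>M. \<exists>n\<in>N. g = m \<otimes>\<^bsub>G\<^esub> n"
    "\<And>m. m \<in> M \<Longrightarrow> m \<in> carrier G" "\<And>n. n \<in> N \<Longrightarrow> n \<in> carrier G"
  using assms by (auto simp: direct_pair_def dest: subgroup.mem_carrier)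

lemma direct_pair_commute: "direct_pair G M N \<Longrightarrow> direct_pair G N M"
  unfolding direct_pair_def by (auto simp: Int_commute) metis

context group
begin

text \<open>Split \<open>g\<close> into \<open>p\<close> from \<open>M\<close> and \<open>q\<close>
  from \<open>N\<close>: conjugation by \<open>q\<close> preserves \<open>N\<close>, and conjugation
  by \<open>p\<close> fixes it pointwise.\<close>

lemma direct_pair_conj_closed:
  assumes d: "direct_pair G M N" and n: "n \<in> N" and g: "g \<in> carrier G"
  shows "g \<otimes> n \<otimes> inv g \<in> N"
proof -
  note dD = direct_pairD[OF d]
  obtain p q where pq: "p \<in> M" "q \<in> N" "g = p \<otimes> q" using dD(5)[OF g] by blast
  have qn: "q \<otimes> n \<otimes> inv q \<in> N"
    using dD(2) pq(2) n by (simp add: subgroup.m_closed subgroup.m_inv_closed)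
  have c [simp]: "p \<in> carrier G" "q \<in> carrier G" "n \<in> carrier G" using pq n dD(6,7) by auto
  have "g \<otimes> n \<otimes> inv g = p \<otimes> (q \<otimes> n \<otimes> inv q) \<otimes> inv p"
    by (simp add: pq(3) inv_mult_group m_assoc)
  also have "\<dots> = q \<otimes> n \<otimes> inv q"
    using dD(3)[OF pq(1) qn] by (simp add: m_assoc)
  finally show ?thesis using qn by simp
qed

text \<open>If a product of \<open>m\<close> and \<open>n\<close> lies in \<open>M'\<close>, then so
  does \<open>n\<close>, which also lies in \<open>N'\<close> and is therefore trivial. Thus one
  inclusion for each factor already identifies a decomposition.\<close>

lemma direct_pair_subset_imp_eq:
  assumes "direct_pair G M N" "direct_pair G M' N'" "M \<subseteq> M'" "N \<subseteq> N'"
  shows "M = M'"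
proof
  show "M' \<subseteq> M"
  proof
    fix x assume x: "x \<in> M'"
    note d = direct_pairD[OF assms(1)] and d' = direct_pairD[OF assms(2)]
    obtain m n where mn: "m \<in> M" "n \<in> N" "x = m \<otimes> n" using d(5)[OF d'(6)[OF x]] by blast
    have c: "m \<in> carrier G" "n \<in> carrier G" using mn d(6,7) by auto
    have "n = inv m \<otimes> x" using c by (simp add: mn(3) m_assoc[symmetric])
    also have "\<dots> \<in> M'"
      using d'(1) x mn(1) assms(3) by (meson subgroup.m_closed subgroup.m_inv_closed subsetD)
    finally have "n = \<one>" using mn(2) assms(4) d'(4) by blast
    then show "x \<in> M" using mn c by simp
  qed
qed (rule assms(3))

text \<open>The \<open>M\<close>-components of \<open>x\<close> and \<open>y\<close> serve. The
  equation says that a quotient of \<open>M\<close>-parts equals a quotient of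
  \<open>N\<close>-parts, so both lie in \<open>M \<inter> N\<close>.\<close>

lemma direct_pair_commutator:
  assumes d: "direct_pair G M N" and b: "b \<in> M" and xy: "x \<in> carrier G" "y \<in> carrier G"
    and eq: "x \<otimes> y = b \<otimes> (y \<otimes> x)"
  obtains p q where "p \<in> M" "q \<in> M" "p \<otimes> q = b \<otimes> (q \<otimes> p)"
proof -
  note dD = direct_pairD[OF d]
  obtain p p' where p: "p \<in> M" "p' \<in> N" "x = p \<otimes> p'" using dD(5)[OF xy(1)] by blast
  obtain q q' where q: "q \<in> M" "q' \<in> N" "y = q \<otimes> q'" using dD(5)[OF xy(2)] by blast
  have c [simp]: "p \<in> carrier G" "q \<in> carrier G" "b \<in> carrier G" "p' \<in> carrier G" "q' \<in> carrier G"
    using p q b dD(6,7) by auto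
  have swap: "s \<otimes> s' \<otimes> (t \<otimes> t') = (s \<otimes> t) \<otimes> (s' \<otimes> t')"
    if "s \<in> M" "t \<in> M" "s' \<in> N" "t' \<in> N" for s t s' t'
  proof -
    have "s \<in> carrier G" "t \<in> carrier G" "s' \<in> carrier G" "t' \<in> carrier G" using that dD(6,7) by auto
    then show ?thesis using dD(3)[OF that(2,3)] by (metis m_assoc m_closed)
  qed
  \<comment> \<open>Separates the two factors: elements of \<open>M\<close> are collected on the
    left, elements of \<open>N\<close> on the right.\<close>
  have cross: "inv s \<otimes> t = t' \<otimes> inv s'"
    if "t \<otimes> s' = s \<otimes> t'" and [simp]: "t \<in> carrier G" "s' \<in> carrier G" "s \<in> carrier G" "t' \<in> carrier G"
    for s t s' t'
  proof -
    have "inv s \<otimes> t = inv s \<otimes> (t \<otimes> s') \<otimes> inv s'" by (simp add: m_assoc)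
    also have "\<dots> = t' \<otimes> inv s'" unfolding that(1) by (simp flip: m_assoc)
    finally show ?thesis .
  qed
  have "(p \<otimes> q) \<otimes> (p' \<otimes> q') = (b \<otimes> (q \<otimes> p)) \<otimes> (q' \<otimes> p')"
    using eq swap[OF p(1) q(1) p(2) q(2)] swap[OF q(1) p(1) q(2) p(2)] by (simp add: p(3) q(3) m_assoc)
  then have "inv (b \<otimes> (q \<otimes> p)) \<otimes> (p \<otimes> q) = (q' \<otimes> p') \<otimes> inv (p' \<otimes> q')"
    using cross[of "p \<otimes> q" "p' \<otimes> q'" "b \<otimes> (q \<otimes> p)" "q' \<otimes> p'"] by simp
  moreover have "inv (b \<otimes> (q \<otimes> p)) \<otimes> (p \<otimes> q) \<in> M"
    using dD(1) p q b by (simp add: subgroup.m_closed subgroup.m_inv_closed)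
  moreover have "(q' \<otimes> p') \<otimes> inv (p' \<otimes> q') \<in> N"
    using dD(2) p q by (simp add: subgroup.m_closed subgroup.m_inv_closed)
  ultimately have "inv (b \<otimes> (q \<otimes> p)) \<otimes> (p \<otimes> q) \<in> M \<inter> N"
    by simp
  then have "inv (b \<otimes> (q \<otimes> p)) \<otimes> (p \<otimes> q) = \<one>"
    using dD(4) by simp
  then have "(b \<otimes> (q \<otimes> p)) \<otimes> (inv (b \<otimes> (q \<otimes> p)) \<otimes> (p \<otimes> q)) = b \<otimes> (q \<otimes> p)"
    by simp
  then have "p \<otimes> q = b \<otimes> (q \<otimes> p)"
    by (simp flip: m_assoc)
  with p q that show ?thesis by blast
qed

end

lemma direct_pair_iso_image:
  assumes "group G" "group H" "f \<in> iso G H" "direct_pair G M N"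
  shows "direct_pair H (f ` M) (f ` N)"
proof -
  interpret group_hom G H f
    using assms by (auto simp: group_hom_def group_hom_axioms_def iso_def)
  note dD = direct_pairD[OF assms(4)]
  have inj: "inj_on f (carrier G)" and surj: "f ` carrier G = carrier H"
    using assms(3) by (auto simp: iso_def bij_betw_def)
  have "f ` M \<inter> f ` N = f ` (M \<inter> N)"
    using dD(6,7) by (intro inj_on_image_Int[OF inj, symmetric]) auto
  then have "f ` M \<inter> f ` N = {\<one>\<^bsub>H\<^esub>}" using dD(4) by simp
  moreover have "\<exists>m\<in>f ` M. \<exists>n\<in>f ` N. h = m \<otimes>\<^bsub>H\<^esub> n" if h: "h \<in> carrier H" for h
  proof -
    obtain g where g: "g \<in> carrier G" "h = f g" using h surj by blast
    obtain m n where "m \<in> M" "n \<in> N" "g = m \<otimes>\<^bsub>G\<^esub> n" using dD(5)[OF g(1)] by blast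
    then show ?thesis using g(2) dD(6,7) by auto
  qed
  moreover have "f m \<otimes>\<^bsub>H\<^esub> f n = f n \<otimes>\<^bsub>H\<^esub> f m" if "m \<in> M" "n \<in> N" for m n
    using dD(3)[OF that] dD(6)[OF that(1)] dD(7)[OF that(2)] by (metis hom_mult)
  ultimately show ?thesis
    using subgroup_img_is_subgroup[OF dD(1)] subgroup_img_is_subgroup[OF dD(2)]
    unfolding direct_pair_def by blast
qed

section \<open>The direct factors of the reduced product\<close>

lemma trivial_on_subgroup: "subgroup (trivial_on k x) (U_HS k)"
proof -
  obtain S where x: "x = class_mod_fin S" using ex_class_mod_fin by blast
  \<comment> \<open>\<open>trivial_on\<close> is the image of \<open>null_seqs k (along S)\<close>,
    from which it inherits the closure properties.\<close>
  have in_triv: "A \<in> trivial_on k x \<longleftrightarrow>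
      (\<exists>u\<in>carrier (unitary_seqs k). A = seq_class k sequentially u \<and> seq_close k (along S) u (\<lambda>n. 1\<^sub>m (k n)))" for A
    using seq_class_in_trivial_on_iff[of _ k S] by (auto simp: x trivial_on_def carrier_U_HS)
  show ?thesis
  proof (rule group.subgroupI[OF group_U_HS])
    have "seq_class k sequentially (\<lambda>n. 1\<^sub>m (k n)) \<in> trivial_on k x" using in_triv by auto
    then show "trivial_on k x \<noteq> {}" by blast
  next
    fix a assume "a \<in> trivial_on k x"
    then obtain u where u: "u \<in> carrier (unitary_seqs k)" "a = seq_class k sequentially u"
      "seq_close k (along S) u (\<lambda>n. 1\<^sub>m (k n))" using in_triv by blast
    have "u \<in> null_seqs k (along S)" using u by (simp add: null_seqs_iff)
    then have "inv\<^bsub>unitary_seqs k\<^esub> u \<in> null_seqs k (along S)"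
      by (rule subgroup.m_inv_closed[OF null_seqs_subgroup])
    then show "inv\<^bsub>U_HS k\<^esub> a \<in> trivial_on k x"
      using u(1) by (auto simp: u(2) inv_U_HS null_seqs_iff in_triv)
  next
    fix a b assume "a \<in> trivial_on k x" "b \<in> trivial_on k x"
    then obtain u v where uv: "u \<in> null_seqs k (along S)" "v \<in> null_seqs k (along S)"
      "a = seq_class k sequentially u" "b = seq_class k sequentially v"
      using in_triv by (metis null_seqs_iff)
    have "u \<otimes>\<^bsub>unitary_seqs k\<^esub> v \<in> null_seqs k (along S)"
      by (rule subgroup.m_closed[OF null_seqs_subgroup uv(1,2)])
    then show "a \<otimes>\<^bsub>U_HS k\<^esub> b \<in> trivial_on k x"
      using uv by (auto simp: mult_U_HS null_seqs_iff in_triv)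
  qed (auto simp: trivial_on_def)
qed

lemma seq_close_commute:
  assumes u: "u \<in> carrier (unitary_seqs k)" and v: "v \<in> carrier (unitary_seqs k)"
    and close: "seq_close k F u (\<lambda>n. 1\<^sub>m (k n))"
  shows "seq_close k F (\<lambda>n. u n * v n) (\<lambda>n. v n * u n)"
proof -
  have "seq_close k F (\<lambda>n. u n * v n) v"
    using seq_close_mult_right_iff[OF u one_carrier_unitary_seqs v] close v by simp
  moreover have "seq_close k F (\<lambda>n. v n * u n) v"
    using seq_close_mult_left_iff[OF u one_carrier_unitary_seqs v] close v by simp
  then have "seq_close k F v (\<lambda>n. v n * u n)"
    by (rule seq_close_sym[OF mult_carrier_unitary_seqs[OF v u] v])
  ultimately show ?thesis
    by (rule seq_close_trans[OF mult_carrier_unitary_seqs[OF u v] v mult_carrier_unitary_seqs[OF v u]])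
qed

lemma trivial_on_direct_pair: "direct_pair (U_HS k) (trivial_on k x) (trivial_on k (- x))"
proof -
  obtain S where x: "x = class_mod_fin S" using ex_class_mod_fin by blast
  have mx: "- x = class_mod_fin (- S)" by (simp add: x uminus_pow_mod_fin.abs_eq)
  let ?one = "\<lambda>n. 1\<^sub>m (k n) :: complex mat"
  \<comment> \<open>Elements of the two subgroups have asymptotically disjoint supports. The second
    conjunct, applied to a common element, gives the trivial intersection.\<close>
  have disj: "a \<otimes>\<^bsub>U_HS k\<^esub> b = b \<otimes>\<^bsub>U_HS k\<^esub> a \<and> (a = b \<longrightarrow> a = \<one>\<^bsub>U_HS k\<^esub>)"
    if ab: "a \<in> trivial_on k x" "b \<in> trivial_on k (- x)" for a b
  proof -
    obtain u v where uv [simp]: "u \<in> carrier (unitary_seqs k)" "v \<in> carrier (unitary_seqs k)"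
      and ab': "a = seq_class k sequentially u" "b = seq_class k sequentially v"
      using ab by (auto simp: trivial_on_def carrier_U_HS)
    have u: "seq_close k (along S) u ?one" and v: "seq_close k (along (- S)) v ?one"
      using ab unfolding ab' x mx[unfolded x] by (simp_all add: seq_class_in_trivial_on_iff)
    have "seq_close k (along S) (\<lambda>n. u n * v n) (\<lambda>n. v n * u n)"
      by (rule seq_close_commute[OF uv u])
    moreover have "seq_close k (along (- S)) (\<lambda>n. u n * v n) (\<lambda>n. v n * u n)"
      by (rule seq_close_sym[OF mult_carrier_unitary_seqs[OF uv(2,1)] mult_carrier_unitary_seqs[OF uv]
            seq_close_commute[OF uv(2,1) v]])
    ultimately have "seq_close k sequentially (\<lambda>n. u n * v n) (\<lambda>n. v n * u n)"
      by (rule seq_close_cases)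
    then have "a \<otimes>\<^bsub>U_HS k\<^esub> b = b \<otimes>\<^bsub>U_HS k\<^esub> a"
      by (simp add: ab' mult_U_HS seq_class_eq_iff)
    moreover have "a = \<one>\<^bsub>U_HS k\<^esub>" if "a = b"
    proof -
      have "seq_close k sequentially u v" using that by (simp add: ab' seq_class_eq_iff)
      then have "seq_close k (along (- S)) u ?one"
        using seq_close_trans[OF uv one_carrier_unitary_seqs _ v] seq_close_mono[of k sequentially u v "along (- S)"]
        by simp
      with u have "seq_close k sequentially u ?one" by (rule seq_close_cases)
      then show ?thesis by (simp add: ab' one_U_HS seq_class_eq_iff)
    qed
    ultimately show ?thesis by blast
  qed
  have prod: "\<exists>a\<in>trivial_on k x. \<exists>b\<in>trivial_on k (- x). g = a \<otimes>\<^bsub>U_HS k\<^esub> b" if g: "g \<in> carrier (U_HS k)" for g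
  proof -
    obtain w where w: "w \<in> carrier (unitary_seqs k)" "g = seq_class k sequentially w"
      using g by (auto simp: carrier_U_HS)
    define u v where "u n = (if n \<in> S then 1\<^sub>m (k n) else w n)" and "v n = (if n \<in> S then w n else 1\<^sub>m (k n))" for n
    have uv: "u \<in> carrier (unitary_seqs k)" "v \<in> carrier (unitary_seqs k)"
      using w(1) by (auto simp: carrier_unitary_seqs u_def v_def)
    have "(\<lambda>n. u n * v n) = w"
      using left_mult_one_mat[OF unitary_seqsD(2)[OF w(1)]] right_mult_one_mat[OF unitary_seqsD(2)[OF w(1)]]
      by (auto simp: u_def v_def)
    then have "g = seq_class k sequentially u \<otimes>\<^bsub>U_HS k\<^esub> seq_class k sequentially v"
      using uv w by (simp add: mult_U_HS)
    moreover have "seq_class k sequentially u \<in> trivial_on k x"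
      unfolding x seq_class_in_trivial_on_iff[OF uv(1)]
      by (rule seq_close_alongI) (use uv in \<open>auto simp: u_def\<close>)
    moreover have "seq_class k sequentially v \<in> trivial_on k (- x)"
      unfolding mx seq_class_in_trivial_on_iff[OF uv(2)]
      by (rule seq_close_alongI) (use uv in \<open>auto simp: v_def\<close>)
    ultimately show ?thesis by blast
  qed
  have "\<one>\<^bsub>U_HS k\<^esub> \<in> trivial_on k y" for y
    by (rule subgroup.one_closed[OF trivial_on_subgroup])
  then have int: "trivial_on k x \<inter> trivial_on k (- x) = {\<one>\<^bsub>U_HS k\<^esub>}"
    using disj by blast
  show ?thesis
    unfolding direct_pair_def
    by (intro conjI ballI trivial_on_subgroup int) (use disj prod in blast)+
qed

text \<open>At each coordinate choose the conjugator given by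
  \<open>ex_conj_far_from_commuting\<close>. The conjugated sequence still represents an element of
  \<open>N\<close>, so it commutes with \<open>u\<close> asymptotically, which forces the cube of
  the minimum to 0.\<close>

lemma min_defect_tendsto_zero:
  assumes k: "\<And>n. 0 < k n" and d: "direct_pair (U_HS k) M N"
    and u: "u \<in> carrier (unitary_seqs k)" "seq_class k sequentially u \<in> M"
    and v: "v \<in> carrier (unitary_seqs k)" "seq_class k sequentially v \<in> N"
  shows "(\<lambda>n. min (defect (k n) (u n)) (defect (k n) (v n))) \<longlonglongrightarrow> 0"
proof -
  let ?m = "\<lambda>n. min (defect (k n) (u n)) (defect (k n) (v n))"
  have "\<exists>h\<in>unitaries (k n). ?m n ^ 3 / 256
      \<le> hs_dist (k n) (u n * unitary_conj h (v n)) (unitary_conj h (v n) * u n)" for n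
    using ex_conj_far_from_commuting[OF unitary_seqsD(1)[OF u(1)] unitary_seqsD(1)[OF v(1)] k] .
  then obtain h where h: "\<And>n. h n \<in> unitaries (k n)"
    and le: "\<And>n. ?m n ^ 3 / 256 \<le> hs_dist (k n) (u n * unitary_conj (h n) (v n)) (unitary_conj (h n) (v n) * u n)"
    by metis
  let ?w = "\<lambda>n. unitary_conj (h n) (v n)"
  have hc: "h \<in> carrier (unitary_seqs k)" using h by (simp add: carrier_unitary_seqs)
  have wc: "?w \<in> carrier (unitary_seqs k)"
    using h unitary_seqsD(1)[OF v(1)] by (simp add: carrier_unitary_seqs)
  have "?w = (\<lambda>n. h n * v n * mat_adjoint (h n))"
    using unitary_seqsD(2)[OF hc] unitary_seqsD(2)[OF v(1)]
    by (auto simp: unitary_conj_def intro!: ext assoc_mult_square[symmetric])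
  then have "seq_class k sequentially ?w = seq_class k sequentially h \<otimes>\<^bsub>U_HS k\<^esub> seq_class k sequentially v
      \<otimes>\<^bsub>U_HS k\<^esub> inv\<^bsub>U_HS k\<^esub> seq_class k sequentially h"
    using hc v(1) by (simp add: inv_U_HS mult_U_HS)
  then have "seq_class k sequentially ?w \<in> N"
    using group.direct_pair_conj_closed[OF group_U_HS d v(2)] hc by simp
  then have "seq_class k sequentially u \<otimes>\<^bsub>U_HS k\<^esub> seq_class k sequentially ?w
      = seq_class k sequentially ?w \<otimes>\<^bsub>U_HS k\<^esub> seq_class k sequentially u"
    using direct_pairD(3)[OF d u(2)] by blast
  then have lim: "(\<lambda>n. hs_dist (k n) (u n * ?w n) (?w n * u n)) \<longlonglongrightarrow> 0"
    using u(1) wc by (simp add: mult_U_HS seq_class_eq_iff) (simp add: seq_close_def)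
  have nonneg: "0 \<le> ?m n" for n
    using u(1) v(1) k by (simp add: unitary_seqsD(1))
  have "(\<lambda>n. ?m n ^ 3 / 256) \<longlonglongrightarrow> 0"
    by (rule tendsto_sandwich[OF _ _ tendsto_const lim]) (use le nonneg in auto)
  then have "(\<lambda>n. root 3 (256 * (?m n ^ 3 / 256))) \<longlonglongrightarrow> root 3 (256 * 0)"
    by (intro tendsto_intros)
  moreover have "root 3 (256 * (?m n ^ 3 / 256)) = ?m n" for n
    using nonneg[of n] by (simp add: real_root_power_cancel)
  ultimately show ?thesis by simp
qed

text \<open>An element of a direct factor is a commutator within that factor, and commutators of almost
  scalar unitaries are almost trivial.\<close>

lemma direct_factor_subset_trivial_on:
  assumes k: "\<And>n. 0 < k n" "filterlim k at_top sequentially" and d: "direct_pair (U_HS k) M N"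
    and small: "\<And>u. u \<in> carrier (unitary_seqs k) \<Longrightarrow> seq_class k sequentially u \<in> M \<Longrightarrow>
      ((\<lambda>n. defect (k n) (u n)) \<longlongrightarrow> 0) (along S)"
  shows "M \<subseteq> trivial_on k (class_mod_fin S)"
proof
  fix b assume b: "b \<in> M"
  then obtain v where v: "v \<in> carrier (unitary_seqs k)" "b = seq_class k sequentially v"
    using direct_pairD(6)[OF d] by (auto simp: carrier_U_HS)
  have "\<exists>x y. x \<in> unitaries (k n) \<and> y \<in> unitaries (k n) \<and>
      hs_dist (k n) (x * y) (v n * (y * x)) \<le> 2 / sqrt (real (k n))" for n
    using unitary_near_commutator[OF unitary_seqsD(1)[OF v(1)] k(1)] by metis
  then obtain x y where xy: "\<And>n. x n \<in> unitaries (k n)" "\<And>n. y n \<in> unitaries (k n)"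
    "\<And>n. hs_dist (k n) (x n * y n) (v n * (y n * x n)) \<le> 2 / sqrt (real (k n))"
    by metis
  have xyc: "x \<in> carrier (unitary_seqs k)" "y \<in> carrier (unitary_seqs k)"
    using xy by (simp_all add: carrier_unitary_seqs)
  have "(\<lambda>n. 2 / sqrt (real (k n))) \<longlonglongrightarrow> 0"
    by (intro tendsto_divide_0[OF tendsto_const] filterlim_at_top_imp_at_infinity
        filterlim_compose[OF sqrt_at_top] filterlim_compose[OF filterlim_real_sequentially] k(2))
  then have "seq_close k sequentially (\<lambda>n. x n * y n) (\<lambda>n. v n * (y n * x n))"
    using xy unitary_seqsD(1)[OF v(1)]
    by (intro seq_closeI_le[where f = "\<lambda>n. 2 / sqrt (real (k n))"]) auto
  then have "seq_class k sequentially x \<otimes>\<^bsub>U_HS k\<^esub> seq_class k sequentially y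
      = b \<otimes>\<^bsub>U_HS k\<^esub> (seq_class k sequentially y \<otimes>\<^bsub>U_HS k\<^esub> seq_class k sequentially x)"
    using xyc v by (simp add: mult_U_HS seq_class_eq_iff)
  then obtain p q where pq: "p \<in> M" "q \<in> M" "p \<otimes>\<^bsub>U_HS k\<^esub> q = b \<otimes>\<^bsub>U_HS k\<^esub> (q \<otimes>\<^bsub>U_HS k\<^esub> p)"
    using group.direct_pair_commutator[OF group_U_HS d b _ _ _] xyc by blast
  obtain p' q' where pq': "p' \<in> carrier (unitary_seqs k)" "q' \<in> carrier (unitary_seqs k)"
    "p = seq_class k sequentially p'" "q = seq_class k sequentially q'"
    using pq(1,2) direct_pairD(6)[OF d] by (auto simp: carrier_U_HS dest!: direct_pairD(6)[OF d])
  \<comment> \<open>The commutator identity holds along the whole sequence. Along \<open>S\<close>,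
    where \<open>p'\<close> and \<open>q'\<close> commute asymptotically, it leaves only
    \<open>v\<close> close to the identity.\<close>
  have 1: "seq_close k sequentially (\<lambda>n. v n * (q' n * p' n)) (\<lambda>n. p' n * q' n)"
    using pq(3) pq' v seq_class_eq_iff[of "\<lambda>n. v n * (q' n * p' n)" k "\<lambda>n. p' n * q' n" sequentially]
    by (simp add: mult_U_HS)
  have 2: "seq_close k (along S) (\<lambda>n. p' n * q' n) (\<lambda>n. q' n * p' n)"
  proof (rule seq_closeI_le)
    show "eventually (\<lambda>n. hs_dist (k n) (p' n * q' n) (q' n * p' n) \<le> defect (k n) (p' n)) (along S)"
      using unitary_seqsD(1)[OF pq'(1)] unitary_seqsD(1)[OF pq'(2)] k(1)
      by (intro always_eventually allI hs_dist_le_defect)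
    show "((\<lambda>n. defect (k n) (p' n)) \<longlongrightarrow> 0) (along S)"
      using small[OF pq'(1)] pq(1) pq'(3) by simp
  qed (use unitary_seqsD(1)[OF pq'(1)] unitary_seqsD(1)[OF pq'(2)] in auto)
  have "seq_close k (along S) (\<lambda>n. v n * (q' n * p' n)) (\<lambda>n. q' n * p' n)"
    by (rule seq_close_trans[OF _ _ _ seq_close_mono[OF 1] 2]) (use v pq' in auto)
  then have "seq_close k (along S) (\<lambda>n. v n * (q' n * p' n)) (\<lambda>n. 1\<^sub>m (k n) * (q' n * p' n))"
    using unitary_seqs_group_laws(3)[OF mult_carrier_unitary_seqs[OF pq'(2,1)]] by simp
  then have "seq_close k (along S) v (\<lambda>n. 1\<^sub>m (k n))"
    using seq_close_mult_right_iff[OF v(1) one_carrier_unitary_seqs mult_carrier_unitary_seqs[OF pq'(2,1)]] by blast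
  then show "b \<in> trivial_on k (class_mod_fin S)"
    using v by (simp add: seq_class_in_trivial_on_iff)
qed

lemma ex_seq_large_defect:
  assumes "filterlim k at_top sequentially"
  obtains g where "g \<in> carrier (unitary_seqs k)" "eventually (\<lambda>n. 1 \<le> defect (k n) (g n)) sequentially"
proof -
  \<comment> \<open>Coordinates with \<open>k n < 16\<close> may carry any unitary; they are
    finitely many because \<open>k\<close> tends to infinity.\<close>
  have "\<exists>g\<in>unitaries (k n). 16 \<le> k n \<longrightarrow> 1 \<le> defect (k n) g" for n
    using ex_large_defect[of "k n"] one_unitaries by metis
  then obtain g where g: "\<And>n. g n \<in> unitaries (k n)" "\<And>n. 16 \<le> k n \<Longrightarrow> 1 \<le> defect (k n) (g n)"
    by metis
  moreover have "eventually (\<lambda>n. 16 \<le> k n) sequentially"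
    using assms by (simp add: filterlim_at_top)
  ultimately show ?thesis
    by (intro that[of g]) (auto simp: carrier_unitary_seqs elim: eventually_mono)
qed

text \<open>Where the \<open>M\<close>-part \<open>u\<close> of \<open>g\<close> has large defect,
  all elements of \<open>N\<close> are nearly scalar; elsewhere the \<open>N\<close>-part
  \<open>w\<close> has large defect, and all elements of \<open>M\<close> are nearly scalar. This
  places \<open>M\<close> and \<open>N\<close> inside two complementary subgroups, and nested
  decompositions agree.\<close>

lemma direct_factor_eq_trivial_on:
  assumes k: "\<And>n. 0 < k n" "filterlim k at_top sequentially" and d: "direct_pair (U_HS k) M N"
  shows "\<exists>x. M = trivial_on k x"
proof -
  obtain g where g: "g \<in> carrier (unitary_seqs k)" "eventually (\<lambda>n. 1 \<le> defect (k n) (g n)) sequentially"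
    using ex_seq_large_defect[OF k(2)] .
  obtain a b where ab: "a \<in> M" "b \<in> N" "seq_class k sequentially g = a \<otimes>\<^bsub>U_HS k\<^esub> b"
    using direct_pairD(5)[OF d seq_class_in_U_HS[OF g(1)]] by blast
  obtain u w where uw: "u \<in> carrier (unitary_seqs k)" "w \<in> carrier (unitary_seqs k)"
    "a = seq_class k sequentially u" "b = seq_class k sequentially w"
    using ab(1,2) by (auto simp: carrier_U_HS dest!: direct_pairD(6,7)[OF d])
  note uwU = unitary_seqsD(1)[OF uw(1)] unitary_seqsD(1)[OF uw(2)] unitary_seqsD(1)[OF g(1)]
  have "seq_close k sequentially g (\<lambda>n. u n * w n)"
    using ab(3) uw g(1) by (simp add: mult_U_HS seq_class_eq_iff)
  then have "eventually (\<lambda>n. hs_dist (k n) (g n) (u n * w n) < 1 / 4) sequentially"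
    unfolding seq_close_def by (rule order_tendstoD) simp
  \<comment> \<open>With distance below \<open>1 / 4\<close>, its doubled contribution to the bound
    for \<open>defect (k n) (g n)\<close> is below \<open>1 / 2\<close>, so the defects of
    \<open>u n\<close> and \<open>w n\<close> add up to more than \<open>1 / 2\<close>.\<close>
  then have ev: "eventually (\<lambda>n. 1 / 4 \<le> defect (k n) (u n) \<or> 1 / 4 \<le> defect (k n) (w n)) sequentially"
    using g(2)
  proof eventually_elim
    case (elim n)
    have "defect (k n) (g n) \<le> defect (k n) (u n * w n) + 2 * hs_dist (k n) (g n) (u n * w n)"
      using uwU k(1) by (intro defect_le_defect_plus_hs_dist) auto
    moreover have "defect (k n) (u n * w n) \<le> defect (k n) (u n) + defect (k n) (w n)"
      using uwU k(1) by (intro defect_mult_le) auto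
    ultimately show ?case using elim by linarith
  qed
  define S where "S = {n. 1 / 4 \<le> defect (k n) (u n)}"
  \<comment> \<open>If the minimum is below \<open>1 / 4\<close> while the defect of
    \<open>t n\<close> is not, the minimum is the defect of \<open>s n\<close>; hence the bound
    \<open>min \<epsilon> (1 / 4)\<close>.\<close>
  have lim: "((\<lambda>n. defect (k n) (s n)) \<longlongrightarrow> 0) (along T)"
    if "(\<lambda>n. min (defect (k n) (s n)) (defect (k n) (t n))) \<longlonglongrightarrow> 0" "s \<in> carrier (unitary_seqs k)"
      "eventually (\<lambda>n. n \<in> T \<longrightarrow> 1 / 4 \<le> defect (k n) (t n)) sequentially" for s t T
  proof (rule tendstoI)
    fix \<epsilon> :: real assume "0 < \<epsilon>"
    then have "eventually (\<lambda>n. min (defect (k n) (s n)) (defect (k n) (t n)) < min \<epsilon> (1 / 4)) sequentially"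
      using that(1) by (intro order_tendstoD) auto
    then have "eventually (\<lambda>n. n \<in> T \<longrightarrow> dist (defect (k n) (s n)) 0 < \<epsilon>) sequentially"
      using that(3)
    proof eventually_elim
      case (elim n)
      have "0 \<le> defect (k n) (s n)" by (rule defect_nonneg[OF unitary_seqsD(1)[OF that(2)] k(1)])
      with elim show ?case by (auto simp: min_def dist_real_def split: if_splits)
    qed
    then show "eventually (\<lambda>n. dist (defect (k n) (s n)) 0 < \<epsilon>) (along T)"
      by (simp add: eventually_inf_principal)
  qed
  have "M \<subseteq> trivial_on k (class_mod_fin (- S))"
  proof (rule direct_factor_subset_trivial_on[OF k d])
    fix v assume v: "v \<in> carrier (unitary_seqs k)" "seq_class k sequentially v \<in> M"
    show "((\<lambda>n. defect (k n) (v n)) \<longlongrightarrow> 0) (along (- S))"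
      by (rule lim[OF min_defect_tendsto_zero[OF k(1) d v uw(2)] v(1)])
        (use ab(2) uw(4) ev in \<open>auto simp: S_def elim: eventually_mono\<close>)
  qed
  moreover have "N \<subseteq> trivial_on k (class_mod_fin S)"
  proof (rule direct_factor_subset_trivial_on[OF k direct_pair_commute[OF d]])
    fix v assume v: "v \<in> carrier (unitary_seqs k)" "seq_class k sequentially v \<in> N"
    show "((\<lambda>n. defect (k n) (v n)) \<longlongrightarrow> 0) (along S)"
      by (rule lim[OF min_defect_tendsto_zero[OF k(1) direct_pair_commute[OF d] v uw(1)] v(1)])
        (use ab(1) uw(3) in \<open>auto simp: S_def\<close>)
  qed
  moreover have "class_mod_fin S = - class_mod_fin (- S)"
    by (simp add: uminus_pow_mod_fin.abs_eq)
  ultimately have "M = trivial_on k (class_mod_fin (- S))"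
    using group.direct_pair_subset_imp_eq[OF group_U_HS d trivial_on_direct_pair] by simp
  then show ?thesis ..
qed

text \<open>For the direction from subgroups to classes, an element that is the identity on
  \<open>S\<close> and eventually of large defect off \<open>S\<close> detects any infinite part of
  \<open>T\<close> outside \<open>S\<close>.\<close>

lemma trivial_on_subset_iff:
  assumes k: "\<And>n. 0 < k n" "filterlim k at_top sequentially"
  shows "trivial_on k x \<subseteq> trivial_on k y \<longleftrightarrow> y \<le> x"
proof -
  obtain S T where x: "x = class_mod_fin S" and y: "y = class_mod_fin T" using ex_class_mod_fin by metis
  have le: "y \<le> x \<longleftrightarrow> finite (T - S)" by (simp add: x y less_eq_pow_mod_fin.abs_eq)
  show ?thesis
  proof
    assume "y \<le> x"
    then obtain m where m: "\<And>n. n \<in> T - S \<Longrightarrow> n < m"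
      using le by (meson finite_nat_set_iff_bounded)
    have "along T \<le> along S"
    proof (rule filter_leI)
      fix P assume "eventually P (along S)"
      then have "eventually (\<lambda>n. n \<in> S \<longrightarrow> P n) sequentially" by (simp add: eventually_inf_principal)
      then have "eventually (\<lambda>n. n \<in> T \<longrightarrow> P n) sequentially"
        using eventually_ge_at_top[of m] by eventually_elim (use m in force)
      then show "eventually P (along T)" by (simp add: eventually_inf_principal)
    qed
    then show "trivial_on k x \<subseteq> trivial_on k y"
      using seq_class_in_trivial_on_iff[of _ k] seq_close_mono
      by (auto simp: x y trivial_on_def carrier_U_HS one_U_HS eq_along_iff)
  next
    assume sub: "trivial_on k x \<subseteq> trivial_on k y"
    obtain g where g: "g \<in> carrier (unitary_seqs k)" "eventually (\<lambda>n. 1 \<le> defect (k n) (g n)) sequentially"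
      using ex_seq_large_defect[OF k(2)] .
    define u where "u n = (if n \<in> S then 1\<^sub>m (k n) else g n)" for n
    have u: "u \<in> carrier (unitary_seqs k)" using g(1) by (auto simp: u_def carrier_unitary_seqs)
    have "seq_class k sequentially u \<in> trivial_on k x"
      unfolding x seq_class_in_trivial_on_iff[OF u]
      by (rule seq_close_alongI) (use u in \<open>auto simp: u_def\<close>)
    then have "seq_close k (along T) u (\<lambda>n. 1\<^sub>m (k n))"
      using sub u by (auto simp: y seq_class_in_trivial_on_iff)
    then have "eventually (\<lambda>n. hs_dist (k n) (u n) (1\<^sub>m (k n)) < 1 / 2) (along T)"
      unfolding seq_close_def by (rule order_tendstoD) simp
    then have "eventually (\<lambda>n. n \<in> T \<longrightarrow> hs_dist (k n) (u n) (1\<^sub>m (k n)) < 1 / 2) sequentially"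
      by (simp add: eventually_inf_principal)
    then have "eventually (\<lambda>n. n \<notin> T - S) sequentially"
      using g(2)
    proof eventually_elim
      case (elim n)
      \<comment> \<open>A distance below \<open>1 / 2\<close> from the identity forces the defect
        below 1, which \<open>g n\<close> does not allow.\<close>
      have "defect (k n) (u n) \<le> defect (k n) (1\<^sub>m (k n)) + 2 * hs_dist (k n) (u n) (1\<^sub>m (k n))"
        using k(1) unitary_seqsD(1)[OF u] by (intro defect_le_defect_plus_hs_dist) auto
      then have "defect (k n) (u n) \<le> 2 * hs_dist (k n) (u n) (1\<^sub>m (k n))"
        using k(1) by simp
      moreover have "u n = g n" if "n \<notin> S" using that by (simp add: u_def)
      ultimately show ?case using elim by fastforce
    qed
    then have "finite (T - S)"
      unfolding eventually_sequentially
      by (metis finite_nat_set_iff_bounded not_le_imp_less)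
    then show "y \<le> x" using le by simp
  qed
qed

section \<open>Boolean automorphisms and the Stone--Cech boundary\<close>

text \<open>The bounds, the lattice operations and the complement are all determined by the
  order.\<close>

lemma boolean_automorphismI:
  assumes "bij h" "\<And>x y. h x \<le> h y \<longleftrightarrow> x \<le> y"
  shows "boolean_automorphism h"
proof -
  have surj: "\<exists>w. z = h w" for z using bij_is_surj[OF assms(1)] by (metis surjD)
  have bot: "h bot = bot" using surj[of bot] assms(2) by (metis bot.extremum bot.extremum_uniqueI)
  have top: "h Orderings.top = Orderings.top" using surj[of Orderings.top] assms(2) by (metis top.extremum top.extremum_uniqueI)
  have inf: "h (inf x y) = inf (h x) (h y)" for x y
  proof (rule antisym)
    show "h (inf x y) \<le> inf (h x) (h y)" by (simp add: assms(2))
    obtain w where w: "inf (h x) (h y) = h w" using surj by metis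
    then have "h w \<le> h x" "h w \<le> h y" by (metis inf_le1, metis inf_le2)
    then show "inf (h x) (h y) \<le> h (inf x y)" by (simp add: w assms(2))
  qed
  have sup: "h (sup x y) = sup (h x) (h y)" for x y
  proof (rule antisym)
    show "sup (h x) (h y) \<le> h (sup x y)" by (simp add: assms(2))
    obtain w where w: "sup (h x) (h y) = h w" using surj by metis
    then have "h x \<le> h w" "h y \<le> h w" by (metis sup_ge1, metis sup_ge2)
    then show "h (sup x y) \<le> sup (h x) (h y)" by (simp add: w assms(2))
  qed
  have "- h x = h (- x)" for x
    by (rule compl_unique) (simp_all add: bot top flip: inf sup)
  then show ?thesis
    using assms(1) bot top inf sup by (simp add: boolean_automorphism_def)
qed

lemma boolean_automorphism_inv:
  assumes h: "boolean_automorphism h"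
  shows "boolean_automorphism (inv_into UNIV h)"
proof (rule boolean_automorphismI)
  have b: "bij h" using h by (simp add: boolean_automorphism_def)
  then show "bij (inv_into UNIV h)" by (rule bij_imp_bij_inv)
  have "h (inf (inv_into UNIV h x) (inv_into UNIV h y)) = inf x y" for x y
    using h b by (simp add: boolean_automorphism_def surj_f_inv_f bij_is_surj)
  then show "inv_into UNIV h x \<le> inv_into UNIV h y \<longleftrightarrow> x \<le> y" for x y
    using b by (metis bij_inv_eq_iff inf.absorb_iff1)
qed

lemma boolean_automorphism_mono: "boolean_automorphism h \<Longrightarrow> x \<le> y \<Longrightarrow> h x \<le> h y"
  unfolding boolean_automorphism_def by (metis inf.absorb_iff1)

text \<open>An isomorphism carries direct factors to direct factors, and on both sides these are the
  subgroups \<open>trivial_on\<close>. The order reversals on the two sides cancel, so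
  \<open>\<Theta>\<close> preserves the order; the inverse of \<open>\<phi>\<close> supplies
  surjectivity.\<close>

lemma iso_induces_order_iso:
  assumes k: "\<And>n. 0 < k n" "filterlim k at_top sequentially"
    and l: "\<And>n. 0 < l n" "filterlim l at_top sequentially"
    and \<phi>: "\<phi> \<in> iso (U_HS k) (U_HS l)"
  obtains \<Theta> where "boolean_automorphism \<Theta>" "\<And>x. \<phi> ` trivial_on k x = trivial_on l (\<Theta> x)"
proof -
  define \<psi> where "\<psi> = inv_into (carrier (U_HS k)) \<phi>"
  have \<psi>: "\<psi> \<in> iso (U_HS l) (U_HS k)"
    unfolding \<psi>_def by (rule group.iso_set_sym[OF group_U_HS \<phi>])
  have bij: "bij_betw \<phi> (carrier (U_HS k)) (carrier (U_HS l))" using \<phi> by (simp add: iso_def)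
  have tc: "trivial_on k x \<subseteq> carrier (U_HS k)" "trivial_on l x \<subseteq> carrier (U_HS l)" for x
    by (auto simp: trivial_on_def)
  have \<psi>\<phi>: "\<psi> ` \<phi> ` A = A" if "A \<subseteq> carrier (U_HS k)" for A
    unfolding \<psi>_def using bij that by (simp add: bij_betw_def inv_into_image_cancel)
  have \<phi>\<psi>: "\<phi> ` \<psi> ` A = A" if "A \<subseteq> carrier (U_HS l)" for A
    unfolding \<psi>_def using bij that by (simp add: bij_betw_def image_inv_into_cancel)
  have "\<exists>y. \<phi> ` trivial_on k x = trivial_on l y" for x
    by (rule direct_factor_eq_trivial_on[OF l direct_pair_iso_image[OF _ _ \<phi> trivial_on_direct_pair]]) auto
  then obtain \<Theta> where \<Theta>: "\<And>x. \<phi> ` trivial_on k x = trivial_on l (\<Theta> x)" by metis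
  have ex: "\<exists>y. \<psi> ` trivial_on l x = trivial_on k y" for x
    by (rule direct_factor_eq_trivial_on[OF k direct_pair_iso_image[OF _ _ \<psi> trivial_on_direct_pair]]) auto
  have ord: "\<Theta> x \<le> \<Theta> y \<longleftrightarrow> x \<le> y" for x y
  proof -
    have "\<Theta> x \<le> \<Theta> y \<longleftrightarrow> \<phi> ` trivial_on k y \<subseteq> \<phi> ` trivial_on k x"
      by (simp add: \<Theta> trivial_on_subset_iff[OF l])
    also have "\<dots> \<longleftrightarrow> trivial_on k y \<subseteq> trivial_on k x"
      using \<psi>\<phi>[OF tc(1)] by (metis image_mono)
    also have "\<dots> \<longleftrightarrow> x \<le> y" by (rule trivial_on_subset_iff[OF k])
    finally show ?thesis .
  qed
  have "bij \<Theta>"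
  proof (rule bijI)
    show "inj \<Theta>" by (rule injI) (metis antisym ord order_refl)
    have "\<exists>x. y = \<Theta> x" for y
    proof -
      obtain x where "\<psi> ` trivial_on l y = trivial_on k x" using ex by blast
      then have "trivial_on l y = trivial_on l (\<Theta> x)" using \<Theta> \<phi>\<psi>[OF tc(2)] by metis
      then show ?thesis by (metis antisym order_refl trivial_on_subset_iff[OF l])
    qed
    then show "surj \<Theta>" by (auto simp: surj_def)
  qed
  then show ?thesis using that[of \<Theta>] \<Theta> ord boolean_automorphismI by blast
qed

lemma eq_along_iso_iff:
  assumes \<phi>: "\<phi> \<in> iso (U_HS k) (U_HS l)" and \<Theta>: "\<And>x. \<phi> ` trivial_on k x = trivial_on l (\<Theta> x)"
    and a: "a \<in> carrier (U_HS k)" and b: "b \<in> carrier (U_HS k)"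
  shows "eq_along k x a b \<longleftrightarrow> eq_along l (\<Theta> x) (\<phi> a) (\<phi> b)"
proof -
  interpret group_hom "U_HS k" "U_HS l" \<phi>
    using \<phi> by (auto simp: group_hom_def group_hom_axioms_def iso_def)
  have inj: "inj_on \<phi> (carrier (U_HS k))" using \<phi> by (auto simp: iso_def bij_betw_def)
  let ?c = "a \<otimes>\<^bsub>U_HS k\<^esub> inv\<^bsub>U_HS k\<^esub> b"
  have "eq_along l (\<Theta> x) (\<phi> a) (\<phi> b) \<longleftrightarrow> \<phi> ?c \<in> \<phi> ` trivial_on k x"
    using a b by (simp add: eq_along_iff_trivial_on \<Theta>)
  also have "\<dots> \<longleftrightarrow> ?c \<in> trivial_on k x"
    using a b by (intro inj_on_image_mem_iff[OF inj]) (auto simp: trivial_on_def)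
  finally show ?thesis using a b by (simp add: eq_along_iff_trivial_on)
qed

section \<open>Stone duality, from Boolean automorphisms to homeomorphisms\<close>

definition stone_map :: "(pow_mod_fin \<Rightarrow> pow_mod_fin) \<Rightarrow> nat filter \<Rightarrow> nat filter" where
  "stone_map \<Theta> U = Abs_filter (\<lambda>P. class_in_ultrafilter (\<Theta> (class_mod_fin {n. P n})) U)"

lemma class_in_ultrafilter_simps:
  assumes U: "U \<in> topspace stone_cech_boundary"
  shows "class_in_ultrafilter (inf x y) U \<longleftrightarrow> class_in_ultrafilter x U \<and> class_in_ultrafilter y U"
    "class_in_ultrafilter (- x) U \<longleftrightarrow> \<not> class_in_ultrafilter x U"
    "\<not> class_in_ultrafilter bot U" "class_in_ultrafilter Orderings.top U"
proof -
  obtain S T where ST: "x = class_mod_fin S" "y = class_mod_fin T" using ex_class_mod_fin by metis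
  have uf: "ultrafilter U" using U by (simp add: topspace_stone_cech_boundary)
  show "class_in_ultrafilter (inf x y) U \<longleftrightarrow> class_in_ultrafilter x U \<and> class_in_ultrafilter y U"
    by (simp add: ST inf_pow_mod_fin.abs_eq class_in_ultrafilter_iff[OF U] eventually_conj_iff)
  have "\<not> (eventually (\<lambda>n. n \<in> S) U \<and> eventually (\<lambda>n. n \<notin> S) U)"
    using uf by (auto simp: ultrafilter_def dest: eventually_conj)
  then show "class_in_ultrafilter (- x) U \<longleftrightarrow> \<not> class_in_ultrafilter x U"
    using uf by (auto simp: ST uminus_pow_mod_fin.abs_eq class_in_ultrafilter_iff[OF U] ultrafilter_def)
  show "\<not> class_in_ultrafilter bot U" "class_in_ultrafilter Orderings.top U"
    using uf by (simp_all add: bot_pow_mod_fin_def top_pow_mod_fin_def class_in_ultrafilter_iff[OF U] ultrafilter_def)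
qed

lemma class_in_ultrafilter_mono:
  assumes "U \<in> topspace stone_cech_boundary" "x \<le> y" "class_in_ultrafilter x U"
  shows "class_in_ultrafilter y U"
  using class_in_ultrafilter_simps(1)[OF assms(1), of x y] assms(2,3) by (simp add: inf.absorb1)

lemma eventually_stone_map:
  assumes U: "U \<in> topspace stone_cech_boundary" and \<Theta>: "boolean_automorphism \<Theta>"
  shows "eventually P (stone_map \<Theta> U) \<longleftrightarrow> class_in_ultrafilter (\<Theta> (class_mod_fin {n. P n})) U"
proof -
  have "is_filter (\<lambda>P. class_in_ultrafilter (\<Theta> (class_mod_fin {n. P n})) U)"
  proof
    have "class_mod_fin {n. True} = Orderings.top" by (simp add: top_pow_mod_fin_def)
    then show "class_in_ultrafilter (\<Theta> (class_mod_fin {n. True})) U"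
      using \<Theta> class_in_ultrafilter_simps(4)[OF U] by (simp add: boolean_automorphism_def)
  next
    fix P Q assume "class_in_ultrafilter (\<Theta> (class_mod_fin {n. P n})) U" "class_in_ultrafilter (\<Theta> (class_mod_fin {n. Q n})) U"
    moreover have "class_mod_fin {n. P n \<and> Q n} = inf (class_mod_fin {n. P n}) (class_mod_fin {n. Q n})"
      by (simp add: inf_pow_mod_fin.abs_eq Collect_conj_eq)
    ultimately show "class_in_ultrafilter (\<Theta> (class_mod_fin {n. P n \<and> Q n})) U"
      using \<Theta> class_in_ultrafilter_simps(1)[OF U] by (simp add: boolean_automorphism_def)
  next
    fix P Q :: "nat \<Rightarrow> bool"
    assume "\<forall>n. P n \<longrightarrow> Q n" and P: "class_in_ultrafilter (\<Theta> (class_mod_fin {n. P n})) U"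
    then have "{n. P n} - {n. Q n} = {}" by blast
    then have "class_mod_fin {n. P n} \<le> class_mod_fin {n. Q n}"
      unfolding less_eq_pow_mod_fin.abs_eq by (metis finite.emptyI)
    then show "class_in_ultrafilter (\<Theta> (class_mod_fin {n. Q n})) U"
      using class_in_ultrafilter_mono[OF U boolean_automorphism_mono[OF \<Theta>] P] by blast
  qed
  then show ?thesis unfolding stone_map_def by (rule eventually_Abs_filter)
qed

text \<open>Finite sets represent \<open>bot\<close>, which \<open>\<Theta>\<close> fixes, so no
  finite set belongs to the image. This excludes both the improper filter and the principal
  ultrafilters.\<close>

lemma stone_map_in_boundary:
  assumes U: "U \<in> topspace stone_cech_boundary" and \<Theta>: "boolean_automorphism \<Theta>"
  shows "stone_map \<Theta> U \<in> topspace stone_cech_boundary"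
proof -
  note ev = eventually_stone_map[OF U \<Theta>]
  have bot: "class_mod_fin S = bot" if "finite S" for S
    using that by (simp add: bot_pow_mod_fin_def pow_mod_fin.abs_eq_iff eq_mod_fin_def)
  have \<Theta>bot: "\<Theta> bot = bot" using \<Theta> by (simp add: boolean_automorphism_def)
  have fin: "\<not> eventually P (stone_map \<Theta> U)" if "finite {n. P n}" for P
    using class_in_ultrafilter_simps(3)[OF U] by (simp add: ev bot[OF that] \<Theta>bot)
  have "stone_map \<Theta> U \<noteq> bot" using fin[of "\<lambda>_. False"] by auto
  moreover have "eventually P (stone_map \<Theta> U) \<or> eventually (\<lambda>n. \<not> P n) (stone_map \<Theta> U)" for P
  proof -
    have "class_mod_fin {n. \<not> P n} = - class_mod_fin {n. P n}"
      by (simp add: uminus_pow_mod_fin.abs_eq Collect_neg_eq)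
    then show ?thesis
      using \<Theta> class_in_ultrafilter_simps(2)[OF U] by (simp add: ev boolean_automorphism_def)
  qed
  moreover have "stone_map \<Theta> U \<noteq> principal {n}" for n
    using fin[of "\<lambda>m. m = n"] by (auto simp: eventually_principal)
  ultimately show ?thesis by (simp add: topspace_stone_cech_boundary ultrafilter_def)
qed

lemma class_in_stone_map_iff:
  assumes U: "U \<in> topspace stone_cech_boundary" and \<Theta>: "boolean_automorphism \<Theta>"
  shows "class_in_ultrafilter x (stone_map \<Theta> U) \<longleftrightarrow> class_in_ultrafilter (\<Theta> x) U"
proof -
  obtain S where "x = class_mod_fin S" using ex_class_mod_fin by blast
  then show ?thesis
    by (simp add: class_in_ultrafilter_iff[OF stone_map_in_boundary[OF U \<Theta>]] eventually_stone_map[OF U \<Theta>])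
qed

text \<open>Duality is contravariant: the composite map corresponds to
  \<open>\<Theta> \<circ> \<Theta>'\<close>, hence the order of composition in the
  hypothesis.\<close>

lemma stone_map_inv:
  assumes U: "U \<in> topspace stone_cech_boundary" and \<Theta>: "boolean_automorphism \<Theta>"
    and \<Theta>': "boolean_automorphism \<Theta>'" "\<And>x. \<Theta> (\<Theta>' x) = x"
  shows "stone_map \<Theta>' (stone_map \<Theta> U) = U"
proof (rule filter_eq_iff[THEN iffD2], rule allI)
  fix P
  show "eventually P (stone_map \<Theta>' (stone_map \<Theta> U)) \<longleftrightarrow> eventually P U"
    using class_in_ultrafilter_iff[OF U, of "{n. P n}"]
    by (simp add: eventually_stone_map[OF stone_map_in_boundary[OF U \<Theta>] \<Theta>'(1)]
        class_in_stone_map_iff[OF U \<Theta>] \<Theta>'(2))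
qed

text \<open>Preimages of basic open sets are basic: the set given by \<open>S\<close> pulls back to
  the one given by any representative of the image of its class under
  \<open>\<Theta>\<close>.\<close>

lemma continuous_map_stone_map:
  assumes \<Theta>: "boolean_automorphism \<Theta>"
  shows "continuous_map stone_cech_boundary stone_cech_boundary (stone_map \<Theta>)"
proof -
  let ?B = "\<lambda>S. {U. ultrafilter U \<and> eventually (\<lambda>n. n \<in> S) U}"
  let ?X = "topspace stone_cech_boundary"
  have "openin stone_cech_boundary (stone_map \<Theta> -` ?B S \<inter> ?X)" for S
  proof -
    obtain T where T: "\<Theta> (class_mod_fin S) = class_mod_fin T" using ex_class_mod_fin by blast
    have "stone_map \<Theta> -` ?B S \<inter> ?X = ?B T \<inter> ?X"
    proof -
      have "U \<in> stone_map \<Theta> -` ?B S \<longleftrightarrow> U \<in> ?B T" if U: "U \<in> ?X" for U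
        using U stone_map_in_boundary[OF U \<Theta>] class_in_stone_map_iff[OF U \<Theta>, of "class_mod_fin S"]
        by (simp add: T class_in_ultrafilter_iff) (simp add: topspace_stone_cech_boundary)
      then show ?thesis by blast
    qed
    moreover have "openin stone_cech_nat (?B T)"
      unfolding stone_cech_nat_def by (rule topology_generated_by_Basis) blast
    ultimately show ?thesis
      unfolding stone_cech_boundary_def
      by (simp add: openin_subtopology_Int topspace_subtopology Int_assoc[symmetric] openin_Int)
  qed
  then have "continuous_map stone_cech_boundary stone_cech_nat (stone_map \<Theta>)"
    unfolding stone_cech_nat_def continuous_on_generated_topo_iff
    using stone_map_in_boundary[OF _ \<Theta>] by (auto simp: topspace_stone_cech_boundary intro!: exI[of _ UNIV])
  then show ?thesis
    unfolding stone_cech_boundary_def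
    using stone_map_in_boundary[OF _ \<Theta>]
    by (auto simp: continuous_map_in_subtopology topspace_stone_cech_boundary stone_cech_boundary_def)
qed

lemma homeomorphic_map_stone_map:
  assumes \<Theta>: "boolean_automorphism \<Theta>"
  shows "homeomorphic_map stone_cech_boundary stone_cech_boundary (stone_map \<Theta>)"
proof -
  have b: "bij \<Theta>" using \<Theta> by (simp add: boolean_automorphism_def)
  note inv = boolean_automorphism_inv[OF \<Theta>]
  have "homeomorphic_maps stone_cech_boundary stone_cech_boundary (stone_map \<Theta>) (stone_map (inv_into UNIV \<Theta>))"
    unfolding homeomorphic_maps_def
    using continuous_map_stone_map[OF \<Theta>] continuous_map_stone_map[OF inv]
      stone_map_inv[OF _ \<Theta> inv] stone_map_inv[OF _ inv \<Theta>] b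
    by (simp add: bij_is_inj bij_is_surj surj_f_inv_f)
  then show ?thesis by (rule homeomorphic_maps_map[THEN iffD1, THEN conjunct1])
qed

text \<open>
  Convergence along an ultrafilter \<open>U\<close> need not be convergence along a member of \<open>U\<close>. But there is an
  infinite subset of any prescribed member of \<open>U\<close>, in general not itself in \<open>U\<close>, along which the
  limit is attained.
\<close>

lemma ex_pseudo_intersection:
  assumes "U \<le> sequentially" "U \<noteq> bot" "eventually (\<lambda>n. n \<in> S) U"
    and "\<And>\<epsilon>. 0 < \<epsilon> \<Longrightarrow> eventually (\<lambda>n. f n < \<epsilon>) U" and nonneg: "\<And>n. 0 \<le> f n"
  obtains R where "infinite R" "R \<subseteq> S" "(f \<longlongrightarrow> (0::real)) (along R)"
proof -
  have "\<exists>n\<ge>m. n \<in> S \<and> f n < 1 / real (Suc m)" for m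
  proof -
    have "eventually (\<lambda>n. m \<le> n) U"
      using assms(1) eventually_ge_at_top by (rule filter_leD)
    moreover have "eventually (\<lambda>n. f n < 1 / real (Suc m)) U" by (rule assms(4)) simp
    ultimately have "eventually (\<lambda>n. m \<le> n \<and> n \<in> S \<and> f n < 1 / real (Suc m)) U"
      using assms(3) by eventually_elim simp
    then show ?thesis using eventually_happens'[OF assms(2)] by blast
  qed
  then obtain r where r: "\<And>m. m \<le> r m" "\<And>m. r m \<in> S" "\<And>m. f (r m) < 1 / real (Suc m)" by metis
  show ?thesis
  proof (rule that[of "range r"])
    show "infinite (range r)"
      using r(1) unfolding infinite_nat_iff_unbounded_le by blast
    show "range r \<subseteq> S" using r(2) by blast
    show "(f \<longlongrightarrow> 0) (along (range r))"
    proof (rule tendstoI)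
      fix \<epsilon> :: real assume "0 < \<epsilon>"
      then obtain M where M: "1 / real (Suc M) < \<epsilon>" using nat_approx_posE by blast
      define B where "B = Max (r ` {..M})"
      have "f n < \<epsilon>" if n: "n \<in> range r" "B < n" for n
      proof -
        obtain m where m: "n = r m" using n(1) by blast
        have "M < m"
        proof (rule ccontr)
          assume "\<not> M < m"
          then have "r m \<le> B" unfolding B_def by (intro Max_ge) auto
          with n(2) m show False by simp
        qed
        then have "1 / real (Suc m) \<le> 1 / real (Suc M)" by (simp add: frac_le)
        then show ?thesis using r(3)[of m] M by (simp add: m)
      qed
      then have "eventually (\<lambda>n. n \<in> range r \<longrightarrow> dist (f n) 0 < \<epsilon>) sequentially"
        using nonneg by (intro eventually_sequentiallyI[of "Suc B"]) (auto simp: dist_real_def)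
      then show "eventually (\<lambda>n. dist (f n) 0 < \<epsilon>) (along (range r))"
        by (simp add: eventually_inf_principal)
    qed
  qed
qed

section \<open>Isomorphisms of metric ultraproducts\<close>

text \<open>An implication between four fixed representatives, so that it applies to
  \<open>\<phi>\<close> with \<open>\<Theta>\<close> and equally to the inverse direction.\<close>

lemma seq_close_transfer:
  assumes U: "U \<in> topspace stone_cech_boundary" and V: "V \<in> topspace stone_cech_boundary"
    and \<Theta>: "boolean_automorphism \<Theta>"
    and UV: "\<And>x. class_in_ultrafilter x U \<longleftrightarrow> class_in_ultrafilter (\<Theta> x) V"
    and u: "u \<in> carrier (unitary_seqs k)" "u' \<in> carrier (unitary_seqs k)"
    and v: "v \<in> carrier (unitary_seqs l)" "v' \<in> carrier (unitary_seqs l)"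
    and along: "\<And>x. eq_along k x (seq_class k sequentially u) (seq_class k sequentially u') \<Longrightarrow>
      eq_along l (\<Theta> x) (seq_class l sequentially v) (seq_class l sequentially v')"
    and close: "seq_close k U u u'"
  shows "seq_close l V v v'"
  unfolding seq_close_def
proof (rule tendstoI, rule ccontr)
  fix \<epsilon> :: real assume \<epsilon>: "0 < \<epsilon>"
    and "\<not> eventually (\<lambda>n. dist (hs_dist (l n) (v n) (v' n)) 0 < \<epsilon>) V"
  moreover have dist: "dist (hs_dist (l n) (v n) (v' n)) 0 = hs_dist (l n) (v n) (v' n)" for n
    using unitary_seqsD(1)[OF v(1)] unitary_seqsD(1)[OF v(2)] by (simp add: dist_real_def)
  \<comment> \<open>As \<open>V\<close> is an ultrafilter, the set where the images are at least
    \<open>\<epsilon>\<close> apart belongs to \<open>V\<close>; the preimage of its class under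
    \<open>\<Theta>\<close> then belongs to \<open>U\<close>.\<close>
  moreover define T where "T = {n. \<not> hs_dist (l n) (v n) (v' n) < \<epsilon>}"
  ultimately have "eventually (\<lambda>n. n \<in> T) V"
    using V by (auto simp: topspace_stone_cech_boundary ultrafilter_def)
  then have "class_in_ultrafilter (class_mod_fin T) V" by (simp add: class_in_ultrafilter_iff[OF V])
  moreover obtain S where S: "class_mod_fin T = \<Theta> (class_mod_fin S)"
    using \<Theta> ex_class_mod_fin unfolding boolean_automorphism_def by (metis bij_pointE)
  ultimately have inS: "eventually (\<lambda>n. n \<in> S) U"
    by (simp add: UV[symmetric] class_in_ultrafilter_iff[OF U])
  have small: "eventually (\<lambda>n. hs_dist (k n) (u n) (u' n) < \<delta>) U" if "0 < \<delta>" for \<delta>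
    using close that unfolding seq_close_def by (rule order_tendstoD)
  have "U \<noteq> bot" using U by (simp add: topspace_stone_cech_boundary ultrafilter_def)
  then obtain R where R: "infinite R" "R \<subseteq> S" "((\<lambda>n. hs_dist (k n) (u n) (u' n)) \<longlongrightarrow> 0) (along R)"
    using ex_pseudo_intersection[OF nonprincipal_le_sequentially[OF U] _ inS small
        hs_dist_nonneg[OF unitary_seqsD(1)[OF u(1)] unitary_seqsD(1)[OF u(2)]]] by blast
  \<comment> \<open>\<open>R\<close> need not belong to \<open>U\<close>, so the contradiction is
    one of cardinality: \<open>R'\<close> is almost contained in \<open>T\<close>, yet the images
    are close along \<open>R'\<close>. This makes \<open>R'\<close> finite, and with it
    \<open>R\<close>.\<close>
  obtain R' where R': "\<Theta> (class_mod_fin R) = class_mod_fin R'" using ex_class_mod_fin by blast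
  have "class_mod_fin R \<le> class_mod_fin S"
    using R(2) by (simp add: less_eq_pow_mod_fin.abs_eq) (metis Diff_eq_empty_iff finite.emptyI)
  then have "class_mod_fin R' \<le> class_mod_fin T"
    using boolean_automorphism_mono[OF \<Theta>] by (metis R' S)
  then have "finite (R' - T)" by (simp add: less_eq_pow_mod_fin.abs_eq)
  have "eq_along k (class_mod_fin R) (seq_class k sequentially u) (seq_class k sequentially u')"
    using R(3) by (simp add: eq_along_iff[OF u] seq_close_def)
  then have "seq_close l (along R') v v'"
    using along[of "class_mod_fin R"] by (simp add: R' eq_along_iff[OF v])
  then have "eventually (\<lambda>n. hs_dist (l n) (v n) (v' n) < \<epsilon>) (along R')"
    unfolding seq_close_def using \<epsilon> by (rule order_tendstoD)
  then obtain m where "\<And>n. m \<le> n \<Longrightarrow> n \<in> R' \<Longrightarrow> n \<notin> T"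
    by (auto simp: eventually_inf_principal eventually_sequentially T_def)
  then have "R' \<subseteq> (R' - T) \<union> {..<m}" by (auto simp: not_le[symmetric])
  then have "finite R'" using \<open>finite (R' - T)\<close> by (meson finite_UnI finite_lessThan finite_subset)
  then have "class_mod_fin R' = bot"
    by (simp add: bot_pow_mod_fin_def pow_mod_fin.abs_eq_iff eq_mod_fin_def)
  then have "\<Theta> (class_mod_fin R) = \<Theta> bot"
    using \<Theta> by (simp add: R' boolean_automorphism_def)
  then have "class_mod_fin R = bot"
    using \<Theta> unfolding boolean_automorphism_def by (metis bij_pointE)
  then have "finite R"
    by (simp add: bot_pow_mod_fin_def pow_mod_fin.abs_eq_iff eq_mod_fin_def)
  with R(1) show False ..
qed

text \<open>A choice of representatives lifts \<open>\<phi>\<close> to sequences. The two directions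
  of \<open>close_iff\<close> show that the resulting class modulo \<open>V\<close> depends only on
  the class modulo \<open>U\<close>, and that it determines the latter.\<close>

lemma iso_induces_ultraproduct_iso:
  assumes \<phi>: "\<phi> \<in> iso (U_HS k) (U_HS l)" and \<Theta>: "boolean_automorphism \<Theta>"
    and eq: "\<And>x a b. a \<in> carrier (U_HS k) \<Longrightarrow> b \<in> carrier (U_HS k) \<Longrightarrow>
      eq_along k x a b \<longleftrightarrow> eq_along l (\<Theta> x) (\<phi> a) (\<phi> b)"
    and U: "U \<in> topspace stone_cech_boundary" and V: "V \<in> topspace stone_cech_boundary"
    and UV: "\<And>x. class_in_ultrafilter x U \<longleftrightarrow> class_in_ultrafilter (\<Theta> x) V"
  shows "\<exists>\<phi>\<^sub>U\<in>iso (metric_ultraproduct k U) (metric_ultraproduct l V).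
    \<forall>u\<in>carrier (unitary_seqs k). \<forall>v\<in>carrier (unitary_seqs l).
      \<phi> (seq_class k sequentially u) = seq_class l sequentially v \<longrightarrow>
      \<phi>\<^sub>U (seq_class k U u) = seq_class l V v"
proof -
  let ?K = "\<lambda>u. seq_class k sequentially u" and ?L = "\<lambda>v. seq_class l sequentially v"
  interpret group_hom "U_HS k" "U_HS l" \<phi>
    using \<phi> by (auto simp: group_hom_def group_hom_axioms_def iso_def)
  have bij: "bij \<Theta>" using \<Theta> by (simp add: boolean_automorphism_def)
  have close_iff: "seq_close k U u u' \<longleftrightarrow> seq_close l V v v'"
    if u: "u \<in> carrier (unitary_seqs k)" "u' \<in> carrier (unitary_seqs k)"
      and v: "v \<in> carrier (unitary_seqs l)" "v' \<in> carrier (unitary_seqs l)"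
      and \<phi>u: "\<phi> (?K u) = ?L v" "\<phi> (?K u') = ?L v'" for u u' v v'
  proof
    have *: "eq_along k x (?K u) (?K u') \<longleftrightarrow> eq_along l (\<Theta> x) (?L v) (?L v')" for x
      using eq[of "?K u" "?K u'" x] u by (simp add: \<phi>u)
    show "seq_close l V v v'" if "seq_close k U u u'"
      by (rule seq_close_transfer[OF U V \<Theta> UV u v _ that]) (simp add: *)
    \<comment> \<open>The converse is the same transfer for the inverse of \<open>\<Theta>\<close>,
      with \<open>U\<close> and \<open>V\<close> exchanged.\<close>
    have "class_in_ultrafilter x V \<longleftrightarrow> class_in_ultrafilter (inv_into UNIV \<Theta> x) U" for x
      by (simp add: UV surj_f_inv_f[OF bij_is_surj[OF bij]])
    moreover have "eq_along k (inv_into UNIV \<Theta> x) (?K u) (?K u')" if "eq_along l x (?L v) (?L v')" for x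
      using that by (simp add: * surj_f_inv_f[OF bij_is_surj[OF bij]])
    ultimately show "seq_close k U u u'" if "seq_close l V v v'"
      using seq_close_transfer[OF V U boolean_automorphism_inv[OF \<Theta>] _ v u _ that] by blast
  qed
  \<comment> \<open>The lift \<open>f\<close> chosen from this need not be multiplicative; its class
    \<open>h\<close> modulo \<open>V\<close> is, because \<open>h_eq\<close> allows any other
    representative of the image.\<close>
  have "\<exists>v. v \<in> carrier (unitary_seqs l) \<and> \<phi> (?K u) = ?L v" if "u \<in> carrier (unitary_seqs k)" for u
    using hom_closed[of "?K u"] that by (auto simp: carrier_U_HS)
  then obtain f where f: "\<And>u. u \<in> carrier (unitary_seqs k) \<Longrightarrow> f u \<in> carrier (unitary_seqs l)"
    "\<And>u. u \<in> carrier (unitary_seqs k) \<Longrightarrow> \<phi> (?K u) = ?L (f u)" by metis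
  define h where "h u = seq_class l V (f u)" for u
  have h_eq: "h u = seq_class l V v"
    if "u \<in> carrier (unitary_seqs k)" "v \<in> carrier (unitary_seqs l)" "\<phi> (?K u) = ?L v" for u v
    using close_iff[OF that(1,1) f(1)[OF that(1)] that(2) f(2)[OF that(1)] that(3)] that f(1)
    by (simp add: h_def seq_class_eq_iff)
  have h_iff: "h u = h u' \<longleftrightarrow> seq_class k U u = seq_class k U u'"
    if "u \<in> carrier (unitary_seqs k)" "u' \<in> carrier (unitary_seqs k)" for u u'
    using close_iff[OF that f(1)[OF that(1)] f(1)[OF that(2)] f(2)[OF that(1)] f(2)[OF that(2)]] that f(1)
    by (simp add: h_def seq_class_eq_iff)
  have hom: "h \<in> hom (unitary_seqs k) (metric_ultraproduct l V)"
  proof (rule homI)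
    show "h u \<in> carrier (metric_ultraproduct l V)" if "u \<in> carrier (unitary_seqs k)" for u
      using f(1)[OF that] by (auto simp: h_def carrier_metric_ultraproduct)
    fix u u' assume u: "u \<in> carrier (unitary_seqs k)" "u' \<in> carrier (unitary_seqs k)"
    have "\<phi> (?K (\<lambda>n. u n * u' n)) = ?L (\<lambda>n. f u n * f u' n)"
      using hom_mult[of "?K u" "?K u'"] u f by (simp add: mult_U_HS)
    then have "h (\<lambda>n. u n * u' n) = seq_class l V (\<lambda>n. f u n * f u' n)"
      using u f(1) by (intro h_eq) auto
    then show "h (u \<otimes>\<^bsub>unitary_seqs k\<^esub> u') = h u \<otimes>\<^bsub>metric_ultraproduct l V\<^esub> h u'"
      using u f(1) by (simp add: h_def mult_metric_ultraproduct)
  qed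
  have "h u = h u'" if "u \<in> carrier (unitary_seqs k)" "u' \<in> carrier (unitary_seqs k)"
    "null_seqs k U #>\<^bsub>unitary_seqs k\<^esub> u = null_seqs k U #>\<^bsub>unitary_seqs k\<^esub> u'" for u u'
    using that h_iff by (simp add: seq_class_def)
  then obtain g where g: "g \<in> hom (unitary_seqs k Mod null_seqs k U) (metric_ultraproduct l V)"
    "\<And>u. u \<in> carrier (unitary_seqs k) \<Longrightarrow> g (null_seqs k U #>\<^bsub>unitary_seqs k\<^esub> u) = h u"
    using FactGroup_universal[OF hom null_seqs_normal] by blast
  have g': "g (seq_class k U u) = h u" if "u \<in> carrier (unitary_seqs k)" for u
    using g(2)[OF that] by (simp add: seq_class_def)
  have "inj_on g (carrier (metric_ultraproduct k U))"
    by (auto simp: inj_on_def carrier_metric_ultraproduct g' h_iff)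
  moreover have "g ` carrier (metric_ultraproduct k U) = carrier (metric_ultraproduct l V)"
  proof
    show "g ` carrier (metric_ultraproduct k U) \<subseteq> carrier (metric_ultraproduct l V)"
      using f(1) by (auto simp: carrier_metric_ultraproduct g' h_def)
    have "seq_class l V v \<in> g ` carrier (metric_ultraproduct k U)" if v: "v \<in> carrier (unitary_seqs l)" for v
    proof -
      have "?L v \<in> \<phi> ` carrier (U_HS k)"
        using \<phi> v by (simp add: iso_def bij_betw_def)
      then obtain u where u: "u \<in> carrier (unitary_seqs k)" "\<phi> (?K u) = ?L v"
        by (auto simp: carrier_U_HS)
      then have "g (seq_class k U u) = seq_class l V v" using v by (simp add: g' h_eq)
      then show ?thesis using u(1) by (force simp: carrier_metric_ultraproduct)
    qed
    then show "carrier (metric_ultraproduct l V) \<subseteq> g ` carrier (metric_ultraproduct k U)"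
      by (auto simp: carrier_metric_ultraproduct[of l])
  qed
  ultimately have "g \<in> iso (metric_ultraproduct k U) (metric_ultraproduct l V)"
    using g(1) by (simp add: iso_def bij_betw_def metric_ultraproduct_def)
  then show ?thesis using g' h_eq by (intro bexI[of _ g]) auto
qed

theorem theorem4p4:
  fixes k l :: "nat \<Rightarrow> nat"
    and \<phi> :: "(nat \<Rightarrow> complex mat) set \<Rightarrow> (nat \<Rightarrow> complex mat) set"
  assumes "\<forall>n. 0 < k n" and "\<forall>n. 0 < l n"
    and "filterlim k at_top sequentially" and "filterlim l at_top sequentially"
    and "\<phi> \<in> iso (U_HS k) (U_HS l)"
  shows "\<exists>\<theta> \<Theta>.
    homeomorphic_map stone_cech_boundary stone_cech_boundary \<theta> \<and> stone_dual \<theta> \<Theta> \<and>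
    (\<forall>a\<in>carrier (U_HS k). \<forall>b\<in>carrier (U_HS k). \<forall>S. infinite S \<longrightarrow>
       (eq_along k (class_mod_fin S) a b \<longleftrightarrow> eq_along l (\<Theta> (class_mod_fin S)) (\<phi> a) (\<phi> b))) \<and>
    (\<forall>U\<in>topspace stone_cech_boundary.
       let V = inv_into (topspace stone_cech_boundary) \<theta> U in
       \<exists>\<phi>\<^sub>U\<in>iso (metric_ultraproduct k U) (metric_ultraproduct l V).
         \<forall>u\<in>carrier (unitary_seqs k). \<forall>v\<in>carrier (unitary_seqs l).
           \<phi> (seq_class k sequentially u) = seq_class l sequentially v \<longrightarrow>
           \<phi>\<^sub>U (seq_class k U u) = seq_class l V v)"
proof -
  obtain \<Theta> where \<Theta>: "boolean_automorphism \<Theta>" and img: "\<And>x. \<phi> ` trivial_on k x = trivial_on l (\<Theta> x)"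
    using iso_induces_order_iso[OF _ assms(3) _ assms(4,5)] assms(1,2) by blast
  note eq = eq_along_iso_iff[OF assms(5) img]
  let ?X = "topspace stone_cech_boundary" and ?\<theta> = "stone_map \<Theta>"
  have homeo: "homeomorphic_map stone_cech_boundary stone_cech_boundary ?\<theta>"
    by (rule homeomorphic_map_stone_map[OF \<Theta>])
  have dual: "stone_dual ?\<theta> \<Theta>"
    unfolding stone_dual_def using \<Theta> class_in_stone_map_iff[OF _ \<Theta>] by blast
  have "let V = inv_into ?X ?\<theta> U in
       \<exists>\<phi>\<^sub>U\<in>iso (metric_ultraproduct k U) (metric_ultraproduct l V).
         \<forall>u\<in>carrier (unitary_seqs k). \<forall>v\<in>carrier (unitary_seqs l).
           \<phi> (seq_class k sequentially u) = seq_class l sequentially v \<longrightarrow>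
           \<phi>\<^sub>U (seq_class k U u) = seq_class l V v" if U: "U \<in> ?X" for U
  proof -
    \<comment> \<open>The filter \<open>V\<close> is the preimage of \<open>U\<close> under
      \<open>?\<theta>\<close>, so the duality at \<open>V\<close> becomes the correspondence
      between \<open>U\<close> and \<open>V\<close> that \<open>iso_induces_ultraproduct_iso\<close>
      requires.\<close>
    have U': "U \<in> ?\<theta> ` ?X" using U homeomorphic_imp_surjective_map[OF homeo] by simp
    have V: "inv_into ?X ?\<theta> U \<in> ?X" by (rule inv_into_into[OF U'])
    show ?thesis
      unfolding Let_def
      using class_in_stone_map_iff[OF V \<Theta>] f_inv_into_f[OF U']
      by (intro iso_induces_ultraproduct_iso[OF assms(5) \<Theta> eq U V]) auto
  qed
  then show ?thesis
    using homeo dual eq by (intro exI[of _ ?\<theta>] exI[of _ \<Theta>]) blast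
qed

end
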